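(* Let $N\ge 2$ and let $(S_i)_{i\in\mathbb{Z}_N}$ be a representation of the Cuntz algebra $\mathcal{O}_N$ on a Hilbert space $\mathcal{H}$. The representation is monic if and only if it is unitarily equivalent to a representation associated to a monic system.
   Context: Let $\mathbb{Z}_N=\{0,1,\dots,N-1\}$. A representation of $\mathcal{O}_N$ on a Hilbert space $\mathcal{H}$ is a family of isometries $(S_i)_{i\in\mathbb{Z}_N}$ on $\mathcal{H}$ with $S_i^*S_j=\delta_{ij}I$ and $\sum_{i\in\mathbb{Z}_N}S_iS_i^*=I$. For a finite word $I=i_1\dots i_n$ with letters in $\mathbb{Z}_N$, $S_I:=S_{i_1}\cdots S_{i_n}$. The representation is called monic if there is a vector $\varphi\in\mathcal{H}$ such that the closed linear span of $\{S_IS_I^*\varphi : I \text{ a finite word}\}$ is $\mathcal{H}$. Let $\mathcal{K}_N=\prod_1^\infty\mathbb{Z}_N$ be the compact space of infinite words $\omega_1\omega_2\dots$ (product topology), $\sigma(\omega_1\omega_2\dots)=\omega_2\omega_3\dots$ the shift, and $\sigma_i(\omega_1\omega_2\dots)=i\omega_1\omega_2\dots$ for $i\in\mathbb{Z}_N$. For a measure $\mu$, $\mu\circ\sigma_i^{-1}$ denotes the push-forward $A\mapsto\mu(\sigma_i^{-1}(A))$. A monic system is a pair $(\mu,(f_i)_{i\in\mathbb{Z}_N})$ where $\mu$ is a finite Borel measure on $\mathcal{K}_N$ with $\mu\circ\sigma_i^{-1}\ll\mu$ for all $i$, and $f_i\in L^2(\mu)$ (complex-valued) are functions such that $\frac{d(\mu\circ\sigma_i^{-1})}{d\mu}=|f_i|^2$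 and $f_i(x)\ne0$ for $\mu$-a.e. $x\in\sigma_i(\mathcal{K}_N)$. The representation of $\mathcal{O}_N$ associated to the monic system is the one on $L^2(\mu)$ given by $S_if=f_i\,(f\circ\sigma)$ for $i\in\mathbb{Z}_N$, $f\in L^2(\mu)$. Unitary equivalence of representations $(S_i)$ on $\mathcal{H}$ and $(S_i')$ on $\mathcal{H}'$ means there is a unitary $W:\mathcal{H}'\to\mathcal{H}$ with $S_iW=WS_i'$ for all $i$. *)

theory Defs
  imports "HOL-Analysis.Analysis"
begin

section \<open>Complex Hilbert spaces\<close>

text \<open>The norm and the metric are those of the underlying real inner product space, whose
  inner product is the real part of \<open>cinner\<close>.  The inner product \<open>cinner\<close> is conjugate
  linear in the first argument.\<close>

class complex_inner = real_inner +
  fixes scaleC :: "complex \<Rightarrow> 'a \<Rightarrow> 'a"  (infixr \<open>*\<^sub>C\<close> 75)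
    and cinner :: "'a \<Rightarrow> 'a \<Rightarrow> complex"
  assumes scaleC_add_right: "a *\<^sub>C (x + y) = a *\<^sub>C x + a *\<^sub>C y"
    and scaleC_add_left: "(a + b) *\<^sub>C x = a *\<^sub>C x + b *\<^sub>C x"
    and scaleC_scaleC: "a *\<^sub>C b *\<^sub>C x = (a * b) *\<^sub>C x"
    and scaleR_scaleC: "r *\<^sub>R x = complex_of_real r *\<^sub>C x"
    and cinner_commute: "cinner x y = cnj (cinner y x)"
    and cinner_add_right: "cinner x (y + z) = cinner x y + cinner x z"
    and cinner_scaleC_right: "cinner x (a *\<^sub>C y) = a * cinner x y"
    and inner_eq_Re_cinner: "inner x y = Re (cinner x y)"

class chilbert_space = complex_inner + complete_space

lemma vector_space_scaleC: "vector_space (scaleC :: complex \<Rightarrow> 'a \<Rightarrow> 'a::complex_inner)"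
proof
  fix x :: 'a
  show "1 *\<^sub>C x = x"
    using scaleR_scaleC[of 1 x] by simp
qed (simp_all add: scaleC_add_right scaleC_add_left scaleC_scaleC)

abbreviation cspan :: "'a::complex_inner set \<Rightarrow> 'a set"
  where "cspan \<equiv> module.span scaleC"

definition cadjoint :: "('a::complex_inner \<Rightarrow> 'a) \<Rightarrow> 'a \<Rightarrow> 'a"
  where "cadjoint T = (THE T'. \<forall>x y. cinner (T' x) y = cinner x (T y))"

definition linear_isometry :: "('a::complex_inner \<Rightarrow> 'a) \<Rightarrow> bool"
  where "linear_isometry T \<longleftrightarrow>
    Vector_Spaces.linear scaleC scaleC T \<and> (\<forall>x. norm (T x) = norm x)"


section \<open>Representations of the Cuntz algebra\<close>

text \<open>The letters are the natural numbers below \<open>N\<close>; only the values \<open>S i\<close> with \<open>i < N\<close>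
  matter.\<close>

definition cuntz_rep :: "nat \<Rightarrow> (nat \<Rightarrow> 'a::chilbert_space \<Rightarrow> 'a) \<Rightarrow> bool"
  where "cuntz_rep N S \<longleftrightarrow>
    (\<forall>i<N. linear_isometry (S i)) \<and>
    (\<forall>i<N. \<forall>j<N. \<forall>x. cadjoint (S i) (S j x) = (if i = j then x else 0)) \<and>
    (\<forall>x. (\<Sum>i<N. S i (cadjoint (S i) x)) = x)"

definition word_op :: "(nat \<Rightarrow> 'a \<Rightarrow> 'a) \<Rightarrow> nat list \<Rightarrow> 'a \<Rightarrow> 'a"
  where "word_op S I = foldr (\<lambda>i T. S i \<circ> T) I id"

definition monic_rep :: "nat \<Rightarrow> (nat \<Rightarrow> 'a::chilbert_space \<Rightarrow> 'a) \<Rightarrow> bool"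
  where "monic_rep N S \<longleftrightarrow>
    (\<exists>\<phi>. closure (cspan {word_op S I (cadjoint (word_op S I) \<phi>) | I. set I \<subseteq> {..<N}}) = UNIV)"


section \<open>Unitary equivalence\<close>

text \<open>The space \<open>L\<^sup>2(\<mu>)\<close> depends on the value \<open>\<mu>\<close> and hence is not a type.  In order to compare
  it with a Hilbert space given by a type, inner product spaces are also presented as
  records with an explicit carrier.\<close>

record 'v cspace =
  vectors :: "'v set"
  add_op :: "'v \<Rightarrow> 'v \<Rightarrow> 'v"
  scale_op :: "complex \<Rightarrow> 'v \<Rightarrow> 'v"
  inner_op :: "'v \<Rightarrow> 'v \<Rightarrow> complex"

definition type_space :: "'a::complex_inner cspace"
  where "type_space =
    \<lparr>vectors = UNIV, add_op = (+), scale_op = scaleC, inner_op = cinner\<rparr>"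

definition unitary_map :: "'v cspace \<Rightarrow> 'w cspace \<Rightarrow> ('v \<Rightarrow> 'w) \<Rightarrow> bool"
  where "unitary_map V V' W \<longleftrightarrow>
    bij_betw W (vectors V) (vectors V') \<and>
    (\<forall>x\<in>vectors V. \<forall>y\<in>vectors V. W (add_op V x y) = add_op V' (W x) (W y)) \<and>
    (\<forall>c. \<forall>x\<in>vectors V. W (scale_op V c x) = scale_op V' c (W x)) \<and>
    (\<forall>x\<in>vectors V. \<forall>y\<in>vectors V. inner_op V' (W x) (W y) = inner_op V x y)"

definition unitarily_equivalent ::
    "nat \<Rightarrow> 'v cspace \<Rightarrow> (nat \<Rightarrow> 'v \<Rightarrow> 'v) \<Rightarrow> 'w cspace \<Rightarrow> (nat \<Rightarrow> 'w \<Rightarrow> 'w) \<Rightarrow> bool"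
  where "unitarily_equivalent N V S V' S' \<longleftrightarrow>
    (\<exists>W. unitary_map V' V W \<and> (\<forall>i<N. \<forall>x\<in>vectors V'. S i (W x) = W (S' i x)))"


section \<open>The Hilbert space of square integrable functions\<close>

definition sq_integrable :: "'x measure \<Rightarrow> ('x \<Rightarrow> complex) set"
  where "sq_integrable \<mu> =
    {f \<in> borel_measurable \<mu>. integrable \<mu> (\<lambda>x. (cmod (f x))\<^sup>2)}"

definition ae_rel :: "'x measure \<Rightarrow> (('x \<Rightarrow> complex) \<times> ('x \<Rightarrow> complex)) set"
  where "ae_rel \<mu> =
    {(f, g). f \<in> sq_integrable \<mu> \<and> g \<in> sq_integrable \<mu> \<and> (AE x in \<mu>. f x = g x)}"

abbreviation ae_class :: "'x measure \<Rightarrow> ('x \<Rightarrow> complex) \<Rightarrow> ('x \<Rightarrow> complex) set"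
  where "ae_class \<mu> f \<equiv> ae_rel \<mu> `` {f}"

definition L2 :: "'x measure \<Rightarrow> ('x \<Rightarrow> complex) set cspace"
  where "L2 \<mu> =
    \<lparr>vectors = sq_integrable \<mu> // ae_rel \<mu>,
     add_op = (\<lambda>A B. \<Union>f\<in>A. \<Union>g\<in>B. ae_class \<mu> (\<lambda>x. f x + g x)),
     scale_op = (\<lambda>c A. \<Union>f\<in>A. ae_class \<mu> (\<lambda>x. c * f x)),
     inner_op = (\<lambda>A B. the_elem (\<Union>f\<in>A. \<Union>g\<in>B. {\<integral>x. cnj (f x) * g x \<partial>\<mu>}))\<rparr>"


section \<open>Infinite words and monic systems\<close>

definition word_topology :: "nat \<Rightarrow> (nat \<Rightarrow> nat) topology"
  where "word_topology N = product_topology (\<lambda>_. discrete_topology {..<N}) UNIV"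

abbreviation infinite_words :: "nat \<Rightarrow> (nat \<Rightarrow> nat) set"
  where "infinite_words N \<equiv> topspace (word_topology N)"

definition word_borel :: "nat \<Rightarrow> (nat \<Rightarrow> nat) measure"
  where "word_borel N = sigma (infinite_words N) {U. openin (word_topology N) U}"

definition shift :: "(nat \<Rightarrow> nat) \<Rightarrow> nat \<Rightarrow> nat"
  where "shift w = (\<lambda>n. w (Suc n))"

definition prepend :: "nat \<Rightarrow> (nat \<Rightarrow> nat) \<Rightarrow> nat \<Rightarrow> nat"
  where "prepend i w = case_nat i w"

definition monic_system ::
    "nat \<Rightarrow> (nat \<Rightarrow> nat) measure \<Rightarrow> (nat \<Rightarrow> (nat \<Rightarrow> nat) \<Rightarrow> complex) \<Rightarrow> bool"
  where "monic_system N \<mu> f \<longleftrightarrow>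
    finite_measure \<mu> \<and> sets \<mu> = sets (word_borel N) \<and>
    (\<forall>i<N.
      absolutely_continuous \<mu> (distr \<mu> \<mu> (prepend i)) \<and>
      f i \<in> sq_integrable \<mu> \<and>
      (AE x in \<mu>. RN_deriv \<mu> (distr \<mu> \<mu> (prepend i)) x = ennreal ((cmod (f i x))\<^sup>2)) \<and>
      (AE x in \<mu>. x \<in> prepend i ` infinite_words N \<longrightarrow> f i x \<noteq> 0))"

definition monic_system_op ::
    "(nat \<Rightarrow> nat) measure \<Rightarrow> (nat \<Rightarrow> (nat \<Rightarrow> nat) \<Rightarrow> complex) \<Rightarrow>
     nat \<Rightarrow> ((nat \<Rightarrow> nat) \<Rightarrow> complex) set \<Rightarrow> ((nat \<Rightarrow> nat) \<Rightarrow> complex) set"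
  where "monic_system_op \<mu> f i A = (\<Union>g\<in>A. ae_class \<mu> (\<lambda>x. f i x * g (shift x)))"


section \<open>The operations on classes are well defined\<close>

lemma sq_integrable_add:
  assumes "f \<in> sq_integrable \<mu>" "g \<in> sq_integrable \<mu>"
  shows "(\<lambda>x. f x + g x) \<in> sq_integrable \<mu>"
proof -
  have [measurable]: "f \<in> borel_measurable \<mu>" "g \<in> borel_measurable \<mu>"
    using assms by (auto simp: sq_integrable_def)
  have "integrable \<mu> (\<lambda>x. (cmod (f x + g x))\<^sup>2)"
  proof (rule Bochner_Integration.integrable_bound)
    show "integrable \<mu> (\<lambda>x. 2 * (cmod (f x))\<^sup>2 + 2 * (cmod (g x))\<^sup>2)"
      using assms by (auto simp: sq_integrable_def)
    have "(cmod (a + b))\<^sup>2 \<le> 2 * (cmod a)\<^sup>2 + 2 * (cmod b)\<^sup>2" for a b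
    proof -
      have "(cmod (a + b))\<^sup>2 \<le> (cmod a + cmod b)\<^sup>2"
        by (intro power_mono norm_triangle_ineq) auto
      also have "\<dots> \<le> 2 * (cmod a)\<^sup>2 + 2 * (cmod b)\<^sup>2"
        using zero_le_power2[of "cmod a - cmod b"] by (simp add: power2_sum power2_diff)
      finally show ?thesis .
    qed
    then show "AE x in \<mu>. norm ((cmod (f x + g x))\<^sup>2) \<le>
        norm (2 * (cmod (f x))\<^sup>2 + 2 * (cmod (g x))\<^sup>2)"
      by auto
  qed simp
  then show ?thesis by (simp add: sq_integrable_def)
qed

lemma sq_integrable_scale:
  "f \<in> sq_integrable \<mu> \<Longrightarrow> (\<lambda>x. c * f x) \<in> sq_integrable \<mu>"
  by (auto simp: sq_integrable_def norm_mult power_mult_distrib)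

lemma equiv_ae_rel: "equiv (sq_integrable \<mu>) (ae_rel \<mu>)"
proof (rule equivI)
  show "ae_rel \<mu> \<subseteq> sq_integrable \<mu> \<times> sq_integrable \<mu>" by (auto simp: ae_rel_def)
  show "refl_on (sq_integrable \<mu>) (ae_rel \<mu>)" by (auto simp: refl_on_def ae_rel_def)
  show "sym (ae_rel \<mu>)" by (auto simp: sym_def ae_rel_def elim: AE_mp)
  show "trans (ae_rel \<mu>)"
  proof (rule transI)
    fix f g h assume "(f, g) \<in> ae_rel \<mu>" "(g, h) \<in> ae_rel \<mu>"
    then show "(f, h) \<in> ae_rel \<mu>" unfolding ae_rel_def by auto
  qed
qed

lemma ae_class_eq_iff:
  assumes "f \<in> sq_integrable \<mu>" "g \<in> sq_integrable \<mu>"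
  shows "ae_class \<mu> f = ae_class \<mu> g \<longleftrightarrow> (AE x in \<mu>. f x = g x)"
  using eq_equiv_class_iff[OF equiv_ae_rel assms] assms by (auto simp: ae_rel_def)

lemma L2_vectors: "vectors (L2 \<mu>) = ae_class \<mu> ` sq_integrable \<mu>"
  by (auto simp: L2_def quotient_def)

lemma L2_add:
  assumes "f \<in> sq_integrable \<mu>" "g \<in> sq_integrable \<mu>"
  shows "add_op (L2 \<mu>) (ae_class \<mu> f) (ae_class \<mu> g) = ae_class \<mu> (\<lambda>x. f x + g x)"
proof -
  have "congruent2 (ae_rel \<mu>) (ae_rel \<mu>) (\<lambda>f g. ae_class \<mu> (\<lambda>x. f x + g x))"
  proof (rule congruent2I')
    fix f f' g g' assume *: "(f, f') \<in> ae_rel \<mu>" "(g, g') \<in> ae_rel \<mu>"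
    then have "AE x in \<mu>. f x + g x = f' x + g' x" unfolding ae_rel_def by auto
    then show "ae_class \<mu> (\<lambda>x. f x + g x) = ae_class \<mu> (\<lambda>x. f' x + g' x)"
      using * by (subst ae_class_eq_iff) (auto simp: ae_rel_def intro!: sq_integrable_add)
  qed
  from UN_equiv_class2[OF equiv_ae_rel equiv_ae_rel this assms] show ?thesis
    by (simp add: L2_def)
qed

lemma L2_scale:
  assumes "f \<in> sq_integrable \<mu>"
  shows "scale_op (L2 \<mu>) c (ae_class \<mu> f) = ae_class \<mu> (\<lambda>x. c * f x)"
proof -
  have "congruent (ae_rel \<mu>) (\<lambda>f. ae_class \<mu> (\<lambda>x. c * f x))"
  proof (rule congruentI)
    fix f f' assume *: "(f, f') \<in> ae_rel \<mu>"
    then have "AE x in \<mu>. c * f x = c * f' x" unfolding ae_rel_def by auto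
    then show "ae_class \<mu> (\<lambda>x. c * f x) = ae_class \<mu> (\<lambda>x. c * f' x)"
      using * by (subst ae_class_eq_iff) (auto simp: ae_rel_def intro!: sq_integrable_scale)
  qed
  from UN_equiv_class[OF equiv_ae_rel this assms] show ?thesis
    by (simp add: L2_def)
qed

lemma L2_inner:
  assumes "f \<in> sq_integrable \<mu>" "g \<in> sq_integrable \<mu>"
  shows "inner_op (L2 \<mu>) (ae_class \<mu> f) (ae_class \<mu> g) = (\<integral>x. cnj (f x) * g x \<partial>\<mu>)"
proof -
  have "congruent2 (ae_rel \<mu>) (ae_rel \<mu>) (\<lambda>f g. {\<integral>x. cnj (f x) * g x \<partial>\<mu>})"
  proof (rule congruent2I')
    fix f f' g g' assume *: "(f, f') \<in> ae_rel \<mu>" "(g, g') \<in> ae_rel \<mu>"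
    then have [measurable]: "f \<in> borel_measurable \<mu>" "f' \<in> borel_measurable \<mu>"
      "g \<in> borel_measurable \<mu>" "g' \<in> borel_measurable \<mu>"
      by (auto simp: ae_rel_def sq_integrable_def)
    have "AE x in \<mu>. cnj (f x) * g x = cnj (f' x) * g' x"
      using * unfolding ae_rel_def by auto
    moreover have [measurable]: "cnj \<in> borel_measurable borel"
      by (intro borel_measurable_continuous_onI continuous_intros)
    ultimately show "{\<integral>x. cnj (f x) * g x \<partial>\<mu>} = {\<integral>x. cnj (f' x) * g' x \<partial>\<mu>}"
      by (auto intro!: integral_cong_AE)
  qed
  from UN_equiv_class2[OF equiv_ae_rel equiv_ae_rel this assms] show ?thesis
    by (simp add: L2_def)
qed

lemma infinite_words_eq: "infinite_words N = {w. \<forall>n. w n < N}"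
  by (auto simp: word_topology_def PiE_def Pi_def)

lemma space_word_borel [simp]: "space (word_borel N) = infinite_words N"
  by (simp add: word_borel_def space_measure_of_conv)

lemma measurable_word_borel:
  assumes "continuous_map (word_topology N) (word_topology N) T"
  shows "T \<in> word_borel N \<rightarrow>\<^sub>M word_borel N"
proof -
  have *: "{U. openin (word_topology N) U} \<subseteq> Pow (infinite_words N)"
    by (auto dest: openin_subset)
  show ?thesis
    unfolding word_borel_def[of N]
  proof (rule measurable_measure_of[OF *], goal_cases)
    case 1
    show ?case
      using continuous_map_image_subset_topspace[OF assms] *
      by (auto simp: space_measure_of)
  next
    case (2 U)
    then have "openin (word_topology N) {x \<in> infinite_words N. T x \<in> U}"
      using assms by (auto simp: continuous_map_def)
    moreover have "T -` U \<inter> infinite_words N = {x \<in> infinite_words N. T x \<in> U}"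
      by auto
    ultimately show ?case
      using * by (auto simp: space_measure_of sets_measure_of)
  qed
qed

lemma measurable_shift: "shift \<in> word_borel N \<rightarrow>\<^sub>M word_borel N"
proof (rule measurable_word_borel)
  have "continuous_map (word_topology N) (discrete_topology {..<N}) (\<lambda>w. w (Suc n))" for n
    unfolding word_topology_def by (rule continuous_map_product_projection) simp
  then show "continuous_map (word_topology N) (word_topology N) shift"
    unfolding word_topology_def[of N] by (auto simp: continuous_map_componentwise_UNIV shift_def)
qed

lemma measurable_prepend:
  assumes "i < N"
  shows "prepend i \<in> word_borel N \<rightarrow>\<^sub>M word_borel N"
proof (rule measurable_word_borel)
  have "continuous_map (word_topology N) (discrete_topology {..<N}) (\<lambda>w. prepend i w n)" for n
  proof (cases n)
    case 0
    then show ?thesis using assms by (simp add: prepend_def)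
  next
    case (Suc m)
    have "continuous_map (word_topology N) (discrete_topology {..<N}) (\<lambda>w. w m)"
      unfolding word_topology_def by (rule continuous_map_product_projection) simp
    then show ?thesis using Suc by (simp add: prepend_def)
  qed
  then show "continuous_map (word_topology N) (word_topology N) (prepend i)"
    unfolding word_topology_def[of N] by (auto simp: continuous_map_componentwise_UNIV)
qed

lemma shift_prepend [simp]: "shift (prepend i w) = w"
  by (simp add: shift_def prepend_def)

lemma nn_integral_monic_system:
  assumes "monic_system N \<mu> f" "i < N"
    and [measurable]: "h \<in> borel_measurable \<mu>"
  shows "(\<integral>\<^sup>+x. ennreal ((cmod (f i x))\<^sup>2) * h (shift x) \<partial>\<mu>) = (\<integral>\<^sup>+x. h x \<partial>\<mu>)"
proof -
  interpret finite_measure \<mu> using assms by (simp add: monic_system_def)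
  let ?\<nu> = "distr \<mu> \<mu> (prepend i)"
  have s: "sets \<mu> = sets (word_borel N)"
    and ac: "absolutely_continuous \<mu> ?\<nu>"
    and rn: "AE x in \<mu>. RN_deriv \<mu> ?\<nu> x = ennreal ((cmod (f i x))\<^sup>2)"
    using assms by (auto simp: monic_system_def)
  have [measurable]: "shift \<in> \<mu> \<rightarrow>\<^sub>M \<mu>" "prepend i \<in> \<mu> \<rightarrow>\<^sub>M \<mu>"
    using measurable_shift measurable_prepend[OF assms(2)]
    by (simp_all add: measurable_cong_sets[OF s s])
  have "(\<integral>\<^sup>+x. ennreal ((cmod (f i x))\<^sup>2) * h (shift x) \<partial>\<mu>) =
      (\<integral>\<^sup>+x. RN_deriv \<mu> ?\<nu> x * h (shift x) \<partial>\<mu>)"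
    using rn by (intro nn_integral_cong_AE) auto
  also have "\<dots> = (\<integral>\<^sup>+x. h (shift x) \<partial>?\<nu>)"
    by (rule RN_deriv_nn_integral[symmetric, OF ac]) auto
  also have "\<dots> = (\<integral>\<^sup>+x. h x \<partial>\<mu>)"
    by (subst nn_integral_distr) auto
  finally show ?thesis .
qed

lemma monic_system_op_sq_integrable:
  assumes "monic_system N \<mu> f" "i < N" "g \<in> sq_integrable \<mu>"
  shows "(\<lambda>x. f i x * g (shift x)) \<in> sq_integrable \<mu>"
proof -
  have s: "sets \<mu> = sets (word_borel N)"
    using assms by (auto simp: monic_system_def)
  have [measurable]: "shift \<in> \<mu> \<rightarrow>\<^sub>M \<mu>"
    using measurable_shift by (simp add: measurable_cong_sets[OF s s])
  have [measurable]: "f i \<in> borel_measurable \<mu>" "g \<in> borel_measurable \<mu>"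
    using assms by (auto simp: monic_system_def sq_integrable_def)
  have "(\<integral>\<^sup>+x. ennreal ((cmod (f i x))\<^sup>2) * ennreal ((cmod (g (shift x)))\<^sup>2) \<partial>\<mu>) =
      (\<integral>\<^sup>+x. ennreal ((cmod (g x))\<^sup>2) \<partial>\<mu>)"
    by (rule nn_integral_monic_system[OF assms(1,2)]) simp
  moreover have "(\<integral>\<^sup>+x. ennreal ((cmod (g x))\<^sup>2) \<partial>\<mu>) < \<infinity>"
    using assms(3) by (auto simp: sq_integrable_def integrable_iff_bounded)
  ultimately show ?thesis
    by (simp add: sq_integrable_def integrable_iff_bounded norm_mult power_mult_distrib
        ennreal_mult)
qed

lemma monic_system_op_ae_class:
  assumes "monic_system N \<mu> f" "i < N" "g \<in> sq_integrable \<mu>"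
  shows "monic_system_op \<mu> f i (ae_class \<mu> g) = ae_class \<mu> (\<lambda>x. f i x * g (shift x))"
proof -
  have s: "sets \<mu> = sets (word_borel N)"
    using assms by (auto simp: monic_system_def)
  have [measurable]: "shift \<in> \<mu> \<rightarrow>\<^sub>M \<mu>"
    using measurable_shift by (simp add: measurable_cong_sets[OF s s])
  have [measurable]: "f i \<in> borel_measurable \<mu>"
    using assms by (auto simp: monic_system_def sq_integrable_def)
  have "congruent (ae_rel \<mu>) (\<lambda>g. ae_class \<mu> (\<lambda>x. f i x * g (shift x)))"
  proof (rule congruentI)
    fix g g' assume *: "(g, g') \<in> ae_rel \<mu>"
    then have g: "g \<in> sq_integrable \<mu>" "g' \<in> sq_integrable \<mu>" and ae: "AE x in \<mu>. g x = g' x"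
      by (auto simp: ae_rel_def)
    then have [measurable]: "g \<in> borel_measurable \<mu>" "g' \<in> borel_measurable \<mu>"
      by (auto simp: sq_integrable_def)
    let ?h = "\<lambda>x. ennreal (cmod (g x - g' x))"
    have "(\<integral>\<^sup>+x. ennreal ((cmod (f i x))\<^sup>2) * ?h (shift x) \<partial>\<mu>) = (\<integral>\<^sup>+x. ?h x \<partial>\<mu>)"
      by (rule nn_integral_monic_system[OF assms(1,2)]) simp
    also have "\<dots> = (\<integral>\<^sup>+x. 0 \<partial>\<mu>)"
      using ae by (intro nn_integral_cong_AE) auto
    finally have "AE x in \<mu>. ennreal ((cmod (f i x))\<^sup>2) * ?h (shift x) = 0"
      using nn_integral_0_iff_AE[of "\<lambda>x. ennreal ((cmod (f i x))\<^sup>2) * ?h (shift x)" \<mu>] by simp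
    then have "AE x in \<mu>. f i x * g (shift x) = f i x * g' (shift x)"
      by (rule AE_mp) (auto simp: ennreal_eq_0_iff)
    then show "ae_class \<mu> (\<lambda>x. f i x * g (shift x)) = ae_class \<mu> (\<lambda>x. f i x * g' (shift x))"
      using g by (subst ae_class_eq_iff)
        (auto intro!: monic_system_op_sq_integrable[OF assms(1,2)])
  qed
  from UN_equiv_class[OF equiv_ae_rel this assms(3)] show ?thesis
    by (simp add: monic_system_op_def)
qed

end

theory Submission
  imports Defs
begin

text \<open>
  If \<open>\<phi>\<close> is cyclic for the commuting projections \<open>P\<^sub>I = S\<^sub>I S\<^sub>I\<^sup>*\<close>, the numbers \<open>\<parallel>P\<^sub>I \<phi>\<parallel>\<^sup>2\<close> are the
  values on cylinders of a measure \<open>\<mu>\<close>, by compactness of the space of words. The assignment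
  \<open>1\<^bsub>C(I)\<^esub> \<mapsto> P\<^sub>I \<phi>\<close> is isometric, and extends to a unitary \<open>L\<^sup>2(\<mu>) \<rightarrow> H\<close> since
  both sides have dense span and \<open>L\<^sup>2(\<mu>)\<close> is complete. It turns \<open>P\<^sub>I\<close> into multiplication by
  \<open>1\<^bsub>C(I)\<^esub>\<close>, and \<open>f\<^sub>i\<close> is the preimage of \<open>S\<^sub>i \<phi>\<close>. Conversely, in the representation of a monic
  system \<open>P\<^sub>I\<close> is multiplication by \<open>1\<^bsub>C(I)\<^esub>\<close>, because the summands of \<open>g = \<Sum>\<^sub>i S\<^sub>i S\<^sub>i\<^sup>* g\<close> live on the
  disjoint cylinders \<open>C(i)\<close>; hence the constant function \<open>1\<close> is cyclic.
\<close>

section \<open>Complex inner products and adjoints of isometries\<close>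

text \<open>Why the preimages \<open>f\<^sub>i\<close> of \<open>S\<^sub>i \<phi>\<close> form a
  monic system: the relation \<open>P\<^sub>i\<^sub>J S\<^sub>i = S\<^sub>i P\<^sub>J\<close> shows
  that \<open>|f\<^sub>i|\<^sup>2 d\<mu>\<close> and the push-forward of \<mu> agree on cylinders,
  hence on all Borel sets. Since \<open>S\<^sub>i S\<^sub>i\<^sup>*\<close> is multiplication by the
  indicator of \<open>C(i)\<close>, every square integrable function living on \<open>C(i)\<close>
  is in the range of \<open>S\<^sub>i\<close>, hence a multiple of \<open>f\<^sub>i\<close>; so
  \<open>f\<^sub>i\<close> cannot vanish on a part of \<open>C(i)\<close> of positive measure.

  The obstacle that shapes the proof is that the elements of L2(\<mu>) are classes of functions, and
  the space depends on the value \<mu>. The work is therefore done with functions and a squared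
  seminorm. Operator identities are verified on functions of finitely many letters and then passed
  to the limit, which is possible because all operators involved are contractions.\<close>

interpretation complex_vector: vector_space "scaleC :: complex \<Rightarrow> 'a \<Rightarrow> 'a::complex_inner"
  by (rule vector_space_scaleC)

lemma cinner_add_left: "cinner (x + y) z = cinner x z + cinner y z"
  by (metis cinner_add_right cinner_commute complex_cnj_add)

lemma cinner_scaleC_left: "cinner (a *\<^sub>C x) y = cnj a * cinner x y"
  by (metis cinner_commute cinner_scaleC_right complex_cnj_mult)

lemma cinner_zero_right [simp]: "cinner x 0 = 0"
  using cinner_scaleC_right[of x 0 x] by simp

lemma cinner_zero_left [simp]: "cinner 0 x = 0"
  using cinner_scaleC_left[of 0 x x] by simp

lemma cinner_minus_left [simp]: "cinner (- x) y = - cinner x y"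
  using cinner_scaleC_left[of "-1" x y] by simp

lemma cinner_diff_left: "cinner (x - y) z = cinner x z - cinner y z"
  using cinner_add_left[of x "- y" z] by simp

lemma cinner_sum_right: "cinner x (\<Sum>i\<in>A. f i) = (\<Sum>i\<in>A. cinner x (f i))"
  by (induction A rule: infinite_finite_induct) (auto simp: cinner_add_right)

lemma cinner_sum_left: "cinner (\<Sum>i\<in>A. f i) x = (\<Sum>i\<in>A. cinner (f i) x)"
  by (induction A rule: infinite_finite_induct) (auto simp: cinner_add_left)

lemma cinner_self: "cinner x x = complex_of_real ((norm x)\<^sup>2)"
proof -
  have "Im (cinner x x) = 0"
    using cinner_commute[of x x] by (metis cnj.simps(2) equal_neg_zero)
  then show ?thesis
    by (simp add: complex_eq_iff power2_norm_eq_inner inner_eq_Re_cinner)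
qed

lemma cinner_self_eq_0: "cinner x x = 0 \<longleftrightarrow> x = 0"
  by (simp add: cinner_self)

lemma cinner_eqI:
  assumes "\<And>y. cinner x y = cinner x' y"
  shows "x = x'"
proof -
  have "cinner (x - x') (x - x') = 0"
    using assms by (simp add: cinner_diff_left)
  then show ?thesis by (simp add: cinner_self_eq_0)
qed

text \<open>Only the real part of \<open>cinner\<close> is the real inner product; multiplication by
  \<open>\<i>\<close> makes the imaginary part accessible to the same real-valued facts.\<close>

lemma Im_cinner: "Im (cinner x y) = - inner x (\<i> *\<^sub>C y)"
  by (simp add: inner_eq_Re_cinner cinner_scaleC_right)

lemma norm_scaleC: "norm (c *\<^sub>C x) = cmod c * norm x"
proof -
  have "complex_of_real ((norm (c *\<^sub>C x))\<^sup>2) = (c * cnj c) * cinner x x"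
    by (simp only: cinner_self[symmetric] cinner_scaleC_left cinner_scaleC_right mult_ac)
  also have "\<dots> = complex_of_real ((cmod c * norm x)\<^sup>2)"
    by (simp only: complex_norm_square[symmetric] cinner_self power_mult_distrib of_real_mult)
  finally have "complex_of_real ((norm (c *\<^sub>C x))\<^sup>2) = complex_of_real ((cmod c * norm x)\<^sup>2)" .
  then have "(norm (c *\<^sub>C x))\<^sup>2 = (cmod c * norm x)\<^sup>2"
    using of_real_eq_iff by blast
  then show ?thesis by simp
qed

lemma bounded_bilinear_cinner: "bounded_bilinear (cinner :: 'a \<Rightarrow> 'a::complex_inner \<Rightarrow> complex)"
proof
  show "\<exists>K. \<forall>a b. norm (cinner a b :: complex) \<le> norm (a::'a) * norm b * K"
  \<comment> \<open>The constant 2 comes from bounding the real and the imaginary part separately by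
    the real Cauchy-Schwarz inequality.\<close>
  proof (intro exI[of _ 2] allI)
    fix a b :: 'a
    have "\<bar>Re (cinner a b)\<bar> \<le> norm a * norm b"
      using Cauchy_Schwarz_ineq2[of a b] by (simp add: inner_eq_Re_cinner)
    moreover have "\<bar>Im (cinner a b)\<bar> \<le> norm a * norm b"
      using Cauchy_Schwarz_ineq2[of a "\<i> *\<^sub>C b"] by (simp add: Im_cinner norm_scaleC)
    ultimately show "norm (cinner a b) \<le> norm a * norm b * 2"
      using cmod_le[of "cinner a b"] by linarith
  qed
qed (simp_all add: cinner_add_left cinner_add_right scaleR_scaleC cinner_scaleC_left
    cinner_scaleC_right scaleR_conv_of_real)

lemmas tendsto_cinner = bounded_bilinear.tendsto[OF bounded_bilinear_cinner]

lemma tendsto_scaleC: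
  fixes f :: "'b \<Rightarrow> 'a::complex_inner"
  assumes "(f \<longlongrightarrow> l) F"
  shows "((\<lambda>x. c *\<^sub>C f x) \<longlongrightarrow> c *\<^sub>C l) F"
proof -
  have "bounded_linear (scaleC c :: 'a \<Rightarrow> 'a)"
    by (rule bounded_linear_intro[of _ "cmod c"])
      (simp_all add: scaleC_add_right scaleR_scaleC scaleC_scaleC norm_scaleC mult.commute)
  then show ?thesis using assms by (rule bounded_linear.tendsto)
qed

lemma linear_isometryD:
  assumes "linear_isometry T"
  shows linear_isometry_add: "T (x + y) = T x + T y"
    and linear_isometry_scaleC: "T (c *\<^sub>C x) = c *\<^sub>C T x"
    and linear_isometry_norm: "norm (T x) = norm x"
  using assms by (auto simp: linear_isometry_def Vector_Spaces.linear_iff)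

lemma linear_isometry_zero: "linear_isometry T \<Longrightarrow> T 0 = 0"
  using linear_isometry_norm[of T 0] by simp

lemma linear_isometry_diff:
  assumes "linear_isometry T" shows "T (x - y) = T x - T y"
  using linear_isometry_add[OF assms, of "x - y" y] by simp

lemma linear_isometry_sum:
  assumes "linear_isometry T" shows "T (\<Sum>i\<in>A. f i) = (\<Sum>i\<in>A. T (f i))"
  by (induction A rule: infinite_finite_induct)
    (auto simp: linear_isometry_add[OF assms] linear_isometry_zero[OF assms])

text \<open>Preservation of norms gives preservation of the real inner product through the
  polarization identity \<open>dot_norm\<close>; complex linearity carries this over to the
  imaginary part via \<open>Im_cinner\<close>.\<close>

lemma linear_isometry_cinner:
  assumes "linear_isometry T"
  shows "cinner (T x) (T y) = cinner x y"
proof -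
  have *: "inner (T u) (T v) = inner u v" for u v
    unfolding dot_norm
    by (simp add: linear_isometry_norm[OF assms] flip: linear_isometry_add[OF assms])
  have "Im (cinner (T x) (T y)) = Im (cinner x y)"
    by (simp add: Im_cinner * flip: linear_isometry_scaleC[OF assms])
  moreover have "Re (cinner (T x) (T y)) = Re (cinner x y)"
    using * by (simp flip: inner_eq_Re_cinner)
  ultimately show ?thesis by (simp add: complex_eq_iff)
qed

lemma linear_isometry_tendsto:
  assumes "linear_isometry T" "(f \<longlongrightarrow> l) F"
  shows "((\<lambda>x. T (f x)) \<longlongrightarrow> T l) F"
proof -
  have "bounded_linear T"
    by (rule bounded_linear_intro[of _ 1])
      (simp_all add: linear_isometryD[OF assms(1)] scaleR_scaleC)
  then show ?thesis using assms(2) by (rule bounded_linear.tendsto)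
qed

lemma linear_isometry_id: "linear_isometry id"
  unfolding linear_isometry_def Vector_Spaces.linear_iff
  by (auto simp: vector_space_scaleC)

lemma linear_isometry_comp:
  "linear_isometry S \<Longrightarrow> linear_isometry T \<Longrightarrow> linear_isometry (S \<circ> T)"
  by (auto simp: linear_isometry_def Vector_Spaces.linear_iff)

section \<open>Existence and calculus of adjoints of isometries\<close>

lemma cadjoint_eqI:
  assumes "\<And>x y. cinner (T' x) y = cinner x (T y)"
  shows "cadjoint T = T'"
  unfolding cadjoint_def
proof (rule the_equality)
  fix T'' assume "\<forall>x y. cinner (T'' x) y = cinner x (T y)"
  then show "T'' = T'" using assms by (intro ext cinner_eqI) simp
qed (simp add: assms)

lemma parallelogram_law:
  fixes x y :: "'a::real_inner"
  shows "(norm (x + y))\<^sup>2 + (norm (x - y))\<^sup>2 = 2 * (norm x)\<^sup>2 + 2 * (norm y)\<^sup>2"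
  unfolding power2_norm_eq_inner inner_add_left inner_add_right inner_diff_left inner_diff_right
  by argo

lemma norm_diff_power2:
  fixes x y :: "'a::real_inner"
  shows "(norm (x - y))\<^sup>2 = (norm x)\<^sup>2 - 2 * inner x y + (norm y)\<^sup>2"
  unfolding power2_norm_eq_inner inner_diff_left inner_diff_right
  by (simp add: inner_commute)

text \<open>The minimizer of \<open>y \<mapsto> \<parallel>x - T y\<parallel>\<close> is the value at \<open>x\<close> of the adjoint of \<open>T\<close>.\<close>
lemma linear_isometry_adjoint_exists:
  fixes T :: "'a::chilbert_space \<Rightarrow> 'a"
  assumes T: "linear_isometry T"
  shows "\<exists>y. \<forall>z. cinner y z = cinner x (T z)"
proof -
  let ?f = "\<lambda>y. (norm (x - T y))\<^sup>2"
  define d where "d = (INF y. ?f y)"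
  have bdd: "bdd_below (range ?f)" by (auto intro!: bdd_belowI[of _ 0])
  have d_le: "d \<le> ?f y" for y
    unfolding d_def using bdd by (rule cINF_lower) simp
  have "\<exists>y. ?f y < d + 1 / real (Suc n)" for n
    using cINF_less_iff[OF _ bdd, of "d + 1 / real (Suc n)"] by (auto simp: d_def)
  then obtain y where y: "?f (y n) < d + 1 / real (Suc n)" for n by metis
  \<comment> \<open>The vectors \<open>x - T u\<close> and \<open>x - T v\<close> have mean
    \<open>x - T ((1/2) *\<^sub>R (u + v))\<close>, of squared norm at least \<open>d\<close>. The
    parallelogram law then bounds their difference, whose norm is that of \<open>u - v\<close>:
    near-minimizers are close to each other.\<close>
  have ineq: "(norm (u - v))\<^sup>2 \<le> 2 * (?f u - d) + 2 * (?f v - d)" for u v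
  proof -
    have "4 * d \<le> 4 * ?f ((1/2) *\<^sub>R (u + v))" using d_le by simp
    also have "\<dots> = (norm ((x - T u) + (x - T v)))\<^sup>2"
    proof -
      have "2 *\<^sub>R T ((1/2) *\<^sub>R (u + v)) = T u + T v"
        by (simp add: scaleR_scaleC scaleC_scaleC flip: linear_isometryD(1,2)[OF T])
      then have "(x - T u) + (x - T v) = 2 *\<^sub>R (x - T ((1/2) *\<^sub>R (u + v)))"
        by (simp add: scaleR_diff_right) (simp add: scaleR_2)
      then show ?thesis by (simp add: power_mult_distrib)
    qed
    finally have "4 * d \<le> (norm ((x - T u) + (x - T v)))\<^sup>2" .
    moreover have "(norm (u - v))\<^sup>2 = (norm ((x - T u) - (x - T v)))\<^sup>2"
      using linear_isometry_norm[OF T, of "v - u"]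
      by (simp add: linear_isometry_diff[OF T] norm_minus_commute)
    ultimately show ?thesis
      using parallelogram_law[of "x - T u" "x - T v"] by argo
  qed
  have "Cauchy y"
  proof (rule metric_CauchyI)
    fix e :: real assume "e > 0"
    \<comment> \<open>Two near-minimizers with excess at most \<open>1 / real (Suc M)\<close> differ
      by a vector of squared norm at most twice the sum of the excesses, whence the 4.\<close>
    then obtain M where M: "4 / real (Suc M) < e\<^sup>2"
      using reals_Archimedean[of "e\<^sup>2 / 4"] by (auto simp: field_simps)
    show "\<exists>M. \<forall>m\<ge>M. \<forall>n\<ge>M. dist (y m) (y n) < e"
    proof (intro exI[of _ M] allI impI)
      fix m n assume mn: "m \<ge> M" "n \<ge> M"
      have b: "?f (y k) - d \<le> 1 / real (Suc M)" if "k \<ge> M" for k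
      proof -
        have "1 / real (Suc k) \<le> 1 / real (Suc M)" using that by (simp add: field_simps)
        then show ?thesis using y[of k] by linarith
      qed
      have "(norm (y m - y n))\<^sup>2 \<le> 4 / real (Suc M)"
        using ineq[of "y m" "y n"] b[OF mn(1)] b[OF mn(2)] by argo
      then have "(norm (y m - y n))\<^sup>2 < e\<^sup>2" using M by linarith
      then show "dist (y m) (y n) < e"
        using \<open>e > 0\<close> by (simp add: dist_norm power_less_imp_less_base)
    qed
  qed
  then obtain l where l: "y \<longlonglongrightarrow> l" by (auto simp: Cauchy_convergent_iff convergent_def)
  have fl: "?f l \<le> d"
  proof (rule LIMSEQ_le)
    show "(\<lambda>n. ?f (y n)) \<longlonglongrightarrow> ?f l"
      by (intro tendsto_intros linear_isometry_tendsto[OF T] l)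
    show "(\<lambda>n. d + 1 / real (Suc n)) \<longlonglongrightarrow> d"
      using LIMSEQ_inverse_real_of_nat_add[of d] by (simp add: inverse_eq_divide)
    show "\<exists>M. \<forall>n\<ge>M. ?f (y n) \<le> d + 1 / real (Suc n)"
      using y less_imp_le by blast
  qed
  have re: "inner (x - T l) (T z) = 0" for z
  proof (rule ccontr)
    assume a: "inner (x - T l) (T z) \<noteq> 0"
    define a where "a = inner (x - T l) (T z)"
    have z: "z \<noteq> 0" using a linear_isometry_zero[OF T] by auto
    \<comment> \<open>This \<open>t\<close> minimizes the quadratic
      \<open>- 2 * t * a + t\<^sup>2 * (norm z)\<^sup>2\<close>, so a step from \<open>l\<close> in
      the direction \<open>z\<close> would go strictly below the infimum.\<close>
    define t where "t = a / (norm z)\<^sup>2"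
    have "?f l \<le> ?f (l + t *\<^sub>R z)" using fl d_le[of "l + t *\<^sub>R z"] by linarith
    also have "\<dots> = (norm ((x - T l) - t *\<^sub>R T z))\<^sup>2"
      by (simp add: linear_isometryD(1,2)[OF T] scaleR_scaleC algebra_simps)
    also have "\<dots> = ?f l - 2 * t * a + t\<^sup>2 * (norm z)\<^sup>2"
      by (simp only: norm_diff_power2 a_def inner_scaleR_right norm_scaleR power_mult_distrib
          linear_isometry_norm[OF T] power2_abs mult.assoc)
    finally have "2 * t * a \<le> t\<^sup>2 * (norm z)\<^sup>2" by simp
    moreover have "t\<^sup>2 * (norm z)\<^sup>2 = t * a"
      using z by (simp add: t_def power2_eq_square)
    moreover have "t * a > 0"
    proof -
      have "t * a = a\<^sup>2 / (norm z)\<^sup>2" by (simp add: t_def power2_eq_square)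
      then show ?thesis using a z by (simp add: a_def)
    qed
    ultimately show False by linarith
  qed
  have "cinner (x - T l) (T z) = 0" for z
  proof -
    have "Im (cinner (x - T l) (T z)) = 0"
      using re[of "\<i> *\<^sub>C z"] by (simp add: Im_cinner linear_isometry_scaleC[OF T])
    then show ?thesis using re[of z] by (simp add: complex_eq_iff inner_eq_Re_cinner)
  qed
  then have "cinner l z = cinner x (T z)" for z
    by (simp add: cinner_diff_left linear_isometry_cinner[OF T])
  then show ?thesis by blast
qed

text \<open>The definite description behind \<open>cadjoint\<close> denotes the adjoint only once
  one is known to exist; here it is chosen pointwise and identified by
  \<open>cadjoint_eqI\<close>.\<close>

lemma cinner_cadjoint_left:
  fixes T :: "'a::chilbert_space \<Rightarrow> 'a"
  assumes "linear_isometry T"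
  shows "cinner (cadjoint T x) y = cinner x (T y)"
proof -
  obtain T' where T': "\<And>x z. cinner (T' x) z = cinner x (T z)"
    using linear_isometry_adjoint_exists[OF assms] by metis
  then have "cadjoint T = T'" by (rule cadjoint_eqI)
  then show ?thesis by (simp add: T')
qed

lemma cinner_cadjoint_right:
  fixes T :: "'a::chilbert_space \<Rightarrow> 'a"
  assumes "linear_isometry T"
  shows "cinner x (cadjoint T y) = cinner (T x) y"
  by (metis assms cinner_cadjoint_left cinner_commute)

lemma cadjoint_add:
  fixes T :: "'a::chilbert_space \<Rightarrow> 'a"
  assumes "linear_isometry T"
  shows "cadjoint T (x + y) = cadjoint T x + cadjoint T y"
  by (rule cinner_eqI) (simp add: cinner_cadjoint_left[OF assms] cinner_add_left)

lemma cadjoint_sum: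
  fixes T :: "'a::chilbert_space \<Rightarrow> 'a"
  assumes "linear_isometry T"
  shows "cadjoint T (\<Sum>i\<in>A. f i) = (\<Sum>i\<in>A. cadjoint T (f i))"
  by (rule cinner_eqI) (simp add: cinner_cadjoint_left[OF assms] cinner_sum_left)

lemma cadjoint_scaleC:
  fixes T :: "'a::chilbert_space \<Rightarrow> 'a"
  assumes "linear_isometry T"
  shows "cadjoint T (c *\<^sub>C x) = c *\<^sub>C cadjoint T x"
  by (rule cinner_eqI) (simp add: cinner_cadjoint_left[OF assms] cinner_scaleC_left)

lemma cadjoint_comp:
  fixes S T :: "'a::chilbert_space \<Rightarrow> 'a"
  assumes "linear_isometry S" "linear_isometry T"
  shows "cadjoint (S \<circ> T) = cadjoint T \<circ> cadjoint S"
  by (rule cadjoint_eqI) (simp add: cinner_cadjoint_left assms)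

lemma cadjoint_id: "cadjoint id = id"
  by (rule cadjoint_eqI) simp

section \<open>Cylinders and measures on infinite words\<close>

definition words :: "nat \<Rightarrow> nat \<Rightarrow> nat list set"
  where "words N n = {I. length I = n \<and> set I \<subseteq> {..<N}}"

text \<open>A representative point of the cylinder of a word, at which functions of finitely many
  letters are evaluated. The filler 0 is a legal letter as soon as \<open>0 < N\<close>.\<close>

definition pad :: "nat list \<Rightarrow> nat \<Rightarrow> nat"
  where "pad I k = (if k < length I then I ! k else 0)"

abbreviation prefix :: "nat \<Rightarrow> (nat \<Rightarrow> nat) \<Rightarrow> nat list"
  where "prefix n w \<equiv> map w [0..<n]"

definition cylinder :: "nat \<Rightarrow> nat list \<Rightarrow> (nat \<Rightarrow> nat) set"
  where "cylinder N I = {w \<in> infinite_words N. prefix (length I) w = I}"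

text \<open>Dependence on the first \<open>n\<close> letters is encoded as invariance under the map
  \<open>w \<mapsto> pad (prefix n w)\<close>, which has finitely many values. The free target type
  covers scalar functions and, through boolean values, sets.\<close>

definition cylinder_fun :: "nat \<Rightarrow> nat \<Rightarrow> ((nat \<Rightarrow> nat) \<Rightarrow> 'b) \<Rightarrow> bool"
  where "cylinder_fun N n g \<longleftrightarrow> (\<forall>w\<in>infinite_words N. g (pad (prefix n w)) = g w)"

lemma finite_words [simp]: "finite (words N n)"
  unfolding words_def using finite_lists_length_eq[of "{..<N}" n] by (simp add: conj_commute)

lemma words_0 [simp]: "words N 0 = {[]}"
  by (auto simp: words_def)

lemma length_words: "I \<in> words N n \<Longrightarrow> length I = n"
  by (simp add: words_def)

lemma words_lengthI: "set I \<subseteq> {..<N} \<Longrightarrow> I \<in> words N (length I)"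
  by (simp add: words_def)

lemma sum_words_Suc: "(\<Sum>J\<in>words N (Suc n). h J) = (\<Sum>I\<in>words N n. \<Sum>i<N. h (I @ [i]))"
proof -
  have "bij_betw (\<lambda>(I, i). I @ [i]) (words N n \<times> {..<N}) (words N (Suc n))"
  proof (rule bij_betw_imageI)
    show "(\<lambda>(I, i). I @ [i]) ` (words N n \<times> {..<N}) = words N (Suc n)"
    proof safe
      fix J assume J: "J \<in> words N (Suc n)"
      then obtain I i where "J = I @ [i]"
        by (metis length_words length_Suc_conv_rev)
      with J show "J \<in> (\<lambda>(I, i). I @ [i]) ` (words N n \<times> {..<N})"
        by (force simp: words_def)
    qed (auto simp: words_def)
  qed (auto simp: inj_on_def)
  from sum.reindex_bij_betw[OF this, of h] show ?thesis
    by (simp add: sum.cartesian_product case_prod_unfold)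
qed

lemma prefix_words: "w \<in> infinite_words N \<Longrightarrow> prefix n w \<in> words N n"
  by (auto simp: words_def infinite_words_eq)

lemma pad_infinite_words: "0 < N \<Longrightarrow> I \<in> words N n \<Longrightarrow> pad I \<in> infinite_words N"
  by (auto simp: words_def infinite_words_eq pad_def dest: nth_mem)

lemma prefix_pad: "length I = n \<Longrightarrow> prefix n (pad I) = I"
  by (auto simp: pad_def intro: nth_equalityI)

lemma prefix_pad_prefix: "k \<le> n \<Longrightarrow> prefix k (pad (prefix n w)) = prefix k w"
  by (auto simp: pad_def)

lemma cylinder_fun_mono:
  assumes "cylinder_fun N n g" "n \<le> k" "0 < N"
  shows "cylinder_fun N k g"
  unfolding cylinder_fun_def
proof
  fix w assume w: "w \<in> infinite_words N"
  have "g (pad (prefix k w)) = g (pad (prefix n (pad (prefix k w))))"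
    using assms(1) pad_infinite_words[OF assms(3) prefix_words[OF w]] by (simp add: cylinder_fun_def)
  then show "g (pad (prefix k w)) = g w"
    using assms w by (simp only: prefix_pad_prefix cylinder_fun_def)
qed

lemma cylinder_fun_comp: "cylinder_fun N n g \<Longrightarrow> cylinder_fun N n (\<lambda>w. h (g w))"
  by (simp add: cylinder_fun_def)

lemma cylinder_fun_comp2:
  "cylinder_fun N n g \<Longrightarrow> cylinder_fun N n g' \<Longrightarrow> cylinder_fun N n (\<lambda>w. h (g w) (g' w))"
  by (simp add: cylinder_fun_def)

lemma cylinder_fun_const: "cylinder_fun N n (\<lambda>w. c)"
  by (simp add: cylinder_fun_def)

lemma cylinder_fun_mem_cylinder:
  assumes "0 < N"
  shows "cylinder_fun N (length I) (\<lambda>w. w \<in> cylinder N I)"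
  using assms
  by (auto simp: cylinder_fun_def cylinder_def pad_infinite_words[OF _ prefix_words] prefix_pad)

lemma cylinder_eq_empty:
  assumes "\<not> set I \<subseteq> {..<N}" shows "cylinder N I = {}"
proof -
  have False if "w \<in> infinite_words N" "I = prefix (length I) w" for w
  proof -
    have "set (prefix (length I) w) \<subseteq> {..<N}"
      using prefix_words[OF that(1), of "length I"] unfolding words_def by blast
    then show False using assms that(2) by simp
  qed
  then show ?thesis unfolding cylinder_def by fastforce
qed

lemma mem_cylinder_eq:
  assumes "w \<in> infinite_words N" "length I = n"
  shows "w \<in> cylinder N I \<longleftrightarrow> prefix n w = I"
  using assms by (auto simp: cylinder_def)

text \<open>Here \<open>F\<close> plays the role of a finitely additive set function, given on cylinders, and the sums
  are integrals of \<open>g\<close>.\<close>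
lemma sum_words_refine:
  fixes F :: "nat list \<Rightarrow> 'v::comm_monoid_add" and s :: "'c \<Rightarrow> 'v \<Rightarrow> 'v"
  assumes "0 < N" and g: "cylinder_fun N n g" and "n \<le> k"
    and F: "\<And>I. set I \<subseteq> {..<N} \<Longrightarrow> F I = (\<Sum>i<N. F (I @ [i]))"
    and s: "\<And>c f. s c (\<Sum>i<N. f i) = (\<Sum>i<N. s c (f i))"
  shows "(\<Sum>J\<in>words N k. s (g (pad J)) (F J)) = (\<Sum>I\<in>words N n. s (g (pad I)) (F I))"
  using \<open>n \<le> k\<close>
proof (induction k rule: dec_induct)
  case (step k)
  have "(\<Sum>J\<in>words N (Suc k). s (g (pad J)) (F J)) =
      (\<Sum>I\<in>words N k. \<Sum>i<N. s (g (pad (I @ [i]))) (F (I @ [i])))"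
    by (rule sum_words_Suc)
  also have "\<dots> = (\<Sum>I\<in>words N k. \<Sum>i<N. s (g (pad I)) (F (I @ [i])))"
  proof (intro sum.cong refl)
    fix I i assume I: "I \<in> words N k" and i: "i \<in> {..<N}"
    have "I @ [i] \<in> words N (Suc k)" using I i by (auto simp: words_def)
    then have "pad (I @ [i]) \<in> infinite_words N" using \<open>0 < N\<close> pad_infinite_words by blast
    moreover have "prefix k (pad (I @ [i])) = I"
      using I by (auto simp: pad_def words_def nth_append intro: nth_equalityI)
    ultimately have "g (pad I) = g (pad (I @ [i]))"
      using cylinder_fun_mono[OF g step.hyps(1) \<open>0 < N\<close>] unfolding cylinder_fun_def by metis
    then show "s (g (pad (I @ [i]))) (F (I @ [i])) = s (g (pad I)) (F (I @ [i]))" by simp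
  qed
  also have "\<dots> = (\<Sum>I\<in>words N k. s (g (pad I)) (F I))"
    by (intro sum.cong refl) (auto simp: s[symmetric] words_def simp flip: F)
  finally show ?case using step.IH by simp
qed simp

section \<open>Cylinders as a base of the topology and a generator of the Borel sets\<close>

lemma openin_word_topology:
  "openin (word_topology N) U \<longleftrightarrow>
    U \<subseteq> infinite_words N \<and> (\<forall>w\<in>U. \<exists>n. cylinder N (prefix n w) \<subseteq> U)"
proof
  assume U: "openin (word_topology N) U"
  then have "\<forall>w\<in>U. \<exists>V. finite {i \<in> UNIV. V i \<noteq> topspace (discrete_topology {..<N})} \<and>
      (\<forall>i\<in>UNIV. openin (discrete_topology {..<N}) (V i)) \<and> w \<in> Pi\<^sub>E UNIV V \<and> Pi\<^sub>E UNIV V \<subseteq> U"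
    by (simp only: word_topology_def openin_product_topology_alt)
  moreover have "\<exists>n. cylinder N (prefix n w) \<subseteq> U"
    if V: "finite {i \<in> UNIV. V i \<noteq> topspace (discrete_topology {..<N})}" "w \<in> Pi\<^sub>E UNIV V" "Pi\<^sub>E UNIV V \<subseteq> U" for w V
  proof -
    \<comment> \<open>A basic open box restricts only finitely many coordinates; once
      \<open>n\<close> exceeds them all, every word sharing its first \<open>n\<close> letters with
      \<open>w\<close> stays in the box.\<close>
    obtain n where n: "\<And>i. V i \<noteq> {..<N} \<Longrightarrow> i < n"
      using finite_nat_bounded[OF V(1)] by auto
    have "cylinder N (prefix n w) \<subseteq> Pi\<^sub>E UNIV V"
    proof
      fix w' assume w': "w' \<in> cylinder N (prefix n w)"
      have "w' i \<in> V i" for i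
        using w' n[of i] V(2) by (cases "i < n") (auto simp: cylinder_def infinite_words_eq)
      then show "w' \<in> Pi\<^sub>E UNIV V" by (simp add: PiE_UNIV_domain)
    qed
    then show ?thesis using V(3) by (intro exI[of _ n]) (rule order_trans)
  qed
  ultimately show "U \<subseteq> infinite_words N \<and> (\<forall>w\<in>U. \<exists>n. cylinder N (prefix n w) \<subseteq> U)"
    using openin_subset[OF U] by meson
next
  assume *: "U \<subseteq> infinite_words N \<and> (\<forall>w\<in>U. \<exists>n. cylinder N (prefix n w) \<subseteq> U)"
  have "\<exists>V. finite {i \<in> UNIV. V i \<noteq> topspace (discrete_topology {..<N})} \<and>
      (\<forall>i\<in>UNIV. openin (discrete_topology {..<N}) (V i)) \<and> w \<in> Pi\<^sub>E UNIV V \<and> Pi\<^sub>E UNIV V \<subseteq> U"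
    if w: "w \<in> U" for w
  proof -
    obtain n where n: "cylinder N (prefix n w) \<subseteq> U" using * w by blast
    have wi: "w i < N" for i using * w by (auto simp: infinite_words_eq)
    let ?V = "\<lambda>i. if i < n then {w i} else {..<N}"
    have "finite {i \<in> UNIV. ?V i \<noteq> topspace (discrete_topology {..<N})}"
      by (rule finite_subset[of _ "{..<n}"]) auto
    moreover have "w' \<in> U" if "w' \<in> Pi\<^sub>E UNIV ?V" for w'
    proof -
      have w': "w' i \<in> ?V i" for i using that by (rule PiE_mem) simp
      have "w' i = w i" if "i < n" for i using w'[of i] that by simp
      moreover have "w' i < N" for i using w'[of i] wi by (auto split: if_splits)
      ultimately show ?thesis using n by (auto simp: cylinder_def infinite_words_eq subset_iff)
    qed
    ultimately show ?thesis
      using wi by (intro exI[of _ ?V]) auto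
  qed
  then show "openin (word_topology N) U"
    by (simp only: word_topology_def openin_product_topology_alt) blast
qed

text \<open>Complements of sets decided by \<open>n\<close> letters are of the same kind, so such
  sets are also closed; this feeds the compactness argument for the measure.\<close>

lemma openin_cylinder_fun:
  assumes "cylinder_fun N n (\<lambda>w. w \<in> A)" "A \<subseteq> infinite_words N" "0 < N"
  shows "openin (word_topology N) A"
  unfolding openin_word_topology
proof (intro conjI ballI exI[of _ n], rule assms(2), rule subsetI)
  fix w w' assume w: "w \<in> A" "w' \<in> cylinder N (prefix n w)"
  then have *: "w \<in> infinite_words N" "w' \<in> infinite_words N" "prefix n w' = prefix n w"
    using assms(2) by (auto simp: cylinder_def)
  have "pad (prefix n w) \<in> A" using assms(1) w(1) *(1) by (simp add: cylinder_fun_def)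
  then show "w' \<in> A" using assms(1) *(2,3) unfolding cylinder_fun_def by metis
qed

lemma cylinder_subset: "cylinder N I \<subseteq> infinite_words N"
  by (auto simp: cylinder_def)

lemma sets_word_borel: "sets (word_borel N) = sigma_sets (infinite_words N) {U. openin (word_topology N) U}"
  unfolding word_borel_def by (rule sets_measure_of) (auto dest: openin_subset)

lemma open_in_sets_word_borel: "openin (word_topology N) A \<Longrightarrow> A \<in> sets (word_borel N)"
  by (simp add: sets_word_borel)

lemma cylinder_in_sets: "0 < N \<Longrightarrow> cylinder N I \<in> sets (word_borel N)"
  by (intro open_in_sets_word_borel openin_cylinder_fun[OF cylinder_fun_mem_cylinder] cylinder_subset)

text \<open>Every open set is the union of the cylinders inside it, and the union is countable
  because there are only countably many finite words.\<close>

lemma sets_word_borel_eq_cylinders: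
  assumes "0 < N"
  shows "sets (word_borel N) = sigma_sets (infinite_words N) (range (cylinder N))"
proof
  show "sigma_sets (infinite_words N) (range (cylinder N)) \<subseteq> sets (word_borel N)"
    using cylinder_in_sets[OF assms] sets.sigma_sets_subset[of "range (cylinder N)" "word_borel N"]
    by (auto simp: image_subset_iff)
  interpret sigma_algebra "infinite_words N" "sigma_sets (infinite_words N) (range (cylinder N))"
    by (rule sigma_algebra_sigma_sets) (use cylinder_subset in blast)
  have "U \<in> sigma_sets (infinite_words N) (range (cylinder N))"
    if U: "openin (word_topology N) U" for U
  proof -
    have "U = (\<Union>I\<in>{I. cylinder N I \<subseteq> U}. cylinder N I)"
    proof (intro equalityI subsetI)
      fix w assume w: "w \<in> U"
      then obtain n where "cylinder N (prefix n w) \<subseteq> U" "w \<in> infinite_words N"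
        using U by (meson openin_word_topology subsetD)
      then show "w \<in> (\<Union>I\<in>{I. cylinder N I \<subseteq> U}. cylinder N I)"
        by (auto intro!: exI[of _ "prefix n w"] simp: cylinder_def)
    qed auto
    moreover have "(\<Union>I\<in>{I. cylinder N I \<subseteq> U}. cylinder N I) \<in> sigma_sets (infinite_words N) (range (cylinder N))"
      by (rule countable_UN'') auto
    ultimately show ?thesis by simp
  qed
  then show "sets (word_borel N) \<subseteq> sigma_sets (infinite_words N) (range (cylinder N))"
    unfolding sets_word_borel by (intro sigma_sets_subset) auto
qed

text \<open>Two cylinders are nested or disjoint, according to whether the shorter word is a prefix
  of the longer one.\<close>

lemma cylinder_Int:
  "cylinder N I \<inter> cylinder N J \<in> {{}, cylinder N I, cylinder N J}"
proof -
  have *: "cylinder N I \<inter> cylinder N J \<in> {{}, cylinder N J}" if "length I \<le> length J" for I J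
  proof (cases "take (length I) J = I")
    case True
    have "cylinder N J \<subseteq> cylinder N I"
    proof
      fix w assume "w \<in> cylinder N J"
      then have w: "w \<in> infinite_words N" "prefix (length J) w = J" by (auto simp: cylinder_def)
      have "prefix (length I) w = take (length I) (prefix (length J) w)"
        using that by (simp add: take_map)
      then show "w \<in> cylinder N I" using w True by (simp add: cylinder_def)
    qed
    then show ?thesis by blast
  next
    case False
    have "False" if w: "w \<in> cylinder N I" "w \<in> cylinder N J" for w
    proof -
      have "prefix (length I) w = take (length I) (prefix (length J) w)"
        using \<open>length I \<le> length J\<close> by (simp add: take_map)
      then show False using w False by (simp add: cylinder_def)
    qed
    then show ?thesis by blast
  qed
  show ?thesis
    using *[of I J] *[of J I] by (cases "length I \<le> length J") (auto simp: Int_commute)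
qed

lemma cylinder_Nil: "cylinder N [] = infinite_words N"
  by (simp add: cylinder_def)

lemma Int_stable_cylinders: "Int_stable (insert {} (range (cylinder N)))"
proof (rule Int_stableI)
  fix A B assume "A \<in> insert {} (range (cylinder N))" "B \<in> insert {} (range (cylinder N))"
  moreover have "cylinder N I \<inter> cylinder N J \<in> insert {} (range (cylinder N))" for I J
    using cylinder_Int[of N I J] by fastforce
  ultimately show "A \<inter> B \<in> insert {} (range (cylinder N))" by auto
qed

lemma sigma_sets_cylinders:
  assumes "0 < N"
  shows "sets (word_borel N) = sigma_sets (infinite_words N) (insert {} (range (cylinder N)))"
proof -
  have "sigma_sets (infinite_words N) (insert {} (range (cylinder N))) =
      sigma_sets (infinite_words N) (range (cylinder N))"
    by (intro equalityI sigma_sets_mono subsetI)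
      (auto intro: sigma_sets.Empty)
  then show ?thesis using sets_word_borel_eq_cylinders[OF assms] by simp
qed

text \<open>Uniqueness on an Int-stable generator; the whole space, being the cylinder of the empty
  word, is a cover by one generator of finite mass. Words with letters outside \<open>{..<N}\<close>
  have empty cylinders and are therefore left out of \<open>eq\<close>.\<close>

lemma measure_eqI_cylinders:
  assumes "0 < N" "sets M = sets (word_borel N)" "sets M' = sets (word_borel N)"
    and eq: "\<And>I. set I \<subseteq> {..<N} \<Longrightarrow> emeasure M (cylinder N I) = emeasure M' (cylinder N I)"
    and "finite_measure M"
  shows "M = M'"
proof (rule measure_eqI_generator_eq[where E = "insert {} (range (cylinder N))"
      and \<Omega> = "infinite_words N" and A = "\<lambda>_. infinite_words N"])
  fix X assume "X \<in> insert {} (range (cylinder N))"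
  then consider "X = {}" | I where "X = cylinder N I" by auto
  then show "emeasure M X = emeasure M' X"
  proof cases
    case (2 I)
    show ?thesis
    proof (cases "set I \<subseteq> {..<N}")
      case False
      have "cylinder N I = {}"
        using False by (rule cylinder_eq_empty)
      then show ?thesis using 2 by simp
    qed (simp add: 2 eq)
  qed simp
next
  show "emeasure M (infinite_words N) \<noteq> \<infinity>"
    using finite_measure.emeasure_finite[OF \<open>finite_measure M\<close>] by simp
  show "range (\<lambda>_. infinite_words N) \<subseteq> insert {} (range (cylinder N))"
    using cylinder_Nil[of N] by auto
  show "insert {} (range (cylinder N)) \<subseteq> Pow (infinite_words N)"
    using cylinder_subset by blast
qed (use assms sigma_sets_cylinders Int_stable_cylinders in auto)

text \<open>Caratheodory extension from the ring of sets decided by finitely many letters. The mass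
  of such a set is a sum of \<open>m\<close> over words of a sufficient length, and the refinement
  rule for \<open>m\<close> makes it independent of that length. Countable additivity reduces to
  continuity at the empty set: a decreasing sequence of closed sets with empty intersection in a
  compact space is eventually empty.\<close>

lemma cylinder_measure_exists:
  fixes m :: "nat list \<Rightarrow> real"
  assumes N: "0 < N" and nonneg: "\<And>I. 0 \<le> m I"
    and m: "\<And>I. set I \<subseteq> {..<N} \<Longrightarrow> m I = (\<Sum>i<N. m (I @ [i]))"
  obtains \<mu> where "finite_measure \<mu>" "sets \<mu> = sets (word_borel N)"
    "\<And>I. set I \<subseteq> {..<N} \<Longrightarrow> measure \<mu> (cylinder N I) = m I"
proof -
  define cyl where "cyl n A \<longleftrightarrow> cylinder_fun N n (\<lambda>w. w \<in> A)" for n A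
  define \<A> where "\<A> = {A. A \<subseteq> infinite_words N \<and> (\<exists>n. cyl n A)}"
  define e where "e n A = (\<Sum>I\<in>words N n. if pad I \<in> A then m I else 0)" for n A
  define f where "f A = e (LEAST n. cyl n A) A" for A
  have cyl_mono: "cyl k A" if "cyl n A" "n \<le> k" for n k A
    using that cylinder_fun_mono[OF _ _ N] unfolding cyl_def by blast
  have e_mono: "e k A = e n A" if "cyl n A" "n \<le> k" for n k A
    unfolding e_def
  \<comment> \<open>The refinement lemma is applied to membership in \<open>A\<close> as a boolean
    function; \<open>s\<close> turns a truth value and a mass into that mass or 0.\<close>
  proof (rule sum_words_refine[where g = "\<lambda>w. w \<in> A" and F = m and s = "\<lambda>b x. if b then x else 0"])
    show "m I = (\<Sum>i<N. m (I @ [i]))" if "set I \<subseteq> {..<N}" for I using m[OF that] .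
  qed (use N that in \<open>simp_all add: cyl_def\<close>)
  have f_eq: "f A = e n A" if "cyl n A" for n A
    unfolding f_def
    using e_mono[OF LeastI[of "\<lambda>n. cyl n A", OF that] Least_le[of "\<lambda>n. cyl n A", OF that]] by simp
  have e_nonneg: "0 \<le> e n A" for n A unfolding e_def using nonneg by (auto intro: sum_nonneg)
  have common: "\<exists>n. cyl n A \<and> cyl n B" if "A \<in> \<A>" "B \<in> \<A>" for A B
    using that cyl_mono[OF _ max.cobounded1] cyl_mono[OF _ max.cobounded2] unfolding \<A>_def
    by blast
  interpret ring_of_sets "infinite_words N" \<A>
  proof (rule ring_of_setsI)
    show "\<A> \<subseteq> Pow (infinite_words N)" by (auto simp: \<A>_def)
    show "{} \<in> \<A>" by (auto simp: \<A>_def cyl_def cylinder_fun_const)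
    fix A B assume AB: "A \<in> \<A>" "B \<in> \<A>"
    then obtain n where n: "cyl n A" "cyl n B" using common by blast
    have "cyl n (A \<union> B)" "cyl n (A - B)"
      using n by (auto simp: cyl_def cylinder_fun_def)
    then show "A \<union> B \<in> \<A>" "A - B \<in> \<A>" using AB unfolding \<A>_def by blast+
  qed
  have "\<exists>\<mu>. (\<forall>A\<in>\<A>. \<mu> A = ennreal (f A)) \<and>
      measure_space (infinite_words N) (sigma_sets (infinite_words N) \<A>) \<mu>"
  proof (rule caratheodory_empty_continuous)
    have "cyl 0 {}" by (simp add: cyl_def cylinder_fun_const)
    from f_eq[OF this] have f_empty: "f {} = 0" by (simp add: e_def)
    then show "positive \<A> (\<lambda>A. ennreal (f A))" by (simp add: positive_def)
    show "additive \<A> (\<lambda>A. ennreal (f A))"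
      unfolding additive_def
    proof (intro ballI impI)
      fix A B assume AB: "A \<in> \<A>" "B \<in> \<A>" "A \<inter> B = {}"
      then obtain n where n: "cyl n A" "cyl n B" using common by blast
      have "cyl n (A \<union> B)" using n by (auto simp: cyl_def cylinder_fun_def)
      have "e n (A \<union> B) = e n A + e n B"
        unfolding e_def using AB(3) by (auto simp flip: sum.distrib intro!: sum.cong)
      then show "ennreal (f (A \<union> B)) = ennreal (f A) + ennreal (f B)"
        using n \<open>cyl n (A \<union> B)\<close> e_nonneg by (simp add: f_eq)
    qed
    fix A :: "nat \<Rightarrow> (nat \<Rightarrow> nat) set"
    assume A: "range A \<subseteq> \<A>" "decseq A" "(\<Inter>i. A i) = {}"
    have compact: "compact_space (word_topology N)"
      unfolding word_topology_def by (auto simp: compact_space_product_topology compact_space_discrete_topology)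
    have "closedin (word_topology N) (A i)" for i
    proof -
      obtain n where "A i \<subseteq> infinite_words N" "cyl n (A i)" 
      proof -
        have "A i \<in> \<A>" using A(1) by auto
        then show ?thesis using that unfolding \<A>_def by blast
      qed
      then have "openin (word_topology N) (infinite_words N - A i)"
        by (intro openin_cylinder_fun[OF _ _ N, of n]) (auto simp: cyl_def cylinder_fun_def
          intro: pad_infinite_words[OF N prefix_words])
      then show ?thesis using \<open>A i \<subseteq> infinite_words N\<close> by (simp add: closedin_def)
    qed
    then obtain n where "A n = {}"
      using compact_space_imp_nest[OF compact _ _ A(2)] A(3) by blast
    then have "A k = {}" if "n \<le> k" for k using A(2) that by (auto dest: decseqD)
    then have "eventually (\<lambda>k. ennreal (f (A k)) = 0) sequentially"
      using f_empty by (auto simp: eventually_sequentially intro!: exI[of _ n])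
    then show "(\<lambda>i. ennreal (f (A i))) \<longlonglongrightarrow> 0" by (rule tendsto_eventually)
  qed simp
  then obtain \<mu>' where \<mu>': "\<And>A. A \<in> \<A> \<Longrightarrow> \<mu>' A = ennreal (f A)"
    "measure_space (infinite_words N) (sigma_sets (infinite_words N) \<A>) \<mu>'" by blast
  define \<mu> where "\<mu> = measure_of (infinite_words N) \<A> \<mu>'"
  have \<A>_sub: "\<A> \<subseteq> Pow (infinite_words N)" by (auto simp: \<A>_def)
  have cyl_cylinder: "cyl (length I) (cylinder N I)" for I
    unfolding cyl_def by (rule cylinder_fun_mem_cylinder[OF N])
  have cylinder_in: "cylinder N I \<in> \<A>" for I
    using cyl_cylinder cylinder_subset by (auto simp: \<A>_def)
  have sets: "sets \<mu> = sets (word_borel N)"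
  proof
    show "sets \<mu> \<subseteq> sets (word_borel N)"
    proof -
      have "\<A> \<subseteq> sets (word_borel N)"
        by (auto simp: \<A>_def cyl_def intro!: open_in_sets_word_borel openin_cylinder_fun[OF _ _ N])
      then have "sigma_sets (infinite_words N) \<A> \<subseteq> sets (word_borel N)"
        using sets.sigma_sets_subset[of \<A> "word_borel N"] by simp
      then show ?thesis by (simp add: \<mu>_def sets_measure_of[OF \<A>_sub])
    qed
    show "sets (word_borel N) \<subseteq> sets \<mu>"
      unfolding sets_word_borel_eq_cylinders[OF N] \<mu>_def sets_measure_of[OF \<A>_sub]
      by (rule sigma_sets_mono') (use cylinder_in in auto)
  qed
  have emeasure: "emeasure \<mu> A = ennreal (f A)" if "A \<in> \<A>" for A
    using \<mu>' that \<A>_sub emeasure_measure_of[OF \<mu>_def \<A>_sub, of A]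
    unfolding measure_space_def \<mu>_def sets_measure_of[OF \<A>_sub] by auto
  have "measure \<mu> (cylinder N I) = m I" if I: "set I \<subseteq> {..<N}" for I
  proof -
    have "f (cylinder N I) = (\<Sum>J\<in>words N (length I). if J = I then m J else 0)"
      unfolding f_eq[OF cyl_cylinder] e_def
      by (intro sum.cong refl if_cong)
        (auto simp: cylinder_def pad_infinite_words[OF N] prefix_pad length_words)
    also have "\<dots> = m I" using words_lengthI[OF I] by simp
    finally show ?thesis
      using emeasure[OF cylinder_in, of I] nonneg by (simp add: measure_def)
  qed
  moreover have "finite_measure \<mu>"
  proof (rule finite_measureI)
    have "space \<mu> = cylinder N []" using sets_eq_imp_space_eq[OF sets] by (simp add: cylinder_Nil)
    then show "emeasure \<mu> (space \<mu>) \<noteq> \<infinity>" using emeasure[OF cylinder_in, of "[]"] by simp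
  qed
  ultimately show ?thesis using sets that by blast
qed

section \<open>Square integrable functions\<close>

text \<open>Squared L2 seminorm, on functions rather than classes. Keeping the square avoids roots;
  the triangle inequality is replaced by \<open>sqnorm_triangle\<close>, with factors 2.\<close>

definition sqnorm :: "'x measure \<Rightarrow> ('x \<Rightarrow> complex) \<Rightarrow> real"
  where "sqnorm \<mu> f = (\<integral>x. (cmod (f x))\<^sup>2 \<partial>\<mu>)"

lemma sq_integrableD:
  assumes "f \<in> sq_integrable \<mu>"
  shows sq_integrable_measurable: "f \<in> borel_measurable \<mu>"
    and sq_integrable_integrable: "integrable \<mu> (\<lambda>x. (cmod (f x))\<^sup>2)"
  using assms by (auto simp: sq_integrable_def)

lemma sq_integrable_diff:
  "f \<in> sq_integrable \<mu> \<Longrightarrow> g \<in> sq_integrable \<mu> \<Longrightarrow> (\<lambda>x. f x - g x) \<in> sq_integrable \<mu>"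
  using sq_integrable_add[of f \<mu> "\<lambda>x. (-1) * g x"] sq_integrable_scale[of g \<mu> "-1"] by simp

lemma sq_integrable_zero [simp]: "(\<lambda>x. 0) \<in> sq_integrable \<mu>"
  by (simp add: sq_integrable_def)

lemma sq_integrable_sum:
  "(\<And>i. i \<in> A \<Longrightarrow> f i \<in> sq_integrable \<mu>) \<Longrightarrow> (\<lambda>x. \<Sum>i\<in>A. f i x) \<in> sq_integrable \<mu>"
  by (induction A rule: infinite_finite_induct) (auto intro: sq_integrable_add)

lemma sq_integrable_dominated:
  assumes "g \<in> sq_integrable \<mu>" and [measurable]: "f \<in> borel_measurable \<mu>"
    and "AE x in \<mu>. cmod (f x) \<le> c * cmod (g x)" "0 \<le> c"
  shows "f \<in> sq_integrable \<mu>"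
proof -
  have "integrable \<mu> (\<lambda>x. (cmod (f x))\<^sup>2)"
  proof (rule Bochner_Integration.integrable_bound)
    show "integrable \<mu> (\<lambda>x. c\<^sup>2 * (cmod (g x))\<^sup>2)"
      using assms(1) by (simp add: sq_integrable_def)
    show "AE x in \<mu>. norm ((cmod (f x))\<^sup>2) \<le> norm (c\<^sup>2 * (cmod (g x))\<^sup>2)"
      using assms(3) by eventually_elim (use \<open>0 \<le> c\<close> in \<open>auto simp flip: power_mult_distrib intro!: power_mono\<close>)
  qed simp
  then show ?thesis by (simp add: sq_integrable_def)
qed

lemma sqnorm_nonneg: "0 \<le> sqnorm \<mu> f"
  by (simp add: sqnorm_def)

lemma sqnorm_scale: "sqnorm \<mu> (\<lambda>x. c * f x) = (cmod c)\<^sup>2 * sqnorm \<mu> f"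
  by (simp add: sqnorm_def norm_mult power_mult_distrib)

lemma sqnorm_add_le:
  assumes "f \<in> sq_integrable \<mu>" "g \<in> sq_integrable \<mu>"
  shows "sqnorm \<mu> (\<lambda>x. f x + g x) \<le> 2 * sqnorm \<mu> f + 2 * sqnorm \<mu> g"
proof -
  have "sqnorm \<mu> (\<lambda>x. f x + g x) \<le> (\<integral>x. 2 * (cmod (f x))\<^sup>2 + 2 * (cmod (g x))\<^sup>2 \<partial>\<mu>)"
    unfolding sqnorm_def
  proof (rule integral_mono)
    fix x
    have "(cmod (f x + g x))\<^sup>2 \<le> 2 * (cmod (f x))\<^sup>2 + 2 * (cmod (g x))\<^sup>2"
      using parallelogram_law[of "f x" "g x"] zero_le_power2[of "cmod (f x - g x)"] by linarith
    then show "(cmod (f x + g x))\<^sup>2 \<le> 2 * (cmod (f x))\<^sup>2 + 2 * (cmod (g x))\<^sup>2" .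
  qed (use assms sq_integrable_add[OF assms] in \<open>auto simp: sq_integrable_def\<close>)
  also have "\<dots> = 2 * sqnorm \<mu> f + 2 * sqnorm \<mu> g"
    using assms by (simp add: sqnorm_def sq_integrable_integrable)
  finally show ?thesis .
qed

lemma sqnorm_diff_commute: "sqnorm \<mu> (\<lambda>x. f x - g x) = sqnorm \<mu> (\<lambda>x. g x - f x)"
  by (simp add: sqnorm_def norm_minus_commute)

lemma sqnorm_triangle:
  assumes "f \<in> sq_integrable \<mu>" "g \<in> sq_integrable \<mu>" "h \<in> sq_integrable \<mu>"
  shows "sqnorm \<mu> (\<lambda>x. f x - h x) \<le> 2 * sqnorm \<mu> (\<lambda>x. f x - g x) + 2 * sqnorm \<mu> (\<lambda>x. g x - h x)"
  using sqnorm_add_le[of "\<lambda>x. f x - g x" \<mu> "\<lambda>x. g x - h x"] assms by (simp add: sq_integrable_diff)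

lemma sqnorm_eq_0:
  assumes "f \<in> sq_integrable \<mu>"
  shows "sqnorm \<mu> f = 0 \<longleftrightarrow> (AE x in \<mu>. f x = 0)"
  using integral_nonneg_eq_0_iff_AE[OF sq_integrable_integrable[OF assms]]
  by (simp add: sqnorm_def)

lemma measurable_cnj [measurable]: "cnj \<in> borel_measurable borel"
  by (intro borel_measurable_continuous_onI continuous_intros)

lemma integrable_cnj_mult:
  assumes "f \<in> sq_integrable \<mu>" "g \<in> sq_integrable \<mu>"
  shows "integrable \<mu> (\<lambda>x. cnj (f x) * g x)"
proof (rule Bochner_Integration.integrable_bound)
  have [measurable]: "f \<in> borel_measurable \<mu>" "g \<in> borel_measurable \<mu>"
    using assms by (auto simp: sq_integrable_def)
  show "integrable \<mu> (\<lambda>x. (cmod (f x))\<^sup>2 + (cmod (g x))\<^sup>2)"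
    using assms by (simp add: sq_integrable_def)
  have "cmod a * cmod b \<le> (cmod a)\<^sup>2 + (cmod b)\<^sup>2" for a b
    using sum_squares_bound[of "cmod a" "cmod b"] mult_nonneg_nonneg[of "cmod a" "cmod b"] norm_ge_zero[of a]
      norm_ge_zero[of b] unfolding mult.assoc by linarith
  then show "AE x in \<mu>. norm (cnj (f x) * g x) \<le> norm ((cmod (f x))\<^sup>2 + (cmod (g x))\<^sup>2)"
    by (simp add: norm_mult)
  show "(\<lambda>x. cnj (f x) * g x) \<in> borel_measurable \<mu>" by measurable
qed

text \<open>Pointwise, the difference of \<open>|b|\<^sup>2\<close> and \<open>|a|\<^sup>2\<close>
  is at most \<open>|a - b| * (|a - b| + 2 * |a|)\<close>, and the mixed term is split by
  \<open>2 * p * q \<le> s * p\<^sup>2 + q\<^sup>2 / s\<close>. The free weight \<open>s\<close>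
  does the work of the Cauchy-Schwarz inequality for integrals.\<close>

lemma sqnorm_diff_bound:
  assumes f: "f \<in> sq_integrable \<mu>" and g: "g \<in> sq_integrable \<mu>" and "s > 0"
  shows "\<bar>sqnorm \<mu> g - sqnorm \<mu> f\<bar> \<le>
    sqnorm \<mu> (\<lambda>x. f x - g x) + s * sqnorm \<mu> f + sqnorm \<mu> (\<lambda>x. f x - g x) / s"
proof -
  note int = sq_integrable_integrable[OF f] sq_integrable_integrable[OF g]
    sq_integrable_integrable[OF sq_integrable_diff[OF f g]]
  have "\<bar>sqnorm \<mu> g - sqnorm \<mu> f\<bar> = \<bar>\<integral>x. (cmod (g x))\<^sup>2 - (cmod (f x))\<^sup>2 \<partial>\<mu>\<bar>"
    using int by (simp add: sqnorm_def)
  also have "\<dots> \<le> (\<integral>x. \<bar>(cmod (g x))\<^sup>2 - (cmod (f x))\<^sup>2\<bar> \<partial>\<mu>)"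
    by (rule integral_abs_bound)
  also have "\<dots> \<le> (\<integral>x. (cmod (f x - g x))\<^sup>2 + s * (cmod (f x))\<^sup>2 + (cmod (f x - g x))\<^sup>2 / s \<partial>\<mu>)"
  proof (rule integral_mono)
    fix x
    have *: "\<bar>(cmod b)\<^sup>2 - (cmod a)\<^sup>2\<bar> \<le> (cmod (a - b))\<^sup>2 + s * (cmod a)\<^sup>2 + (cmod (a - b))\<^sup>2 / s" for a b
    proof -
      have "\<bar>(cmod b)\<^sup>2 - (cmod a)\<^sup>2\<bar> = \<bar>cmod b - cmod a\<bar> * (cmod b + cmod a)"
        by (simp add: power2_eq_square abs_mult_pos' flip: square_diff_square_factored abs_mult)
          (simp add: square_diff_square_factored abs_mult mult.commute)
      also have "\<dots> \<le> cmod (a - b) * (cmod (a - b) + 2 * cmod a)"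
        using norm_triangle_ineq3[of b a] norm_triangle_ineq3[of a b] norm_triangle_sub[of b a]
        by (intro mult_mono) (auto simp: norm_minus_commute)
      also have "\<dots> = (cmod (a - b))\<^sup>2 + 2 * cmod a * cmod (a - b)"
        by (simp add: power2_eq_square algebra_simps)
      also have "2 * cmod a * cmod (a - b) \<le> s * (cmod a)\<^sup>2 + (cmod (a - b))\<^sup>2 / s"
      proof -
        have "0 \<le> (s * cmod a - cmod (a - b))\<^sup>2 / s" using \<open>s > 0\<close> by simp
        also have "\<dots> = s * (cmod a)\<^sup>2 + (cmod (a - b))\<^sup>2 / s - 2 * cmod a * cmod (a - b)"
          using \<open>s > 0\<close> by (simp add: power2_eq_square field_simps)
        finally show ?thesis by simp
      qed
      finally show ?thesis by simp
    qed
    show "\<bar>(cmod (g x))\<^sup>2 - (cmod (f x))\<^sup>2\<bar> \<le>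
        (cmod (f x - g x))\<^sup>2 + s * (cmod (f x))\<^sup>2 + (cmod (f x - g x))\<^sup>2 / s"
      by (rule *)
  qed (use int in auto)
  also have "\<dots> = sqnorm \<mu> (\<lambda>x. f x - g x) + s * sqnorm \<mu> f + sqnorm \<mu> (\<lambda>x. f x - g x) / s"
    using int by (simp add: sqnorm_def)
  finally show ?thesis .
qed

lemma tendsto_sqnorm:
  assumes f: "f \<in> sq_integrable \<mu>" and g: "\<And>k. g k \<in> sq_integrable \<mu>"
    and lim: "(\<lambda>k. sqnorm \<mu> (\<lambda>x. f x - g k x)) \<longlonglongrightarrow> 0"
  shows "(\<lambda>k. sqnorm \<mu> (g k)) \<longlonglongrightarrow> sqnorm \<mu> f"
proof -
  define d where "d k = sqnorm \<mu> (\<lambda>x. f x - g k x)" for k :: nat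
  \<comment> \<open>The root of \<open>d k\<close> balances the last two terms of
    \<open>sqnorm_diff_bound\<close>; the summand \<open>1 / real (Suc k)\<close> keeps the weight
    positive when \<open>d k = 0\<close>.\<close>
  define s where "s k = sqrt (d k) + 1 / real (Suc k)" for k :: nat
  have d0: "0 \<le> d k" for k by (simp add: d_def sqnorm_nonneg)
  have bound: "\<bar>sqnorm \<mu> (g k) - sqnorm \<mu> f\<bar> \<le> d k + s k * sqnorm \<mu> f + sqrt (d k)" for k
  proof -
    have s: "s k > 0" using d0[of k] by (simp add: s_def add_nonneg_pos)
    have "d k = sqrt (d k) * sqrt (d k)" using d0 by simp
    also have "\<dots> \<le> sqrt (d k) * s k" using d0 by (intro mult_left_mono) (auto simp: s_def)
    finally have "d k / s k \<le> sqrt (d k)" using s by (simp add: divide_le_eq)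
    then show ?thesis using sqnorm_diff_bound[OF f g[of k] s] by (simp add: d_def)
  qed
  have "d \<longlonglongrightarrow> 0" using lim by (simp add: d_def[abs_def])
  moreover have "(\<lambda>k. 1 / real (Suc k)) \<longlonglongrightarrow> 0"
    using LIMSEQ_inverse_real_of_nat by (simp add: inverse_eq_divide)
  ultimately have "(\<lambda>k. d k + s k * sqnorm \<mu> f + sqrt (d k)) \<longlonglongrightarrow>
      0 + (sqrt 0 + 0) * sqnorm \<mu> f + sqrt 0"
    unfolding s_def by (intro tendsto_intros)
  then have "(\<lambda>k. d k + s k * sqnorm \<mu> f + sqrt (d k)) \<longlonglongrightarrow> 0" by simp
  then have "(\<lambda>k. sqnorm \<mu> (g k) - sqnorm \<mu> f) \<longlonglongrightarrow> 0"
    by (rule Lim_null_comparison[rotated]) (use bound in auto)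
  then show ?thesis by (rule LIM_zero_cancel)
qed

section \<open>Square integrability and completeness over a finite measure\<close>

lemma (in finite_measure) sq_integrable_integrable1:
  assumes "f \<in> sq_integrable M" shows "integrable M f"
proof (rule Bochner_Integration.integrable_bound)
  show "integrable M (\<lambda>x. 1 + (cmod (f x))\<^sup>2)"
    using assms by (simp add: sq_integrable_integrable)
  have "cmod a \<le> 1 + (cmod a)\<^sup>2" for a
    using sum_squares_bound[of 1 "cmod a"] norm_ge_zero[of a]
    by (simp del: norm_ge_zero)
  then show "AE x in M. norm (f x) \<le> norm (1 + (cmod (f x))\<^sup>2)" by simp
qed (use assms in \<open>simp add: sq_integrable_measurable\<close>)

lemma (in finite_measure) sq_integrable_bounded:
  assumes "f \<in> borel_measurable M" "\<And>x. x \<in> space M \<Longrightarrow> cmod (f x) \<le> B"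
  shows "f \<in> sq_integrable M"
proof -
  have "integrable M (\<lambda>x. (cmod (f x))\<^sup>2)"
    using assms by (intro integrable_const_bound[of _ "B\<^sup>2"]) (auto intro!: power_mono)
  then show ?thesis using assms by (simp add: sq_integrable_def)
qed

text \<open>Riesz--Fischer: the increments of a rapidly converging subsequence are summable almost
  everywhere.\<close>
lemma (in finite_measure) L2_complete:
  fixes g :: "nat \<Rightarrow> 'a \<Rightarrow> complex"
  assumes g: "\<And>k. g k \<in> sq_integrable M"
    and cauchy: "\<And>e. e > 0 \<Longrightarrow> \<exists>K. \<forall>k\<ge>K. \<forall>l\<ge>K. sqnorm M (\<lambda>x. g k x - g l x) < e"
  obtains f where "f \<in> sq_integrable M" "(\<lambda>k. sqnorm M (\<lambda>x. f x - g k x)) \<longlonglongrightarrow> 0"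
proof -
  have [measurable]: "g k \<in> borel_measurable M" for k using g by (rule sq_integrable_measurable)
  have "\<exists>K. \<forall>k\<ge>K. \<forall>l\<ge>K. sqnorm M (\<lambda>x. g k x - g l x) < (1/4) ^ n" for n
    by (rule cauchy) simp
  then obtain K where K: "\<And>n k l. k \<ge> K n \<Longrightarrow> l \<ge> K n \<Longrightarrow> sqnorm M (\<lambda>x. g k x - g l x) < (1/4) ^ n"
    by metis
  \<comment> \<open>Summing the \<open>K i\<close> makes the indices increasing and at least
    \<open>K n\<close>; adding \<open>n\<close> sends them to infinity.\<close>
  define r where "r n = (\<Sum>i\<le>n. K i) + n" for n
  have r_ge: "K n \<le> r n" "r n \<le> r (Suc n)" "n \<le> r n" for n
    unfolding r_def using member_le_sum[of n "{..n}" K] by auto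
  define d where "d n x = g (r (Suc n)) x - g (r n) x" for n x
  have [measurable]: "d n \<in> borel_measurable M" for n unfolding d_def by measurable
  have d: "d n \<in> sq_integrable M" for n unfolding d_def using g by (intro sq_integrable_diff)
  have int_d: "(\<integral>x. cmod (d n x) \<partial>M) \<le> (1 + measure M (space M)) * (1/2) ^ n" for n
  proof -
    have i1: "integrable M (\<lambda>x. (cmod (d n x))\<^sup>2)" by (rule sq_integrable_integrable[OF d])
    \<comment> \<open>Expanding a square gives
      \<open>2 * c \<le> 2 ^ n * c\<^sup>2 + 1 / 2 ^ n\<close>. This bounds the L1 norm by the
      squared L2 norm at the cost of a factor \<open>2 ^ n\<close>; the rate
      \<open>(1/4) ^ n\<close> was chosen so that a summable bound remains.\<close>
    have "(\<integral>x. cmod (d n x) \<partial>M) \<le> (\<integral>x. 2 ^ n * (cmod (d n x))\<^sup>2 + (1/2) ^ n \<partial>M)"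
    proof (rule integral_mono)
      fix x
      let ?t = "2 ^ n :: real" and ?c = "cmod (d n x)"
      have "0 \<le> (?t * ?c - 1)\<^sup>2 / ?t" by simp
      also have "\<dots> = ?t * ?c\<^sup>2 + 1 / ?t - 2 * ?c"
        by (simp add: power2_eq_square field_simps)
      finally show "?c \<le> ?t * ?c\<^sup>2 + (1/2) ^ n"
        using norm_ge_zero[of "d n x"] unfolding power_one_over by linarith
    qed (use i1 sq_integrable_integrable1[OF d] in auto)
    also have "\<dots> = 2 ^ n * sqnorm M (d n) + (1/2) ^ n * measure M (space M)"
      using i1 by (simp add: sqnorm_def)
    also have "\<dots> \<le> 2 ^ n * (1/4) ^ n + (1/2) ^ n * measure M (space M)"
      using K[of n "r (Suc n)" "r n"] r_ge[of n] by (simp add: d_def[abs_def])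
    also have "(2::real) ^ n * (1/4) ^ n = (1/2) ^ n"
      by (simp flip: power_mult_distrib)
    finally show ?thesis by (simp add: algebra_simps)
  qed
  have "AE x in M. (\<Sum>n. ennreal (cmod (d n x))) \<noteq> \<infinity>"
  proof (rule nn_integral_PInf_AE)
    have "(\<integral>\<^sup>+x. (\<Sum>n. ennreal (cmod (d n x))) \<partial>M) = (\<Sum>n. \<integral>\<^sup>+x. ennreal (cmod (d n x)) \<partial>M)"
      by (rule nn_integral_suminf) simp
    also have "\<dots> \<le> (\<Sum>n. ennreal ((1 + measure M (space M)) * (1/2) ^ n))"
      using sq_integrable_integrable1[OF d] int_d
      by (intro suminf_le) (auto simp: nn_integral_eq_integral ennreal_leI)
    also have "\<dots> < \<infinity>"
    proof -
      have "summable (\<lambda>n. (1 + measure M (space M)) * (1/2) ^ n)"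
        by (intro summable_mult summable_geometric) simp
      then show ?thesis
        by (subst infinity_ennreal_def, subst top.not_eq_extremum[symmetric])
          (rule ennreal_suminf_neq_top, simp_all)
    qed
    finally show "(\<integral>\<^sup>+x. (\<Sum>n. ennreal (cmod (d n x))) \<partial>M) \<noteq> \<infinity>" by simp
  qed simp
  then have conv: "AE x in M. convergent (\<lambda>n. g (r n) x)"
  proof eventually_elim
    case (elim x)
    then have "summable (\<lambda>n. cmod (d n x))" by (intro summable_suminf_not_top) auto
    then have "summable (\<lambda>n. d n x)" by (rule summable_norm_cancel)
    then have "convergent (\<lambda>n. \<Sum>i<n. d i x)" by (simp add: summable_iff_convergent)
    then have "convergent (\<lambda>n. g (r 0) x + (\<Sum>i<n. d i x))" by (simp add: convergent_add_const_iff)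
    moreover have "g (r 0) x + (\<Sum>i<n. d i x) = g (r n) x" for n
      unfolding d_def using sum_lessThan_telescope[of "\<lambda>n. g (r n) x" n] by simp
    ultimately show ?case by simp
  qed
  define f where "f x = lim (\<lambda>n. g (r n) x)" for x
  have [measurable]: "f \<in> borel_measurable M" unfolding f_def by measurable
  have lim: "AE x in M. (\<lambda>n. g (r n) x) \<longlonglongrightarrow> f x"
    using conv by eventually_elim (auto simp: f_def convergent_LIMSEQ_iff)
  \<comment> \<open>Fatou's lemma along the subsequence lets \<open>f\<close> inherit the Cauchy
    estimate of the \<open>g k\<close>.\<close>
  have key: "(\<integral>\<^sup>+x. ennreal ((cmod (f x - g k x))\<^sup>2) \<partial>M) \<le> ennreal ((1/4) ^ n)" if "k \<ge> K n" for n k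
  proof -
    have "(\<integral>\<^sup>+x. ennreal ((cmod (f x - g k x))\<^sup>2) \<partial>M) =
        (\<integral>\<^sup>+x. liminf (\<lambda>j. ennreal ((cmod (g (r j) x - g k x))\<^sup>2)) \<partial>M)"
    proof (rule nn_integral_cong_AE)
      show "AE x in M. ennreal ((cmod (f x - g k x))\<^sup>2) = liminf (\<lambda>j. ennreal ((cmod (g (r j) x - g k x))\<^sup>2))"
        using lim
      proof eventually_elim
        case (elim x)
        then have "(\<lambda>j. ennreal ((cmod (g (r j) x - g k x))\<^sup>2)) \<longlonglongrightarrow> ennreal ((cmod (f x - g k x))\<^sup>2)"
          by (intro tendsto_intros tendsto_ennrealI)
        from lim_imp_Liminf[OF _ this] show ?case by (rule sym) simp
      qed
    qed
    also have "\<dots> \<le> liminf (\<lambda>j. \<integral>\<^sup>+x. ennreal ((cmod (g (r j) x - g k x))\<^sup>2) \<partial>M)"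
      by (rule nn_integral_liminf) simp
    also have "\<dots> \<le> ennreal ((1/4) ^ n)"
    proof (rule Liminf_le)
      have "(\<integral>\<^sup>+x. ennreal ((cmod (g (r j) x - g k x))\<^sup>2) \<partial>M) \<le> ennreal ((1/4) ^ n)" if "j \<ge> K n" for j
      proof -
        have "K n \<le> r j" using that r_ge(3)[of j] by linarith
        then have "sqnorm M (\<lambda>x. g (r j) x - g k x) < (1/4) ^ n" using K \<open>k \<ge> K n\<close> by blast
        then show ?thesis
          using sq_integrable_integrable[OF sq_integrable_diff[OF g g], of "r j" k]
          by (simp add: nn_integral_eq_integral sqnorm_def ennreal_leI less_imp_le)
      qed
      then show "eventually (\<lambda>j. (\<integral>\<^sup>+x. ennreal ((cmod (g (r j) x - g k x))\<^sup>2) \<partial>M) \<le> ennreal ((1/4) ^ n)) sequentially"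
        by (auto simp: eventually_sequentially)
    qed simp
    finally show ?thesis .
  qed
  have diff: "(\<lambda>x. f x - g k x) \<in> sq_integrable M" if "k \<ge> K 0" for k
    using le_less_trans[OF key[OF that]] by (simp add: sq_integrable_def integrable_iff_bounded)
  have "f \<in> sq_integrable M"
    using sq_integrable_add[OF diff[OF order_refl] g[of "K 0"]] by simp
  moreover have "(\<lambda>k. sqnorm M (\<lambda>x. f x - g k x)) \<longlonglongrightarrow> 0"
  proof (rule LIMSEQ_I)
    fix e :: real assume "e > 0"
    then obtain n where n: "(1/4) ^ n < e"
      using real_arch_pow_inv[of e "1/4"] by auto
    have "norm (sqnorm M (\<lambda>x. f x - g k x) - 0) < e" if "k \<ge> K n" for k
    proof -
      have "(\<lambda>x. f x - g k x) \<in> sq_integrable M"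
        using \<open>f \<in> sq_integrable M\<close> g by (rule sq_integrable_diff)
      then have "ennreal (sqnorm M (\<lambda>x. f x - g k x)) \<le> ennreal ((1/4) ^ n)"
        using key[OF that] by (simp add: sqnorm_def nn_integral_eq_integral sq_integrable_integrable)
      then show ?thesis using n sqnorm_nonneg[of M "\<lambda>x. f x - g k x"] by simp
    qed
    then show "\<exists>K. \<forall>k\<ge>K. norm (sqnorm M (\<lambda>x. f x - g k x) - 0) < e" by blast
  qed
  ultimately show ?thesis by (rule that)
qed

section \<open>Density of cylinder functions\<close>

locale word_measure = finite_measure \<mu> for \<mu> :: "(nat \<Rightarrow> nat) measure" +
  fixes N :: nat
  assumes N_pos: "0 < N" and sets_eq: "sets \<mu> = sets (word_borel N)"
begin

lemma space_eq: "space \<mu> = infinite_words N"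
  using sets_eq_imp_space_eq[OF sets_eq] by simp

lemma cylinder_sets [measurable]: "cylinder N I \<in> sets \<mu>"
  using cylinder_in_sets[OF N_pos] by (simp add: sets_eq)

text \<open>At \<open>w\<close> only the indicator belonging to \<open>prefix n w\<close> is
  nonzero. The target is a general ring since the expansion serves complex functions as well as
  their real squared moduli.\<close>

lemma cylinder_fun_expand:
  fixes g :: "(nat \<Rightarrow> nat) \<Rightarrow> 'b::comm_ring_1"
  assumes "cylinder_fun N n g" "w \<in> infinite_words N"
  shows "g w = (\<Sum>I\<in>words N n. g (pad I) * indicator (cylinder N I) w)"
proof -
  have "(\<Sum>I\<in>words N n. g (pad I) * indicator (cylinder N I) w) =
      (\<Sum>I\<in>words N n. if prefix n w = I then g (pad I) else 0)"
    using assms(2) by (intro sum.cong refl) (simp add: mem_cylinder_eq length_words indicator_def)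
  also have "\<dots> = g (pad (prefix n w))"
    using prefix_words[OF assms(2), of n] by simp
  finally show ?thesis using assms by (simp add: cylinder_fun_def)
qed

lemma cylinder_fun_indicator: "cylinder_fun N (length I) (indicator (cylinder N I) :: _ \<Rightarrow> complex)"
  using cylinder_fun_comp[OF cylinder_fun_mem_cylinder[OF N_pos, of I], where h = of_bool]
  by (simp add: indicator_def[abs_def])

lemma cylinder_fun_sq_integrable:
  assumes g: "cylinder_fun N n g"
  shows "g \<in> sq_integrable \<mu>"
proof (rule sq_integrable_bounded)
  have "(\<lambda>w. \<Sum>I\<in>words N n. g (pad I) * indicator (cylinder N I) w) \<in> borel_measurable \<mu>"
    by measurable
  then show "g \<in> borel_measurable \<mu>"
    using cylinder_fun_expand[OF g] by (subst measurable_cong) (auto simp: space_eq)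
  fix w assume "w \<in> space \<mu>"
  then have "prefix n w \<in> words N n" "g w = g (pad (prefix n w))"
    using g by (auto simp: space_eq prefix_words cylinder_fun_def)
  then show "cmod (g w) \<le> (\<Sum>I\<in>words N n. cmod (g (pad I)))"
    using member_le_sum[of "prefix n w" "words N n" "\<lambda>I. cmod (g (pad I))"] by simp
qed

lemma indicator_sq_integrable:
  "A \<in> sets \<mu> \<Longrightarrow> (indicator A :: _ \<Rightarrow> complex) \<in> sq_integrable \<mu>"
  by (rule sq_integrable_bounded[of _ 1]) (auto simp: indicator_def)

lemma mult_indicator_sq_integrable:
  assumes "A \<in> sets \<mu>" "g \<in> sq_integrable \<mu>"
  shows "(\<lambda>x. indicator A x * g x) \<in> sq_integrable \<mu>"
proof (rule sq_integrable_dominated[OF assms(2), of _ 1])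
  show "(\<lambda>x. indicator A x * g x) \<in> borel_measurable \<mu>"
    using assms sq_integrable_measurable[OF assms(2)] by measurable
qed (auto simp: indicator_def)

text \<open>Membership in the L2 closure of the cylinder functions, as a predicate, so that density
  can be proved by induction over the \<sigma>-algebra.\<close>

definition approx :: "((nat \<Rightarrow> nat) \<Rightarrow> complex) \<Rightarrow> bool"
  where "approx f \<longleftrightarrow> f \<in> sq_integrable \<mu> \<and>
    (\<forall>e>0. \<exists>n g. cylinder_fun N n g \<and> sqnorm \<mu> (\<lambda>x. f x - g x) < e)"

lemma approx_cylinder_fun: "cylinder_fun N n g \<Longrightarrow> approx g"
  unfolding approx_def
  by (auto intro!: exI[of _ n] exI[of _ g] cylinder_fun_sq_integrable simp: sqnorm_def)

text \<open>A closure is closed; the shares \<open>e / 4\<close> absorb the factors 2 of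
  \<open>sqnorm_triangle\<close>.\<close>

lemma approx_lim:
  assumes f: "f \<in> sq_integrable \<mu>"
    and h: "\<And>e. e > 0 \<Longrightarrow> \<exists>h. approx h \<and> sqnorm \<mu> (\<lambda>x. f x - h x) < e"
  shows "approx f"
  unfolding approx_def
proof (intro conjI f allI impI)
  fix e :: real assume "e > 0"
  then obtain h where h: "approx h" "sqnorm \<mu> (\<lambda>x. f x - h x) < e / 4"
    using h[of "e / 4"] by auto
  then obtain n g where g: "cylinder_fun N n g" "sqnorm \<mu> (\<lambda>x. h x - g x) < e / 4"
    using \<open>e > 0\<close> unfolding approx_def by (meson divide_pos_pos zero_less_numeral)
  have "sqnorm \<mu> (\<lambda>x. f x - g x) < e"
    using sqnorm_triangle[OF f _ cylinder_fun_sq_integrable[OF g(1)], of h] h g(2)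
    by (auto simp: approx_def)
  then show "\<exists>n g. cylinder_fun N n g \<and> sqnorm \<mu> (\<lambda>x. f x - g x) < e" using g(1) by blast
qed

lemma approx_add:
  assumes "approx f" "approx g" shows "approx (\<lambda>x. f x + g x)"
proof (rule approx_lim)
  have fg: "f \<in> sq_integrable \<mu>" "g \<in> sq_integrable \<mu>" using assms by (auto simp: approx_def)
  then show "(\<lambda>x. f x + g x) \<in> sq_integrable \<mu>" by (rule sq_integrable_add)
  fix e :: real assume "e > 0"
  then have e: "e / 4 > 0" by simp
  obtain n h where h: "cylinder_fun N n h" "sqnorm \<mu> (\<lambda>x. f x - h x) < e / 4"
    using assms(1) e unfolding approx_def by blast
  obtain m k where k: "cylinder_fun N m k" "sqnorm \<mu> (\<lambda>x. g x - k x) < e / 4"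
    using assms(2) e unfolding approx_def by blast
  have "cylinder_fun N (max n m) (\<lambda>x. h x + k x)"
    using cylinder_fun_mono[OF h(1) max.cobounded1 N_pos] cylinder_fun_mono[OF k(1) max.cobounded2 N_pos]
    by (rule cylinder_fun_comp2)
  moreover have "sqnorm \<mu> (\<lambda>x. (f x + g x) - (h x + k x)) < e"
    using sqnorm_add_le[OF sq_integrable_diff[OF fg(1) cylinder_fun_sq_integrable[OF h(1)]]
        sq_integrable_diff[OF fg(2) cylinder_fun_sq_integrable[OF k(1)]]] h(2) k(2)
    by (simp add: algebra_simps)
  ultimately show "\<exists>h. approx h \<and> sqnorm \<mu> (\<lambda>x. f x + g x - h x) < e"
    using approx_cylinder_fun by blast
qed

lemma approx_scale:
  assumes "approx f" shows "approx (\<lambda>x. c * f x)"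
proof (rule approx_lim)
  have f: "f \<in> sq_integrable \<mu>" using assms by (auto simp: approx_def)
  then show "(\<lambda>x. c * f x) \<in> sq_integrable \<mu>" by (rule sq_integrable_scale)
  fix e :: real assume "e > 0"
  \<comment> \<open>The 1 in the denominator covers the case \<open>c = 0\<close>.\<close>
  then have e: "e / (1 + (cmod c)\<^sup>2) > 0" by (simp add: add_pos_nonneg)
  then obtain n h where h: "cylinder_fun N n h" "sqnorm \<mu> (\<lambda>x. f x - h x) < e / (1 + (cmod c)\<^sup>2)"
    using assms unfolding approx_def by blast
  have "sqnorm \<mu> (\<lambda>x. c * f x - c * h x) = (cmod c)\<^sup>2 * sqnorm \<mu> (\<lambda>x. f x - h x)"
    using sqnorm_scale[of \<mu> c "\<lambda>x. f x - h x"] by (simp add: right_diff_distrib)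
  also have "\<dots> \<le> (1 + (cmod c)\<^sup>2) * sqnorm \<mu> (\<lambda>x. f x - h x)"
    by (intro mult_right_mono sqnorm_nonneg) simp
  also have "\<dots> < e" using h(2) by (simp add: less_divide_eq add_pos_nonneg mult.commute)
  finally show "\<exists>h. approx h \<and> sqnorm \<mu> (\<lambda>x. c * f x - h x) < e"
    using approx_cylinder_fun[OF cylinder_fun_comp[OF h(1), of "\<lambda>z. c * z"]] by blast
qed

lemma approx_sum:
  "(\<And>i. i \<in> A \<Longrightarrow> approx (f i)) \<Longrightarrow> approx (\<lambda>x. \<Sum>i\<in>A. f i x)"
  by (induction A rule: infinite_finite_induct)
    (auto intro: approx_add approx_cylinder_fun[OF cylinder_fun_const])

lemma approx_cong:
  assumes "approx f" "\<And>x. x \<in> space \<mu> \<Longrightarrow> f x = g x"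
  shows "approx g"
proof -
  have f: "f \<in> sq_integrable \<mu>" using assms(1) by (simp add: approx_def)
  have "g \<in> borel_measurable \<mu>"
    using sq_integrable_measurable[OF f] assms(2) by (simp cong: measurable_cong)
  then have g: "g \<in> sq_integrable \<mu>"
    using f assms(2) by (intro sq_integrable_dominated[of f _ g 1]) auto
  have "sqnorm \<mu> (\<lambda>x. g x - h x) = sqnorm \<mu> (\<lambda>x. f x - h x)" for h
    unfolding sqnorm_def using assms(2) by (intro Bochner_Integration.integral_cong) auto
  then show ?thesis using assms(1) g by (simp add: approx_def)
qed

text \<open>Because the generator is Int-stable, closure under complements and countable disjoint
  unions suffices. For a disjoint union the finite partial unions \<open>B k\<close> converge in
  squared mean by dominated convergence, with the constant 1 as integrable bound.\<close>

lemma approx_indicator: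
  assumes "A \<in> sets \<mu>"
  shows "approx (indicator A)"
proof -
  let ?G = "insert {} (range (cylinder N))"
  have sets: "sets \<mu> = sigma_sets (infinite_words N) ?G"
    using sigma_sets_cylinders[OF N_pos] by (simp add: sets_eq)
  have zero: "approx (\<lambda>x. 0)" by (rule approx_cylinder_fun[OF cylinder_fun_const])
  have "?G \<subseteq> Pow (infinite_words N)" using cylinder_subset by blast
  with Int_stable_cylinders show ?thesis
    using assms unfolding sets
  proof (induction A rule: sigma_sets_induct_disjoint)
    case (basic A)
    then show ?case using approx_cylinder_fun[OF cylinder_fun_indicator] zero
      by (auto simp: indicator_def[abs_def])
  next
    case empty
    then show ?case using zero by (simp add: indicator_def[abs_def])
  next
    case (compl A)
    have "approx (\<lambda>x. 1 + (-1) * indicator A x)"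
      by (intro approx_add approx_scale compl.IH approx_cylinder_fun[OF cylinder_fun_const])
    then show ?case by (rule approx_cong) (auto simp: space_eq indicator_def)
  next
    case (union A)
    have A [measurable]: "A i \<in> sets \<mu>" for i using union.hyps(2) by (auto simp: sets)
    define B where "B k = (\<Union>i<k. A i)" for k
    have [measurable]: "B k \<in> sets \<mu>" for k unfolding B_def by measurable
    have B: "approx (indicator (B k))" for k
    proof -
      have "approx (\<lambda>x. \<Sum>i<k. indicator (A i) x)" by (rule approx_sum) (rule union.IH)
      moreover have "(\<Sum>i<k. indicator (A i) x :: complex) = indicator (B k) x" for x
      proof -
        have "disjoint_family_on A {..<k}"
          using union.hyps(1) by (rule disjoint_family_on_mono[rotated]) simp
        then show ?thesis unfolding B_def by (simp add: indicator_UN_disjoint)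
      qed
      ultimately show ?thesis by simp
    qed
    have "(\<lambda>k. sqnorm \<mu> (\<lambda>x. indicator (\<Union>i. A i) x - indicator (B k) x)) \<longlonglongrightarrow> (\<integral>x. 0 \<partial>\<mu>)"
      unfolding sqnorm_def
    proof (rule integral_dominated_convergence[where w = "\<lambda>x. 1"])
      show "AE x in \<mu>. (\<lambda>k. (cmod (indicator (\<Union>i. A i) x - indicator (B k) x))\<^sup>2) \<longlonglongrightarrow> 0"
      proof (rule AE_I2)
        fix x
        have "(\<lambda>k. indicator (B k) x :: complex) \<longlonglongrightarrow> indicator (\<Union>i. A i) x"
          unfolding B_def by (rule LIMSEQ_indicator_UN)
        then have "(\<lambda>k. (cmod (indicator (\<Union>i. A i) x - indicator (B k) x))\<^sup>2) \<longlonglongrightarrow>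
            (cmod (indicator (\<Union>i. A i) x - indicator (\<Union>i. A i) x :: complex))\<^sup>2"
          by (intro tendsto_intros)
        then show "(\<lambda>k. (cmod (indicator (\<Union>i. A i) x - indicator (B k) x))\<^sup>2) \<longlonglongrightarrow> 0" by simp
      qed
      show "AE x in \<mu>. norm ((cmod (indicator (\<Union>i. A i) x - indicator (B k) x))\<^sup>2) \<le> 1" for k
        by (auto simp: indicator_def)
    qed (auto simp: borel_measurable_indicator)
    then have lim: "(\<lambda>k. sqnorm \<mu> (\<lambda>x. indicator (\<Union>i. A i) x - indicator (B k) x)) \<longlonglongrightarrow> 0" by simp
    show ?case
    proof (rule approx_lim)
      show "(indicator (\<Union>i. A i) :: _ \<Rightarrow> complex) \<in> sq_integrable \<mu>"
        by (intro indicator_sq_integrable) measurable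
      fix e :: real assume "e > 0"
      from order_tendstoD(2)[OF lim this] obtain k
        where "sqnorm \<mu> (\<lambda>x. indicator (\<Union>i. A i) x - indicator (B k) x) < e"
        by (auto simp: eventually_sequentially)
      then show "\<exists>h. approx h \<and> sqnorm \<mu> (\<lambda>x. indicator (\<Union>i. A i) x - h x) < e"
        using B by blast
    qed
  qed
qed

lemma approx_sq_integrable:
  assumes f: "f \<in> sq_integrable \<mu>"
  shows "approx f"
proof -
  have [measurable]: "f \<in> borel_measurable \<mu>" by (rule sq_integrable_measurable[OF f])
  obtain F where F: "\<And>i. simple_function \<mu> (F i)"
    "\<And>x. x \<in> space \<mu> \<Longrightarrow> (\<lambda>i. F i x) \<longlonglongrightarrow> f x"
    "\<And>i x. x \<in> space \<mu> \<Longrightarrow> cmod (F i x) \<le> 2 * cmod (f x)"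
    using borel_measurable_implies_sequence_metric[of f \<mu> 0] by auto metis
  have [measurable]: "F i \<in> borel_measurable \<mu>" for i
    using F(1) by (rule borel_measurable_simple_function)
  have approx_F: "approx (F i)" for i
  proof (rule approx_cong)
    have "F i -` {y} \<inter> space \<mu> \<in> sets \<mu>" for y by measurable
    then show "approx (\<lambda>x. \<Sum>y\<in>F i ` space \<mu>. y * indicator (F i -` {y} \<inter> space \<mu>) x)"
      by (intro approx_sum approx_scale approx_indicator)
    fix x assume x: "x \<in> space \<mu>"
    have "(\<Sum>y\<in>F i ` space \<mu>. y * indicator (F i -` {y} \<inter> space \<mu>) x) =
        (\<Sum>y\<in>F i ` space \<mu>. if y = F i x then y else 0)"
      using x by (intro sum.cong) (auto simp: indicator_def)
    also have "\<dots> = F i x" using x simple_functionD(1)[OF F(1)] by simp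
    finally show "(\<Sum>y\<in>F i ` space \<mu>. y * indicator (F i -` {y} \<inter> space \<mu>) x) = F i x" .
  qed
  have "(\<lambda>k. sqnorm \<mu> (\<lambda>x. f x - F k x)) \<longlonglongrightarrow> (\<integral>x. 0 \<partial>\<mu>)"
    unfolding sqnorm_def
  \<comment> \<open>The simple functions are bounded by \<open>2 * cmod (f x)\<close>, so the error
    is at most \<open>3 * cmod (f x)\<close>, whose square is the dominating function.\<close>
  proof (rule integral_dominated_convergence[where w = "\<lambda>x. 9 * (cmod (f x))\<^sup>2"])
    show "AE x in \<mu>. (\<lambda>k. (cmod (f x - F k x))\<^sup>2) \<longlonglongrightarrow> 0"
    proof (rule AE_I2)
      fix x assume "x \<in> space \<mu>"
      then have "(\<lambda>k. (cmod (f x - F k x))\<^sup>2) \<longlonglongrightarrow> (cmod (f x - f x))\<^sup>2"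
        by (intro tendsto_intros F)
      then show "(\<lambda>k. (cmod (f x - F k x))\<^sup>2) \<longlonglongrightarrow> 0" by simp
    qed
    show "AE x in \<mu>. norm ((cmod (f x - F k x))\<^sup>2) \<le> 9 * (cmod (f x))\<^sup>2" for k
    proof (rule AE_I2)
      fix x assume "x \<in> space \<mu>"
      then have "cmod (f x - F k x) \<le> 3 * cmod (f x)"
        using norm_triangle_ineq4[of "f x" "F k x"] F(3)[of x k] by linarith
      from power_mono[OF this norm_ge_zero, of 2]
      show "norm ((cmod (f x - F k x))\<^sup>2) \<le> 9 * (cmod (f x))\<^sup>2" by (simp add: power_mult_distrib)
    qed
    show "integrable \<mu> (\<lambda>x. 9 * (cmod (f x))\<^sup>2)" using sq_integrable_integrable[OF f] by simp
  qed measurable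
  then have lim: "(\<lambda>k. sqnorm \<mu> (\<lambda>x. f x - F k x)) \<longlonglongrightarrow> 0" by simp
  show ?thesis
  proof (rule approx_lim[OF f])
    fix e :: real assume "e > 0"
    from order_tendstoD(2)[OF lim this] obtain k where "sqnorm \<mu> (\<lambda>x. f x - F k x) < e"
      by (auto simp: eventually_sequentially)
    then show "\<exists>h. approx h \<and> sqnorm \<mu> (\<lambda>x. f x - h x) < e" using approx_F by blast
  qed
qed

lemma cylinder_funs_dense:
  assumes "f \<in> sq_integrable \<mu>" "e > 0"
  obtains n g where "cylinder_fun N n g" "sqnorm \<mu> (\<lambda>x. f x - g x) < e"
  using approx_sq_integrable[OF assms(1)] assms(2) unfolding approx_def by blast

lemma cylinder_fun_seq:
  assumes "f \<in> sq_integrable \<mu>"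
  obtains n g where "\<And>k. cylinder_fun N (n k) (g k)" "(\<lambda>k. sqnorm \<mu> (\<lambda>x. f x - g k x)) \<longlonglongrightarrow> 0"
proof -
  have "\<exists>n g. cylinder_fun N n g \<and> sqnorm \<mu> (\<lambda>x. f x - g x) < 1 / real (Suc k)" for k
    by (rule cylinder_funs_dense[OF assms, of "1 / real (Suc k)"]) auto
  then obtain n g where g: "\<And>k. cylinder_fun N (n k) (g k)"
    "\<And>k. sqnorm \<mu> (\<lambda>x. f x - g k x) < 1 / real (Suc k)" by metis
  have "(\<lambda>k. sqnorm \<mu> (\<lambda>x. f x - g k x)) \<longlonglongrightarrow> 0"
  proof (rule Lim_null_comparison[OF always_eventually])
    show "\<forall>k. norm (sqnorm \<mu> (\<lambda>x. f x - g k x)) \<le> 1 / real (Suc k)"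
      using g(2) sqnorm_nonneg[of \<mu>] by (simp add: less_imp_le)
    show "(\<lambda>k. 1 / real (Suc k)) \<longlonglongrightarrow> 0"
      using LIMSEQ_inverse_real_of_nat by (simp add: inverse_eq_divide)
  qed
  with g(1) show ?thesis by (rule that)
qed

end

section \<open>Unitary maps on square integrable functions\<close>

text \<open>A unitary map on \<open>L\<^sup>2(\<mu>)\<close> is handled as a map on functions which respects equality almost
  everywhere.\<close>
definition L2_unitary :: "'x measure \<Rightarrow> (('x \<Rightarrow> complex) \<Rightarrow> 'h::complex_inner) \<Rightarrow> bool"
  where "L2_unitary \<mu> V \<longleftrightarrow>
    (\<forall>f\<in>sq_integrable \<mu>. \<forall>g\<in>sq_integrable \<mu>. V (\<lambda>x. f x + g x) = V f + V g) \<and>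
    (\<forall>c. \<forall>f\<in>sq_integrable \<mu>. V (\<lambda>x. c * f x) = c *\<^sub>C V f) \<and>
    (\<forall>f\<in>sq_integrable \<mu>. (norm (V f))\<^sup>2 = sqnorm \<mu> f) \<and>
    V ` sq_integrable \<mu> = UNIV"

lemma sqnorm_add:
  assumes "f \<in> sq_integrable \<mu>" "g \<in> sq_integrable \<mu>"
  shows "sqnorm \<mu> (\<lambda>x. f x + g x) = sqnorm \<mu> f + sqnorm \<mu> g + 2 * Re (\<integral>x. cnj (f x) * g x \<partial>\<mu>)"
proof -
  have *: "(cmod (a + b))\<^sup>2 = (cmod a)\<^sup>2 + (cmod b)\<^sup>2 + 2 * Re (cnj a * b)" for a b
    unfolding cmod_power2 by (simp add: power2_eq_square algebra_simps)
  show ?thesis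
    using assms integrable_cnj_mult[OF assms]
      integrable_Re[OF integrable_cnj_mult[OF assms]]
    unfolding sqnorm_def *
    by (simp add: sq_integrable_integrable integral_Re del: times_complex.sel)
qed

context
  fixes \<mu> :: "'x measure" and V :: "('x \<Rightarrow> complex) \<Rightarrow> 'h::complex_inner"
  assumes V: "L2_unitary \<mu> V"
begin

lemma L2_unitary_add:
  "f \<in> sq_integrable \<mu> \<Longrightarrow> g \<in> sq_integrable \<mu> \<Longrightarrow> V (\<lambda>x. f x + g x) = V f + V g"
  using V by (simp add: L2_unitary_def)

lemma L2_unitary_scale: "f \<in> sq_integrable \<mu> \<Longrightarrow> V (\<lambda>x. c * f x) = c *\<^sub>C V f"
  using V by (simp add: L2_unitary_def)

lemma L2_unitary_norm: "f \<in> sq_integrable \<mu> \<Longrightarrow> (norm (V f))\<^sup>2 = sqnorm \<mu> f"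
  using V by (simp add: L2_unitary_def)

lemma L2_unitary_surj: obtains f where "f \<in> sq_integrable \<mu>" "V f = v"
proof -
  have "v \<in> V ` sq_integrable \<mu>" using V by (simp add: L2_unitary_def)
  then show ?thesis using that by blast
qed

lemma L2_unitary_zero: "V (\<lambda>x. 0) = 0"
  using L2_unitary_norm[of "\<lambda>x. 0"] by (simp add: sqnorm_def)

lemma L2_unitary_sum:
  assumes "\<And>i. i \<in> A \<Longrightarrow> f i \<in> sq_integrable \<mu>"
  shows "V (\<lambda>x. \<Sum>i\<in>A. f i x) = (\<Sum>i\<in>A. V (f i))"
  using assms
  by (induction A rule: infinite_finite_induct)
    (simp_all add: L2_unitary_zero L2_unitary_add sq_integrable_sum)

lemma L2_unitary_diff:
  assumes "f \<in> sq_integrable \<mu>" "g \<in> sq_integrable \<mu>"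
  shows "V (\<lambda>x. f x - g x) = V f - V g"
  using L2_unitary_add[OF sq_integrable_diff[OF assms] assms(2)] by simp

lemma L2_unitary_eq_iff:
  assumes "f \<in> sq_integrable \<mu>" "g \<in> sq_integrable \<mu>"
  shows "V f = V g \<longleftrightarrow> (AE x in \<mu>. f x = g x)"
proof -
  have "V f = V g \<longleftrightarrow> (norm (V f - V g))\<^sup>2 = 0" by simp
  also have "\<dots> \<longleftrightarrow> sqnorm \<mu> (\<lambda>x. f x - g x) = 0"
    using L2_unitary_norm[OF sq_integrable_diff[OF assms]] L2_unitary_diff[OF assms] by simp
  also have "\<dots> \<longleftrightarrow> (AE x in \<mu>. f x = g x)"
    using sqnorm_eq_0[OF sq_integrable_diff[OF assms]] by simp
  finally show ?thesis .
qed

text \<open>Of the inner product, \<open>L2_unitary\<close> records only the norms. Expanding the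
  norm of \<open>V f + V h\<close> recovers real parts, and \<open>h = \<i> * g\<close> then yields
  the imaginary part.\<close>

lemma L2_unitary_cinner:
  assumes f: "f \<in> sq_integrable \<mu>" and g: "g \<in> sq_integrable \<mu>"
  shows "cinner (V f) (V g) = (\<integral>x. cnj (f x) * g x \<partial>\<mu>)"
proof -
  have re: "Re (cinner (V f) (V h)) = Re (\<integral>x. cnj (f x) * h x \<partial>\<mu>)" if h: "h \<in> sq_integrable \<mu>" for h
  proof -
    have "(norm (V f + V h))\<^sup>2 = (norm (V f))\<^sup>2 + (norm (V h))\<^sup>2 + 2 * Re (cinner (V f) (V h))"
      by (simp add: power2_norm_eq_inner inner_add inner_commute flip: inner_eq_Re_cinner)
    moreover have "(norm (V f + V h))\<^sup>2 = sqnorm \<mu> (\<lambda>x. f x + h x)"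
      using L2_unitary_add[OF f h] L2_unitary_norm[OF sq_integrable_add[OF f h]] by simp
    ultimately show ?thesis
      using sqnorm_add[OF f h] L2_unitary_norm[OF f] L2_unitary_norm[OF h] by simp
  qed
  have "Re (\<i> * cinner (V f) (V g)) = Re (\<i> * (\<integral>x. cnj (f x) * g x \<partial>\<mu>))"
    using re[OF sq_integrable_scale[OF g, of \<i>]]
    by (simp add: L2_unitary_scale g cinner_scaleC_right mult.left_commute del: mult_eq_0_iff complex_i_mult_minus)
  then show ?thesis using re[OF g] by (simp add: complex_eq_iff)
qed

lemma L2_unitary_tendsto:
  assumes f: "f \<in> sq_integrable \<mu>" and g: "\<And>k. g k \<in> sq_integrable \<mu>"
    and lim: "(\<lambda>k. sqnorm \<mu> (\<lambda>x. f x - g k x)) \<longlonglongrightarrow> 0"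
  shows "(\<lambda>k. V (g k)) \<longlonglongrightarrow> V f"
proof -
  have "(\<lambda>k. sqrt (sqnorm \<mu> (\<lambda>x. f x - g k x))) \<longlonglongrightarrow> sqrt 0"
    by (intro tendsto_real_sqrt lim)
  moreover have "sqrt (sqnorm \<mu> (\<lambda>x. f x - g k x)) = norm (V f - V (g k))" for k
    using L2_unitary_norm[OF sq_integrable_diff[OF f g[of k]]] L2_unitary_diff[OF f g[of k]]
    by (simp add: real_sqrt_unique)
  ultimately have "(\<lambda>k. norm (V f - V (g k))) \<longlonglongrightarrow> 0" by simp
  then have "(\<lambda>k. norm (V (g k) - V f)) \<longlonglongrightarrow> 0" by (simp add: norm_minus_commute)
  then show ?thesis using LIM_zero_iff tendsto_norm_zero_iff by blast
qed

end

text \<open>Passage from classes to functions, so that the rest of the proof deals with functions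
  only. A unitary \<open>W\<close> on classes gives \<open>V f\<close> as its value at the class of
  \<open>f\<close>. Conversely \<open>W\<close> evaluates \<open>V\<close> at a chosen
  representative, which is harmless since \<open>V\<close> agrees on functions equal almost
  everywhere.\<close>

lemma unitarily_equivalent_L2_iff:
  fixes S :: "nat \<Rightarrow> 'h::complex_inner \<Rightarrow> 'h"
  assumes "monic_system N \<mu> F"
  shows "unitarily_equivalent N type_space S (L2 \<mu>) (monic_system_op \<mu> F) \<longleftrightarrow>
    (\<exists>V. L2_unitary \<mu> V \<and>
      (\<forall>i<N. \<forall>g\<in>sq_integrable \<mu>. S i (V g) = V (\<lambda>x. F i x * g (shift x))))"
    (is "?lhs \<longleftrightarrow> ?rhs")
proof
  assume ?lhs
  then obtain W where W: "unitary_map (L2 \<mu>) type_space W"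
    and SW: "\<And>i x. i < N \<Longrightarrow> x \<in> vectors (L2 \<mu>) \<Longrightarrow> S i (W x) = W (monic_system_op \<mu> F i x)"
    by (auto simp: unitarily_equivalent_def)
  define V where "V f = W (ae_class \<mu> f)" for f
  have "L2_unitary \<mu> V"
    unfolding L2_unitary_def
  proof (intro conjI ballI allI)
    fix f g assume f: "f \<in> sq_integrable \<mu>" and g: "g \<in> sq_integrable \<mu>"
    have "W (add_op (L2 \<mu>) (ae_class \<mu> f) (ae_class \<mu> g)) = W (ae_class \<mu> f) + W (ae_class \<mu> g)"
      using W f g by (simp add: unitary_map_def type_space_def L2_vectors)
    then show "V (\<lambda>x. f x + g x) = V f + V g" by (simp add: V_def L2_add f g)
  next
    fix c f assume f: "f \<in> sq_integrable \<mu>"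
    have "W (scale_op (L2 \<mu>) c (ae_class \<mu> f)) = c *\<^sub>C W (ae_class \<mu> f)"
      using W f by (simp add: unitary_map_def type_space_def L2_vectors)
    then show "V (\<lambda>x. c * f x) = c *\<^sub>C V f" by (simp add: V_def L2_scale f)
  next
    fix f assume f: "f \<in> sq_integrable \<mu>"
    have "cinner (V f) (V f) = inner_op (L2 \<mu>) (ae_class \<mu> f) (ae_class \<mu> f)"
      using W f by (simp add: unitary_map_def type_space_def L2_vectors V_def)
    also have "\<dots> = (\<integral>x. complex_of_real ((cmod (f x))\<^sup>2) \<partial>\<mu>)"
      unfolding L2_inner[OF f f] complex_norm_square by (simp add: mult.commute)
    also have "\<dots> = complex_of_real (sqnorm \<mu> f)"
      unfolding sqnorm_def by (rule integral_complex_of_real)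
    finally show "(norm (V f))\<^sup>2 = sqnorm \<mu> f"
      unfolding cinner_self of_real_eq_iff .
  next
    have "W ` vectors (L2 \<mu>) = UNIV"
      using W by (simp add: unitary_map_def type_space_def bij_betw_def)
    then show "V ` sq_integrable \<mu> = UNIV" by (simp add: L2_vectors image_image V_def)
  qed
  moreover have "S i (V g) = V (\<lambda>x. F i x * g (shift x))" if "i < N" "g \<in> sq_integrable \<mu>" for i g
    using SW[of i "ae_class \<mu> g"] that monic_system_op_ae_class[OF assms that]
    by (simp add: V_def L2_vectors)
  ultimately show ?rhs by blast
next
  assume ?rhs
  then obtain V where V: "L2_unitary \<mu> V"
    and SV: "\<And>i g. i < N \<Longrightarrow> g \<in> sq_integrable \<mu> \<Longrightarrow> S i (V g) = V (\<lambda>x. F i x * g (shift x))" by blast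
  define W where "W A = V (SOME f. f \<in> A)" for A
  have W: "W (ae_class \<mu> f) = V f" if f: "f \<in> sq_integrable \<mu>" for f
  proof -
    define g where "g = (SOME g. g \<in> ae_class \<mu> f)"
    have "f \<in> ae_class \<mu> f" using f by (simp add: ae_rel_def)
    then have "g \<in> ae_class \<mu> f"
      unfolding g_def by (rule someI[where P = "\<lambda>g. g \<in> ae_class \<mu> f"])
    then have "g \<in> sq_integrable \<mu>" "AE x in \<mu>. f x = g x"
      by (simp_all add: ae_rel_def)
    then show ?thesis unfolding W_def g_def[symmetric] using L2_unitary_eq_iff[OF V f] by metis
  qed
  have "unitary_map (L2 \<mu>) type_space W"
    unfolding unitary_map_def
  proof (intro conjI ballI allI)
    show "bij_betw W (vectors (L2 \<mu>)) (vectors type_space)"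
    proof (rule bij_betw_imageI)
      show "inj_on W (vectors (L2 \<mu>))"
      proof (rule inj_onI)
        fix A B assume "A \<in> vectors (L2 \<mu>)" "B \<in> vectors (L2 \<mu>)" and eq: "W A = W B"
        then obtain f g where "f \<in> sq_integrable \<mu>" "A = ae_class \<mu> f" "g \<in> sq_integrable \<mu>" "B = ae_class \<mu> g"
          by (auto simp: L2_vectors)
        then show "A = B" using eq by (simp add: W L2_unitary_eq_iff[OF V] ae_class_eq_iff)
      qed
      have "W ` vectors (L2 \<mu>) = V ` sq_integrable \<mu>"
        unfolding L2_vectors image_image using W by (intro image_cong) auto
      then show "W ` vectors (L2 \<mu>) = vectors type_space"
        using V by (simp add: type_space_def L2_unitary_def)
    qed
  next
    fix A B assume "A \<in> vectors (L2 \<mu>)" "B \<in> vectors (L2 \<mu>)"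
    then obtain f g where fg: "f \<in> sq_integrable \<mu>" "A = ae_class \<mu> f" "g \<in> sq_integrable \<mu>" "B = ae_class \<mu> g"
      by (auto simp: L2_vectors)
    then show "W (add_op (L2 \<mu>) A B) = add_op type_space (W A) (W B)"
      by (simp add: L2_add W sq_integrable_add L2_unitary_add[OF V] type_space_def)
    show "inner_op type_space (W A) (W B) = inner_op (L2 \<mu>) A B"
      using fg by (simp add: L2_inner W L2_unitary_cinner[OF V] type_space_def)
  next
    fix c A assume "A \<in> vectors (L2 \<mu>)"
    then show "W (scale_op (L2 \<mu>) c A) = scale_op type_space c (W A)"
      by (auto simp: L2_vectors L2_scale W sq_integrable_scale L2_unitary_scale[OF V] type_space_def)
  qed
  moreover have "S i (W A) = W (monic_system_op \<mu> F i A)" if i: "i < N" and A: "A \<in> vectors (L2 \<mu>)" for i A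
  proof -
    obtain g where g: "g \<in> sq_integrable \<mu>" "A = ae_class \<mu> g"
      using A by (auto simp: L2_vectors)
    then show ?thesis
      using SV[OF i g(1)] monic_system_op_sq_integrable[OF assms i g(1)]
      by (simp add: monic_system_op_ae_class[OF assms i] W)
  qed
  ultimately show ?lhs by (auto simp: unitarily_equivalent_def)
qed

section \<open>Word projections of a Cuntz representation\<close>

lemma word_op_Nil [simp]: "word_op S [] = id"
  by (simp add: word_op_def)

lemma word_op_Cons [simp]: "word_op S (i # I) = S i \<circ> word_op S I"
  by (simp add: word_op_def)

lemma word_op_append: "word_op S (I @ J) = word_op S I \<circ> word_op S J"
  by (induction I) (simp_all add: comp_assoc)

definition word_proj :: "(nat \<Rightarrow> 'a::complex_inner \<Rightarrow> 'a) \<Rightarrow> nat list \<Rightarrow> 'a \<Rightarrow> 'a"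
  where "word_proj S I x = word_op S I (cadjoint (word_op S I) x)"

lemma word_proj_Nil [simp]: "word_proj S [] x = x"
  by (simp add: word_proj_def cadjoint_id)

locale cuntz =
  fixes N :: nat and S :: "nat \<Rightarrow> 'h::chilbert_space \<Rightarrow> 'h"
  assumes cuntz_rep: "cuntz_rep N S"
begin

lemma isometry: "i < N \<Longrightarrow> linear_isometry (S i)"
  using cuntz_rep by (simp add: cuntz_rep_def)

lemma cadjoint_S: "i < N \<Longrightarrow> j < N \<Longrightarrow> cadjoint (S i) (S j x) = (if i = j then x else 0)"
  using cuntz_rep by (simp add: cuntz_rep_def)

lemma sum_S: "(\<Sum>i<N. S i (cadjoint (S i) x)) = x"
  using cuntz_rep by (simp add: cuntz_rep_def)

lemma word_isometry: "set I \<subseteq> {..<N} \<Longrightarrow> linear_isometry (word_op S I)"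
  by (induction I)
    (simp_all add: linear_isometry_id linear_isometry_comp isometry flip: id_def)

text \<open>The first letters cancel or annihilate by \<open>cadjoint_S\<close>, and the remaining
  words again have equal length.\<close>

lemma cadjoint_word_op:
  assumes "length I = length J" "set I \<subseteq> {..<N}" "set J \<subseteq> {..<N}"
  shows "cadjoint (word_op S I) (word_op S J x) = (if I = J then x else 0)"
  using assms
proof (induction I J rule: list_induct2)
  case (Cons i I j J)
  then have i: "i < N" "j < N" "set I \<subseteq> {..<N}" "set J \<subseteq> {..<N}" by auto
  have "cadjoint (word_op S (i # I)) y = cadjoint (word_op S I) (cadjoint (S i) y)" for y
    unfolding word_op_Cons cadjoint_comp[OF isometry[OF i(1)] word_isometry[OF i(3)]] by simp
  moreover have "cadjoint (word_op S I) 0 = 0"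
    using cadjoint_scaleC[OF word_isometry[OF i(3)], of 0 0] by simp
  moreover have "word_op S (j # J) x = S j (word_op S J x)" by simp
  moreover have "cadjoint (word_op S I) (word_op S J x) = (if I = J then x else 0)"
    using Cons.IH i by blast
  ultimately have "cadjoint (word_op S (i # I)) (word_op S (j # J) x) =
      (if i = j then if I = J then x else 0 else 0)"
    unfolding \<open>word_op S (j # J) x = S j (word_op S J x)\<close> using cadjoint_S[OF i(1,2)] by metis
  then show ?case by (simp del: word_op_Cons)
qed (simp add: cadjoint_id)

lemma word_proj_Cons:
  assumes "i < N" "set I \<subseteq> {..<N}"
  shows "word_proj S (i # I) x = S i (word_proj S I (cadjoint (S i) x))"
  using assms by (simp add: word_proj_def cadjoint_comp[OF isometry word_isometry])

text \<open>The resolution of the identity \<open>sum_S\<close> is inserted between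
  \<open>word_op S I\<close> and its adjoint.\<close>

lemma word_proj_refine:
  assumes "set I \<subseteq> {..<N}"
  shows "word_proj S I x = (\<Sum>i<N. word_proj S (I @ [i]) x)"
proof -
  have "word_proj S I x = word_op S I (\<Sum>i<N. S i (cadjoint (S i) (cadjoint (word_op S I) x)))"
    by (simp add: word_proj_def sum_S)
  also have "\<dots> = (\<Sum>i<N. word_proj S (I @ [i]) x)"
    unfolding linear_isometry_sum[OF word_isometry[OF assms]]
    by (intro sum.cong refl)
      (simp add: word_proj_def word_op_append cadjoint_comp[OF word_isometry[OF assms] isometry])
  finally show ?thesis .
qed

lemma word_proj_word_op:
  assumes "length I = length J" "set I \<subseteq> {..<N}" "set J \<subseteq> {..<N}"
  shows "word_proj S I (word_op S J x) = (if I = J then word_op S J x else 0)"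
  using cadjoint_word_op[OF assms] linear_isometry_zero[OF word_isometry[OF assms(2)]]
  by (simp add: word_proj_def)

text \<open>Split \<open>J\<close> after \<open>length I\<close> letters: the range of
  \<open>word_op S J\<close> lies in the range of the operator of that prefix, to which the
  orthogonality of words of equal length applies.\<close>

lemma word_proj_word_proj:
  assumes "length I \<le> length J" "set I \<subseteq> {..<N}" "set J \<subseteq> {..<N}"
  shows "word_proj S I (word_proj S J x) = (if take (length I) J = I then word_proj S J x else 0)"
proof -
  let ?K = "take (length I) J" and ?L = "drop (length I) J"
  have "word_op S J = word_op S ?K \<circ> word_op S ?L"
    by (simp flip: word_op_append)
  moreover have "set ?K \<subseteq> {..<N}" using assms(3) set_take_subset by fast
  ultimately show ?thesis
    using word_proj_word_op[of I ?K] assms unfolding word_proj_def[of S J] by auto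
qed

lemma word_proj_add: "set I \<subseteq> {..<N} \<Longrightarrow> word_proj S I (x + y) = word_proj S I x + word_proj S I y"
  by (simp add: word_proj_def cadjoint_add linear_isometry_add word_isometry)

lemma word_proj_scaleC: "set I \<subseteq> {..<N} \<Longrightarrow> word_proj S I (c *\<^sub>C x) = c *\<^sub>C word_proj S I x"
  by (simp add: word_proj_def cadjoint_scaleC linear_isometry_scaleC word_isometry)

lemma word_proj_sum: "set I \<subseteq> {..<N} \<Longrightarrow> word_proj S I (\<Sum>j\<in>A. f j) = (\<Sum>j\<in>A. word_proj S I (f j))"
  by (simp add: word_proj_def cadjoint_sum linear_isometry_sum word_isometry)

lemma cinner_word_proj:
  assumes "set I \<subseteq> {..<N}"
  shows "cinner (word_proj S I x) y = cinner x (word_proj S I y)"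
  using word_isometry[OF assms]
  by (simp add: word_proj_def cinner_cadjoint_left flip: cinner_cadjoint_right)

lemma word_proj_idem: "set I \<subseteq> {..<N} \<Longrightarrow> word_proj S I (word_proj S I x) = word_proj S I x"
  using word_proj_word_proj[of I I x] by simp

lemma cinner_word_proj_orthogonal:
  assumes "I \<in> words N n" "J \<in> words N n"
  shows "cinner (word_proj S I x) (word_proj S J x) =
    (if I = J then complex_of_real ((norm (word_proj S I x))\<^sup>2) else 0)"
proof -
  have I: "set I \<subseteq> {..<N}" "set J \<subseteq> {..<N}" "length I = length J"
    using assms by (auto simp: words_def)
  have "I \<noteq> J \<Longrightarrow> cinner (word_proj S I x) (word_proj S J x) = 0"
    using I word_proj_word_proj[of I J x] by (simp add: cinner_word_proj)
  then show ?thesis by (auto simp: cinner_self)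
qed

text \<open>For an orthogonal projection the squared norm of the image of \<open>x\<close> is linear
  in the projection; this is what makes these squared norms additive and hence a measure.\<close>

lemma word_proj_norm:
  assumes "set I \<subseteq> {..<N}"
  shows "(norm (word_proj S I x))\<^sup>2 = Re (cinner x (word_proj S I x))"
proof -
  have "cinner x (word_proj S I x) = cinner (word_proj S I x) (word_proj S I x)"
    using assms by (simp add: cinner_word_proj word_proj_idem)
  then show ?thesis by (simp add: cinner_self)
qed

lemma word_proj_norm_refine:
  assumes "set I \<subseteq> {..<N}"
  shows "(norm (word_proj S I x))\<^sup>2 = (\<Sum>i<N. (norm (word_proj S (I @ [i]) x))\<^sup>2)"
proof -
  have "(norm (word_proj S I x))\<^sup>2 = Re (cinner x (\<Sum>i<N. word_proj S (I @ [i]) x))"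
    unfolding word_proj_norm[OF assms] word_proj_refine[OF assms, symmetric] ..
  also have "\<dots> = (\<Sum>i<N. (norm (word_proj S (I @ [i]) x))\<^sup>2)"
    unfolding cinner_sum_right Re_sum
    using assms by (intro sum.cong refl) (simp add: word_proj_norm)
  finally show ?thesis .
qed

lemma word_proj_norm_le:
  assumes "set I \<subseteq> {..<N}"
  shows "norm (word_proj S I x) \<le> norm x"
proof -
  have "(norm (word_proj S I x))\<^sup>2 \<le> norm x * norm (word_proj S I x)"
    using Cauchy_Schwarz_ineq2[of x "word_proj S I x"]
    by (simp add: word_proj_norm[OF assms] inner_eq_Re_cinner)
  then show ?thesis
    by (cases "word_proj S I x = 0") (simp_all add: power2_eq_square)
qed

lemma word_proj_tendsto:
  assumes "set I \<subseteq> {..<N}" "(f \<longlongrightarrow> l) F"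
  shows "((\<lambda>x. word_proj S I (f x)) \<longlongrightarrow> word_proj S I l) F"
proof -
  have "bounded_linear (word_proj S I)"
    using word_proj_norm_le[OF assms(1)]
    by (intro bounded_linear_intro[of _ 1])
      (simp_all add: word_proj_add[OF assms(1)] word_proj_scaleC[OF assms(1)] scaleR_scaleC)
  then show ?thesis using assms(2) by (rule bounded_linear.tendsto)
qed

end

section \<open>Monic systems give monic representations\<close>

lemma prepend_shift: "prepend (w 0) (shift w) = w"
  by (auto simp: prepend_def shift_def fun_eq_iff split: nat.split)

lemma mem_cylinder_Cons:
  "w \<in> cylinder N (i # I) \<longleftrightarrow> w \<in> infinite_words N \<and> w 0 = i \<and> shift w \<in> cylinder N I"
proof -
  have "prefix (Suc n) w = w 0 # prefix n (shift w)" for n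
    by (simp add: map_upt_Suc shift_def del: upt_Suc)
  moreover have "w \<in> infinite_words N \<Longrightarrow> shift w \<in> infinite_words N"
    by (simp add: infinite_words_eq shift_def)
  ultimately show ?thesis by (auto simp: cylinder_def simp del: upt_Suc)
qed

lemma mem_cylinder_singleton: "w \<in> cylinder N [i] \<longleftrightarrow> w \<in> infinite_words N \<and> w 0 = i"
  by (auto simp: mem_cylinder_Cons cylinder_Nil infinite_words_eq shift_def)

lemma prepend_infinite_words: "i < N \<Longrightarrow> w \<in> infinite_words N \<Longrightarrow> prepend i w \<in> infinite_words N"
  by (auto simp: infinite_words_eq prepend_def split: nat.split)

lemma prepend_image: "i < N \<Longrightarrow> prepend i ` infinite_words N = cylinder N [i]"
proof (intro equalityI subsetI)
  fix w assume w: "w \<in> cylinder N [i]"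
  then have "w = prepend i (shift w)" "shift w \<in> infinite_words N"
    using prepend_shift[of w] by (auto simp: mem_cylinder_singleton infinite_words_eq shift_def)
  then show "w \<in> prepend i ` infinite_words N" by blast
qed (auto simp: mem_cylinder_singleton prepend_infinite_words, simp add: prepend_def)

lemma mem_cylinder_prepend:
  assumes "j < N" "w \<in> infinite_words N"
  shows "prepend j w \<in> cylinder N (i # I) \<longleftrightarrow> i = j \<and> w \<in> cylinder N I"
  using assms by (auto simp: mem_cylinder_Cons prepend_infinite_words) (auto simp: prepend_def)

lemma (in word_measure) shift_measurable [measurable]: "shift \<in> \<mu> \<rightarrow>\<^sub>M \<mu>"
  using measurable_shift by (simp add: measurable_cong_sets[OF sets_eq sets_eq])

lemma (in word_measure) prepend_measurable: "i < N \<Longrightarrow> prepend i \<in> \<mu> \<rightarrow>\<^sub>M \<mu>"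
  using measurable_prepend by (simp add: measurable_cong_sets[OF sets_eq sets_eq])

text \<open>The push-forward under \<open>prepend i\<close> gives no mass to the complement of the
  cylinder of \<open>i\<close>, so its density, the squared modulus of \<open>F i\<close>, is zero
  there.\<close>

lemma monic_system_vanishes:
  assumes "monic_system N \<mu> F" "i < N"
  shows "AE x in \<mu>. x \<notin> cylinder N [i] \<longrightarrow> F i x = 0"
proof -
  interpret word_measure \<mu> N
    using assms by (auto simp: monic_system_def word_measure_def word_measure_axioms_def)
  have [measurable]: "prepend i \<in> \<mu> \<rightarrow>\<^sub>M \<mu>" by (rule prepend_measurable[OF assms(2)])
  let ?\<nu> = "distr \<mu> \<mu> (prepend i)"
  let ?A = "space \<mu> - cylinder N [i]"
  have ac: "absolutely_continuous \<mu> ?\<nu>"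
    and rn: "AE x in \<mu>. RN_deriv \<mu> ?\<nu> x = ennreal ((cmod (F i x))\<^sup>2)"
    using assms by (auto simp: monic_system_def)
  have "(\<integral>\<^sup>+x. RN_deriv \<mu> ?\<nu> x * indicator ?A x \<partial>\<mu>) = (\<integral>\<^sup>+x. indicator ?A x \<partial>?\<nu>)"
    by (rule RN_deriv_nn_integral[symmetric, OF ac]) auto
  also have "\<dots> = emeasure \<mu> (prepend i -` ?A \<inter> space \<mu>)"
    by (simp add: emeasure_distr)
  also have "prepend i -` ?A \<inter> space \<mu> = {}"
    using prepend_image[OF assms(2)] by (auto simp: space_eq)
  finally have "AE x in \<mu>. RN_deriv \<mu> ?\<nu> x * indicator ?A x = 0"
    using nn_integral_0_iff_AE[of "\<lambda>x. RN_deriv \<mu> ?\<nu> x * indicator ?A x" \<mu>] by simp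
  with rn AE_space show ?thesis
  proof eventually_elim
    case (elim x)
    then show ?case by (auto simp: indicator_def ennreal_eq_0_iff split: if_splits)
  qed
qed

lemma monic_rep_of_monic_system:
  fixes S :: "nat \<Rightarrow> 'h::chilbert_space \<Rightarrow> 'h"
  assumes N: "0 < N" and "cuntz_rep N S" and monic: "monic_system N \<mu> F"
    and V: "L2_unitary \<mu> V"
    and SV: "\<And>i g. i < N \<Longrightarrow> g \<in> sq_integrable \<mu> \<Longrightarrow> S i (V g) = V (\<lambda>x. F i x * g (shift x))"
  shows "monic_rep N S"
proof -
  interpret cuntz N S by unfold_locales fact
  interpret word_measure \<mu> N
    using assms by (auto simp: monic_system_def word_measure_def word_measure_axioms_def)
  \<comment> \<open>An explicit adjoint would involve division by \<open>F i\<close>. It is enough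
    to let \<open>h\<close> represent the adjoint value and to know that \<open>S i\<close> sends it
    back to the part of \<open>g\<close> on the cylinder of \<open>i\<close>.\<close>
  have adj: "\<exists>h\<in>sq_integrable \<mu>. cadjoint (S i) (V g) = V h \<and>
      (AE x in \<mu>. indicator (cylinder N [i]) x * g x = F i x * h (shift x))"
    if i: "i < N" and g: "g \<in> sq_integrable \<mu>" for i g
  proof -
    have "\<exists>h. h \<in> sq_integrable \<mu> \<and> V h = cadjoint (S j) (V g)" for j
      using L2_unitary_surj[OF V] by metis
    then obtain h where h: "\<And>j. h j \<in> sq_integrable \<mu>" "\<And>j. V (h j) = cadjoint (S j) (V g)" by metis
    let ?k = "\<lambda>j x. F j x * h j (shift x)"
    have k: "?k j \<in> sq_integrable \<mu>" if "j < N" for j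
      using monic_system_op_sq_integrable[OF monic that h(1)] .
    have "V (\<lambda>x. \<Sum>j<N. ?k j x) = (\<Sum>j<N. V (?k j))"
      by (rule L2_unitary_sum[OF V]) (simp add: k)
    also have "\<dots> = (\<Sum>j<N. S j (cadjoint (S j) (V g)))"
      by (intro sum.cong refl) (simp add: h(1) flip: SV h(2))
    also have "\<dots> = V g" by (rule sum_S)
    finally have "AE x in \<mu>. (\<Sum>j<N. ?k j x) = g x"
      by (rule iffD1[OF L2_unitary_eq_iff[OF V sq_integrable_sum g], rotated]) (simp add: k)
    moreover have "AE x in \<mu>. \<forall>j\<in>{..<N}. x \<notin> cylinder N [j] \<longrightarrow> F j x = 0"
      by (rule AE_finite_allI) (auto intro: monic_system_vanishes[OF monic])
    ultimately have "AE x in \<mu>. indicator (cylinder N [i]) x * g x = ?k i x"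
      using AE_space
    proof eventually_elim
      case (elim x)
      \<comment> \<open>The summand for \<open>j\<close> vanishes off the cylinder of
        \<open>j\<close>, so at \<open>x\<close> only the one for the first letter of
        \<open>x\<close> survives.\<close>
      have "(\<Sum>j<N. ?k j x) = (\<Sum>j<N. if x 0 = j then ?k j x else 0)"
        using elim by (intro sum.cong refl) (auto simp: mem_cylinder_singleton)
      also have "\<dots> = ?k (x 0) x"
        using elim(3) by (simp add: space_eq infinite_words_eq)
      finally show ?case
        using elim i by (cases "x 0 = i") (auto simp: mem_cylinder_singleton space_eq indicator_def)
    qed
    then show ?thesis using h by metis
  qed
  have proj: "word_proj S I (V g) = V (\<lambda>x. indicator (cylinder N I) x * g x)"
    if "set I \<subseteq> {..<N}" "g \<in> sq_integrable \<mu>" for I g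
    using that
  \<comment> \<open>The function must vary: peeling off the first letter replaces \<open>g\<close>
    by the function \<open>h\<close> that represents the adjoint value.\<close>
  proof (induction I arbitrary: g)
    case Nil
    have "AE x in \<mu>. g x = indicator (cylinder N []) x * g x"
      using AE_space by eventually_elim (simp add: cylinder_Nil space_eq)
    then show ?case
      using L2_unitary_eq_iff[OF V Nil.prems(2) mult_indicator_sq_integrable[OF cylinder_sets Nil.prems(2)]]
      by simp
  next
    case (Cons i I)
    then have i: "i < N" "set I \<subseteq> {..<N}" by auto
    obtain h where h: "h \<in> sq_integrable \<mu>" "cadjoint (S i) (V g) = V h"
      "AE x in \<mu>. indicator (cylinder N [i]) x * g x = F i x * h (shift x)"
      using adj[OF i(1) Cons.prems(2)] by blast
    let ?h = "\<lambda>x. indicator (cylinder N I) x * h x"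
    have h': "?h \<in> sq_integrable \<mu>" using h(1) by (intro mult_indicator_sq_integrable) auto
    have "AE x in \<mu>. F i x * ?h (shift x) = indicator (cylinder N (i # I)) x * g x"
      using h(3) AE_space
    proof eventually_elim
      case (elim x)
      have "F i x * ?h (shift x) = indicator (cylinder N I) (shift x) * (F i x * h (shift x))" by simp
      also have "\<dots> = indicator (cylinder N I) (shift x) * (indicator (cylinder N [i]) x * g x)"
        using elim(1) by simp
      also have "\<dots> = indicator (cylinder N (i # I)) x * g x"
        using mem_cylinder_Cons[of x N i I] by (auto simp: indicator_def mem_cylinder_singleton)
      finally show ?case .
    qed
    then have "V (\<lambda>x. F i x * ?h (shift x)) = V (\<lambda>x. indicator (cylinder N (i # I)) x * g x)"
      using L2_unitary_eq_iff[OF V monic_system_op_sq_integrable[OF monic i(1) h']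
          mult_indicator_sq_integrable[OF cylinder_sets Cons.prems(2)]] by blast
    then show ?case
      using i h SV[OF i(1) h'] Cons.IH[OF i(2) h(1)] by (simp add: word_proj_Cons)
  qed
  let ?\<phi> = "V (\<lambda>x. 1)"
  let ?P = "{word_op S I (cadjoint (word_op S I) ?\<phi>) | I. set I \<subseteq> {..<N}}"
  have one: "(\<lambda>x. 1) \<in> sq_integrable \<mu>" by (rule cylinder_fun_sq_integrable[OF cylinder_fun_const])
  have in_span: "V g \<in> cspan ?P" if g: "cylinder_fun N n g" for n g
  proof -
    have sq: "(\<lambda>x. indicator (cylinder N I) x * 1) \<in> sq_integrable \<mu>" for I
      by (intro mult_indicator_sq_integrable one) auto
    have "AE x in \<mu>. g x = (\<Sum>I\<in>words N n. g (pad I) * (indicator (cylinder N I) x * 1))"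
      using AE_space by eventually_elim (use cylinder_fun_expand[OF g] in \<open>simp add: space_eq\<close>)
    then have "V g = V (\<lambda>x. \<Sum>I\<in>words N n. g (pad I) * (indicator (cylinder N I) x * 1))"
      by (rule iffD2[OF L2_unitary_eq_iff[OF V cylinder_fun_sq_integrable[OF g]], rotated])
        (intro sq_integrable_sum sq_integrable_scale sq)
    also have "\<dots> = (\<Sum>I\<in>words N n. V (\<lambda>x. g (pad I) * (indicator (cylinder N I) x * 1)))"
      by (rule L2_unitary_sum[OF V]) (intro sq_integrable_scale sq)
    also have "\<dots> = (\<Sum>I\<in>words N n. g (pad I) *\<^sub>C word_proj S I ?\<phi>)"
    proof (intro sum.cong refl)
      fix I assume "I \<in> words N n"
      then have "set I \<subseteq> {..<N}" by (simp add: words_def)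
      then show "V (\<lambda>x. g (pad I) * (indicator (cylinder N I) x * 1)) = g (pad I) *\<^sub>C word_proj S I ?\<phi>"
        using L2_unitary_scale[OF V sq] proj[OF _ one] by simp
    qed
    also have "\<dots> \<in> cspan ?P"
      by (intro complex_vector.span_sum complex_vector.span_scale complex_vector.span_base)
        (auto simp: word_proj_def words_def)
    finally show ?thesis .
  qed
  have "v \<in> closure (cspan ?P)" for v
  proof -
    obtain f where f: "f \<in> sq_integrable \<mu>" "V f = v" by (rule L2_unitary_surj[OF V])
    obtain n g where g: "\<And>k. cylinder_fun N (n k) (g k)" "(\<lambda>k. sqnorm \<mu> (\<lambda>x. f x - g k x)) \<longlonglongrightarrow> 0"
      by (rule cylinder_fun_seq[OF f(1)]) (rule that)
    have "(\<lambda>k. V (g k)) \<longlonglongrightarrow> V f"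
      by (rule L2_unitary_tendsto[OF V f(1) cylinder_fun_sq_integrable[OF g(1)] g(2)])
    then show ?thesis
      unfolding closure_sequential f(2)[symmetric]
      using in_span[OF g(1)] by (intro exI[of _ "\<lambda>k. V (g k)"]) simp
  qed
  then show ?thesis unfolding monic_rep_def by blast
qed

section \<open>Monic representations give monic systems\<close>

locale cyclic_cuntz = cuntz N S + word_measure \<mu> N
  for N :: nat and S :: "nat \<Rightarrow> 'h::chilbert_space \<Rightarrow> 'h" and \<mu> +
  fixes \<phi> :: 'h
  assumes measure_cylinder: "set I \<subseteq> {..<N} \<Longrightarrow> measure \<mu> (cylinder N I) = (norm (word_proj S I \<phi>))\<^sup>2"
    and cyclic: "closure (cspan {word_proj S I \<phi> | I. set I \<subseteq> {..<N}}) = UNIV"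
begin

text \<open>The isometry on cylinder functions, extended linearly from indicators of cylinders. The
  level \<open>n\<close> is an argument because a cylinder function has many levels; by
  \<open>synth_mono\<close> every admissible one gives the same vector.\<close>

definition synth :: "nat \<Rightarrow> ((nat \<Rightarrow> nat) \<Rightarrow> complex) \<Rightarrow> 'h"
  where "synth n g = (\<Sum>I\<in>words N n. g (pad I) *\<^sub>C word_proj S I \<phi>)"

lemma synth_mono:
  assumes "cylinder_fun N n g" "n \<le> k"
  shows "synth k g = synth n g"
  unfolding synth_def
proof (rule sum_words_refine[OF N_pos assms, where F = "\<lambda>I. word_proj S I \<phi>" and s = "(*\<^sub>C)"])
  show "word_proj S I \<phi> = (\<Sum>i<N. word_proj S (I @ [i]) \<phi>)" if "set I \<subseteq> {..<N}" for I
    using word_proj_refine[OF that] .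
  show "c *\<^sub>C (\<Sum>i<N. f i) = (\<Sum>i<N. c *\<^sub>C f i)" for c and f :: "nat \<Rightarrow> 'h"
    by (rule complex_vector.scale_sum_right)
qed

lemma synth_add: "synth n (\<lambda>x. g x + h x) = synth n g + synth n h"
  by (simp add: synth_def scaleC_add_left sum.distrib)

lemma synth_scale: "synth n (\<lambda>x. c * g x) = c *\<^sub>C synth n g"
  by (simp add: synth_def scaleC_scaleC complex_vector.scale_sum_right)

text \<open>The vectors \<open>word_proj S I \<phi>\<close> of one level are pairwise orthogonal.
  Pythagoras yields a sum weighted by their squared norms, which are the masses of the
  cylinders.\<close>

lemma synth_norm:
  assumes g: "cylinder_fun N n g"
  shows "(norm (synth n g))\<^sup>2 = sqnorm \<mu> g"
proof -
  have "cinner (synth n g) (synth n g) =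
      (\<Sum>J\<in>words N n. \<Sum>I\<in>words N n. g (pad J) * (cnj (g (pad I)) *
        (if I = J then complex_of_real ((norm (word_proj S I \<phi>))\<^sup>2) else 0)))"
    unfolding synth_def cinner_sum_left cinner_sum_right cinner_scaleC_left cinner_scaleC_right
      sum_distrib_left
    by (intro sum.cong refl) (simp add: cinner_word_proj_orthogonal)
  also have "\<dots> = (\<Sum>J\<in>words N n. complex_of_real ((cmod (g (pad J)))\<^sup>2 * (norm (word_proj S J \<phi>))\<^sup>2))"
  proof (intro sum.cong refl)
    fix J assume J: "J \<in> words N n"
    have "(\<Sum>I\<in>words N n. g (pad J) * (cnj (g (pad I)) *
        (if I = J then complex_of_real ((norm (word_proj S I \<phi>))\<^sup>2) else 0))) =
        (\<Sum>I\<in>words N n. if I = J then g (pad J) * cnj (g (pad J)) * complex_of_real ((norm (word_proj S J \<phi>))\<^sup>2) else 0)"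
      by (intro sum.cong refl) simp
    also have "\<dots> = g (pad J) * cnj (g (pad J)) * complex_of_real ((norm (word_proj S J \<phi>))\<^sup>2)"
      using J by simp
    also have "\<dots> = complex_of_real ((cmod (g (pad J)))\<^sup>2 * (norm (word_proj S J \<phi>))\<^sup>2)"
      by (simp only: complex_norm_square[symmetric] of_real_mult)
    finally show "(\<Sum>I\<in>words N n. g (pad J) * (cnj (g (pad I)) *
        (if I = J then complex_of_real ((norm (word_proj S I \<phi>))\<^sup>2) else 0))) =
        complex_of_real ((cmod (g (pad J)))\<^sup>2 * (norm (word_proj S J \<phi>))\<^sup>2)" .
  qed
  finally have "(norm (synth n g))\<^sup>2 = (\<Sum>J\<in>words N n. (cmod (g (pad J)))\<^sup>2 * (norm (word_proj S J \<phi>))\<^sup>2)"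
    unfolding cinner_self of_real_sum[symmetric] of_real_eq_iff .
  also have "\<dots> = (\<Sum>J\<in>words N n. (cmod (g (pad J)))\<^sup>2 * measure \<mu> (cylinder N J))"
    by (intro sum.cong refl) (simp add: measure_cylinder words_def)
  also have "\<dots> = (\<integral>x. (\<Sum>J\<in>words N n. (cmod (g (pad J)))\<^sup>2 * indicator (cylinder N J) x) \<partial>\<mu>)"
    by (subst Bochner_Integration.integral_sum)
      (auto simp: cylinder_sets emeasure_finite top.not_eq_extremum[symmetric] intro!: integrable_mult_right)
  also have "\<dots> = sqnorm \<mu> g"
    unfolding sqnorm_def
    using cylinder_fun_expand[OF cylinder_fun_comp[OF g, of "\<lambda>z. (cmod z)\<^sup>2"]]
    by (intro Bochner_Integration.integral_cong) (simp_all add: space_eq)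
  finally show ?thesis .
qed

text \<open>Both functions are lifted to a common level. The formula transports Cauchy sequences in
  both directions, between functions and vectors.\<close>

lemma synth_diff_norm:
  assumes g: "cylinder_fun N n g" and h: "cylinder_fun N m h"
  shows "(norm (synth n g - synth m h))\<^sup>2 = sqnorm \<mu> (\<lambda>x. g x - h x)"
proof -
  let ?k = "max n m"
  have gh: "cylinder_fun N ?k g" "cylinder_fun N ?k h"
    using cylinder_fun_mono[OF g _ N_pos] cylinder_fun_mono[OF h _ N_pos] by auto
  have "synth n g - synth m h = synth ?k g - synth ?k h"
    using synth_mono[OF g, of ?k] synth_mono[OF h, of ?k] by simp
  also have "\<dots> = synth ?k (\<lambda>x. g x + (-1) * h x)"
    unfolding synth_add synth_scale by simp
  finally show ?thesis
    using synth_norm[of ?k "\<lambda>x. g x + (-1) * h x"]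
      cylinder_fun_comp2[OF gh, of "\<lambda>a b. a + (-1) * b"] by simp
qed

text \<open>The closure of the graph of \<open>synth\<close>. A relation treats both sides alike:
  totality comes from completeness of the Hilbert space, surjectivity from completeness of
  L2(\<mu>).\<close>

definition synth_rel :: "((nat \<Rightarrow> nat) \<Rightarrow> complex) \<Rightarrow> 'h \<Rightarrow> bool"
  where "synth_rel f v \<longleftrightarrow> f \<in> sq_integrable \<mu> \<and>
    (\<exists>n g. (\<forall>k. cylinder_fun N (n k) (g k)) \<and> (\<lambda>k. sqnorm \<mu> (\<lambda>x. f x - g k x)) \<longlonglongrightarrow> 0 \<and>
      (\<lambda>k. synth (n k) (g k)) \<longlonglongrightarrow> v)"

lemma synth_relI:
  assumes "f \<in> sq_integrable \<mu>" "\<And>k. cylinder_fun N (n k) (g k)"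
    and "(\<lambda>k. sqnorm \<mu> (\<lambda>x. f x - g k x)) \<longlonglongrightarrow> 0" "(\<lambda>k. synth (n k) (g k)) \<longlonglongrightarrow> v"
  shows "synth_rel f v"
  unfolding synth_rel_def using assms by (intro conjI exI[of _ n] exI[of _ g]) simp_all

lemma synth_rel_cylinder_fun:
  assumes "cylinder_fun N n g" shows "synth_rel g (synth n g)"
  unfolding synth_rel_def
proof (intro conjI exI[of _ "\<lambda>_. n"] exI[of _ "\<lambda>_. g"] allI)
  show "g \<in> sq_integrable \<mu>" using assms by (rule cylinder_fun_sq_integrable)
qed (simp_all add: assms sqnorm_def)

lemma synth_rel_norm:
  assumes "synth_rel f v" shows "(norm v)\<^sup>2 = sqnorm \<mu> f"
proof -
  obtain n g where f: "f \<in> sq_integrable \<mu>" and g: "\<And>k. cylinder_fun N (n k) (g k)"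
    and lim: "(\<lambda>k. sqnorm \<mu> (\<lambda>x. f x - g k x)) \<longlonglongrightarrow> 0" "(\<lambda>k. synth (n k) (g k)) \<longlonglongrightarrow> v"
    using assms unfolding synth_rel_def by blast
  have "(\<lambda>k. sqnorm \<mu> (g k)) \<longlonglongrightarrow> sqnorm \<mu> f"
    by (rule tendsto_sqnorm[OF f cylinder_fun_sq_integrable[OF g] lim(1)])
  moreover have "(\<lambda>k. sqnorm \<mu> (g k)) \<longlonglongrightarrow> (norm v)\<^sup>2"
    unfolding synth_norm[OF g, symmetric] by (intro tendsto_intros lim)
  ultimately show ?thesis by (rule LIMSEQ_unique[rotated])
qed

lemma synth_rel_add:
  assumes "synth_rel f v" "synth_rel f' v'"
  shows "synth_rel (\<lambda>x. f x + f' x) (v + v')"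
proof -
  obtain n g where f: "f \<in> sq_integrable \<mu>" and g: "\<And>k. cylinder_fun N (n k) (g k)"
    and lim: "(\<lambda>k. sqnorm \<mu> (\<lambda>x. f x - g k x)) \<longlonglongrightarrow> 0" "(\<lambda>k. synth (n k) (g k)) \<longlonglongrightarrow> v"
    using assms(1) unfolding synth_rel_def by blast
  obtain n' g' where f': "f' \<in> sq_integrable \<mu>" and g': "\<And>k. cylinder_fun N (n' k) (g' k)"
    and lim': "(\<lambda>k. sqnorm \<mu> (\<lambda>x. f' x - g' k x)) \<longlonglongrightarrow> 0" "(\<lambda>k. synth (n' k) (g' k)) \<longlonglongrightarrow> v'"
    using assms(2) unfolding synth_rel_def by blast
  let ?m = "\<lambda>k. max (n k) (n' k)" and ?h = "\<lambda>k x. g k x + g' k x"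
  have h: "cylinder_fun N (?m k) (?h k)" for k
    using cylinder_fun_mono[OF g max.cobounded1 N_pos] cylinder_fun_mono[OF g' max.cobounded2 N_pos]
    by (rule cylinder_fun_comp2)
  have "(\<lambda>k. sqnorm \<mu> (\<lambda>x. (f x + f' x) - ?h k x)) \<longlonglongrightarrow> 0"
  proof (rule Lim_null_comparison[OF always_eventually])
    show "\<forall>k. norm (sqnorm \<mu> (\<lambda>x. (f x + f' x) - ?h k x)) \<le>
        2 * sqnorm \<mu> (\<lambda>x. f x - g k x) + 2 * sqnorm \<mu> (\<lambda>x. f' x - g' k x)"
    proof
      fix k
      show "norm (sqnorm \<mu> (\<lambda>x. (f x + f' x) - ?h k x)) \<le>
        2 * sqnorm \<mu> (\<lambda>x. f x - g k x) + 2 * sqnorm \<mu> (\<lambda>x. f' x - g' k x)"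
        using sqnorm_add_le[OF sq_integrable_diff[OF f cylinder_fun_sq_integrable[OF g[of k]]]
            sq_integrable_diff[OF f' cylinder_fun_sq_integrable[OF g'[of k]]]]
        by (simp add: sqnorm_nonneg algebra_simps)
    qed
    show "(\<lambda>k. 2 * sqnorm \<mu> (\<lambda>x. f x - g k x) + 2 * sqnorm \<mu> (\<lambda>x. f' x - g' k x)) \<longlonglongrightarrow> 0"
      using tendsto_add[OF tendsto_mult_left[OF lim(1), of 2] tendsto_mult_left[OF lim'(1), of 2]] by simp
  qed
  moreover have "synth (?m k) (?h k) = synth (n k) (g k) + synth (n' k) (g' k)" for k
    using synth_mono[OF g, of k "?m k"] synth_mono[OF g', of k "?m k"] by (simp add: synth_add)
  then have "(\<lambda>k. synth (?m k) (?h k)) \<longlonglongrightarrow> v + v'" using tendsto_add[OF lim(2) lim'(2)] by simp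
  ultimately show ?thesis
    using sq_integrable_add[OF f f'] h by (intro synth_relI)
qed

lemma synth_rel_scale:
  assumes "synth_rel f v" shows "synth_rel (\<lambda>x. c * f x) (c *\<^sub>C v)"
proof -
  obtain n g where f: "f \<in> sq_integrable \<mu>" and g: "\<And>k. cylinder_fun N (n k) (g k)"
    and lim: "(\<lambda>k. sqnorm \<mu> (\<lambda>x. f x - g k x)) \<longlonglongrightarrow> 0" "(\<lambda>k. synth (n k) (g k)) \<longlonglongrightarrow> v"
    using assms unfolding synth_rel_def by blast
  have h: "cylinder_fun N (n k) (\<lambda>x. c * g k x)" for k using g by (rule cylinder_fun_comp)
  have "(\<lambda>k. sqnorm \<mu> (\<lambda>x. c * f x - c * g k x)) \<longlonglongrightarrow> 0"
    using tendsto_mult_left[OF lim(1), of "(cmod c)\<^sup>2"]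
    by (simp flip: sqnorm_scale right_diff_distrib)
  moreover have "(\<lambda>k. synth (n k) (\<lambda>x. c * g k x)) \<longlonglongrightarrow> c *\<^sub>C v"
    unfolding synth_scale using lim(2) by (rule tendsto_scaleC)
  ultimately show ?thesis
    using sq_integrable_scale[OF f, of c] h by (intro synth_relI)
qed

text \<open>By linearity \<open>v - v'\<close> is related to \<open>f - f\<close>, whose squared
  seminorm is 0.\<close>

lemma synth_rel_unique:
  assumes "synth_rel f v" "synth_rel f v'" shows "v = v'"
proof -
  have "(norm (v - v'))\<^sup>2 = 0"
    using synth_rel_norm[OF synth_rel_add[OF assms(1) synth_rel_scale[OF assms(2), of "-1"]]]
    by (simp add: sqnorm_def)
  then show ?thesis by simp
qed

lemma synth_rel_total:
  assumes f: "f \<in> sq_integrable \<mu>"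
  obtains v where "synth_rel f v"
proof -
  obtain n g where g: "\<And>k. cylinder_fun N (n k) (g k)"
    and lim: "(\<lambda>k. sqnorm \<mu> (\<lambda>x. f x - g k x)) \<longlonglongrightarrow> 0"
    by (rule cylinder_fun_seq[OF f]) (rule that)
  have sq: "g k \<in> sq_integrable \<mu>" for k using g by (rule cylinder_fun_sq_integrable)
  have "Cauchy (\<lambda>k. synth (n k) (g k))"
  proof (rule metric_CauchyI)
    fix e :: real assume "e > 0"
    \<comment> \<open>Two errors below \<open>e\<^sup>2 / 4\<close>, each doubled by
      \<open>sqnorm_triangle\<close>, add up to less than \<open>e\<^sup>2\<close>.\<close>
    then have "e\<^sup>2 / 4 > 0" by simp
    from order_tendstoD(2)[OF lim this] obtain K
      where K: "\<And>k. k \<ge> K \<Longrightarrow> sqnorm \<mu> (\<lambda>x. f x - g k x) < e\<^sup>2 / 4"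
      by (auto simp: eventually_sequentially)
    have "dist (synth (n k) (g k)) (synth (n l) (g l)) < e" if "k \<ge> K" "l \<ge> K" for k l
    proof -
      have "(norm (synth (n k) (g k) - synth (n l) (g l)))\<^sup>2 = sqnorm \<mu> (\<lambda>x. g k x - g l x)"
        by (rule synth_diff_norm[OF g g])
      also have "\<dots> \<le> 2 * sqnorm \<mu> (\<lambda>x. g k x - f x) + 2 * sqnorm \<mu> (\<lambda>x. f x - g l x)"
        by (rule sqnorm_triangle[OF sq f sq])
      also have "\<dots> < e\<^sup>2"
        using K[OF that(1)] K[OF that(2)] sqnorm_diff_commute[of \<mu> "g k" f] by linarith
      finally show ?thesis
        using \<open>e > 0\<close> by (simp add: dist_norm power_less_imp_less_base)
    qed
    then show "\<exists>M. \<forall>k\<ge>M. \<forall>l\<ge>M. dist (synth (n k) (g k)) (synth (n l) (g l)) < e" by blast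
  qed
  then obtain v where "(\<lambda>k. synth (n k) (g k)) \<longlonglongrightarrow> v"
    by (auto simp: Cauchy_convergent_iff convergent_def)
  with f g lim have "synth_rel f v" by (intro synth_relI)
  then show ?thesis by (rule that)
qed

lemma synth_indicator:
  assumes "set I \<subseteq> {..<N}"
  shows "synth (length I) (indicator (cylinder N I)) = word_proj S I \<phi>"
proof -
  have "synth (length I) (indicator (cylinder N I)) =
      (\<Sum>J\<in>words N (length I). if J = I then word_proj S J \<phi> else 0)"
    unfolding synth_def
    by (intro sum.cong refl)
      (auto simp: indicator_def mem_cylinder_eq[OF pad_infinite_words[OF N_pos]] prefix_pad length_words)
  also have "\<dots> = word_proj S I \<phi>" using words_lengthI[OF assms] by simp
  finally show ?thesis .
qed

text \<open>The generators come from indicators of cylinders, and sums are formed after passing to a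
  common level.\<close>

lemma cspan_subset_synth:
  "cspan {word_proj S I \<phi> | I. set I \<subseteq> {..<N}} \<subseteq> {synth n g | n g. cylinder_fun N n g}"
proof (rule complex_vector.span_minimal)
  show "{word_proj S I \<phi> | I. set I \<subseteq> {..<N}} \<subseteq> {synth n g | n g. cylinder_fun N n g}"
  proof safe
    fix I assume "set I \<subseteq> {..<N}"
    then show "\<exists>n g. word_proj S I \<phi> = synth n g \<and> cylinder_fun N n g"
      using synth_indicator cylinder_fun_indicator by metis
  qed
  show "complex_vector.subspace {synth n g | n g. cylinder_fun N n g}"
  proof (rule complex_vector.subspaceI)
    show "0 \<in> {synth n g | n g. cylinder_fun N n g}"
      using cylinder_fun_const[of N 0 0] synth_def[of 0 "\<lambda>_. 0"] by fastforce
  next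
    fix x y assume "x \<in> {synth n g | n g. cylinder_fun N n g}" "y \<in> {synth n g | n g. cylinder_fun N n g}"
    then obtain n g m h where *: "cylinder_fun N n g" "x = synth n g" "cylinder_fun N m h" "y = synth m h"
      by blast
    have "cylinder_fun N (max n m) (\<lambda>x. g x + h x)"
      using cylinder_fun_mono[OF *(1) max.cobounded1 N_pos] cylinder_fun_mono[OF *(3) max.cobounded2 N_pos]
      by (rule cylinder_fun_comp2)
    moreover have "x + y = synth (max n m) (\<lambda>x. g x + h x)"
      using synth_mono[OF *(1), of "max n m"] synth_mono[OF *(3), of "max n m"] *
      by (simp add: synth_add)
    ultimately show "x + y \<in> {synth n g | n g. cylinder_fun N n g}" by blast
  next
    fix c x assume "x \<in> {synth n g | n g. cylinder_fun N n g}"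
    then obtain n g where "cylinder_fun N n g" "x = synth n g" by blast
    then show "c *\<^sub>C x \<in> {synth n g | n g. cylinder_fun N n g}"
      using synth_scale[of n c g, symmetric] cylinder_fun_comp[of N n g "\<lambda>z. c * z"] by blast
  qed
qed

text \<open>By cyclicity \<open>v\<close> is a limit of values of \<open>synth\<close>. As
  \<open>synth\<close> is isometric, the underlying cylinder functions are Cauchy in L2(\<mu>), and
  \<open>L2_complete\<close> provides the preimage.\<close>

lemma synth_rel_surj:
  obtains f where "synth_rel f v"
proof -
  have "v \<in> closure (cspan {word_proj S I \<phi> | I. set I \<subseteq> {..<N}})" by (simp add: cyclic)
  then obtain x where x: "\<And>k. x k \<in> cspan {word_proj S I \<phi> | I. set I \<subseteq> {..<N}}" "x \<longlonglongrightarrow> v"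
    unfolding closure_sequential by blast
  have "\<exists>n g. cylinder_fun N n g \<and> x k = synth n g" for k
    using x(1)[of k] cspan_subset_synth by blast
  then obtain n g where g: "\<And>k. cylinder_fun N (n k) (g k)" and xk: "\<And>k. x k = synth (n k) (g k)"
    by metis
  have sq: "g k \<in> sq_integrable \<mu>" for k using g by (rule cylinder_fun_sq_integrable)
  obtain f where f: "f \<in> sq_integrable \<mu>" "(\<lambda>k. sqnorm \<mu> (\<lambda>x. f x - g k x)) \<longlonglongrightarrow> 0"
  proof (rule L2_complete[OF sq])
    fix e :: real assume "e > 0"
    then have "sqrt e > 0" by simp
    then obtain K where K: "\<And>k l. k \<ge> K \<Longrightarrow> l \<ge> K \<Longrightarrow> dist (x k) (x l) < sqrt e"
      using LIMSEQ_imp_Cauchy[OF x(2)] unfolding Cauchy_def by blast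
    have "sqnorm \<mu> (\<lambda>x. g k x - g l x) < e" if "k \<ge> K" "l \<ge> K" for k l
    proof -
      have "sqnorm \<mu> (\<lambda>x. g k x - g l x) = (norm (x k - x l))\<^sup>2"
        unfolding xk by (rule synth_diff_norm[OF g g, symmetric])
      also have "\<dots> < (sqrt e)\<^sup>2"
        using K[OF that] by (intro power_strict_mono) (simp_all add: dist_norm)
      finally show ?thesis using \<open>e > 0\<close> by simp
    qed
    then show "\<exists>K. \<forall>k\<ge>K. \<forall>l\<ge>K. sqnorm \<mu> (\<lambda>x. g k x - g l x) < e" by blast
  qed (rule that)
  have "synth_rel f v"
    using f g x(2) unfolding xk by (intro synth_relI)
  then show ?thesis by (rule that)
qed

definition spectral :: "((nat \<Rightarrow> nat) \<Rightarrow> complex) \<Rightarrow> 'h"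
  where "spectral f = (THE v. synth_rel f v)"

lemma spectral_eqI: "synth_rel f v \<Longrightarrow> spectral f = v"
  unfolding spectral_def using synth_rel_unique by blast

lemma synth_rel_spectral: "f \<in> sq_integrable \<mu> \<Longrightarrow> synth_rel f (spectral f)"
  using synth_rel_total spectral_eqI by metis

lemma spectral_unitary: "L2_unitary \<mu> spectral"
  unfolding L2_unitary_def
proof (intro conjI ballI allI)
  show "spectral ` sq_integrable \<mu> = UNIV"
  proof (intro equalityI subsetI)
    fix v
    obtain f where "synth_rel f v" by (rule synth_rel_surj)
    then show "v \<in> spectral ` sq_integrable \<mu>"
      using spectral_eqI unfolding synth_rel_def by blast
  qed simp
qed (simp_all add: spectral_eqI synth_rel_add synth_rel_scale synth_rel_norm synth_rel_spectral)

lemma spectral_cylinder_fun: "cylinder_fun N n g \<Longrightarrow> spectral g = synth n g"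
  by (rule spectral_eqI) (rule synth_rel_cylinder_fun)

text \<open>For \<open>J\<close> at least as long as \<open>I\<close>, \<open>word_proj S I\<close>
  keeps or kills \<open>word_proj S J \<phi>\<close> according to whether \<open>I\<close> is a
  prefix of \<open>J\<close>, just as the indicator does with the cylinder of \<open>J\<close>. This
  settles cylinder functions, taken at a level at least \<open>length I\<close>; both sides are
  contractions in \<open>f\<close>, so limits give the rest.\<close>

lemma word_proj_spectral:
  assumes I: "set I \<subseteq> {..<N}" and f: "f \<in> sq_integrable \<mu>"
  shows "word_proj S I (spectral f) = spectral (\<lambda>x. indicator (cylinder N I) x * f x)"
proof -
  have cyl: "word_proj S I (spectral g) = spectral (\<lambda>x. indicator (cylinder N I) x * g x)"
    if "cylinder_fun N n g" for n g
  proof -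
    let ?k = "max n (length I)"
    have g: "cylinder_fun N ?k g" using that max.cobounded1 N_pos by (rule cylinder_fun_mono)
    have "cylinder_fun N ?k (indicator (cylinder N I) :: _ \<Rightarrow> complex)"
      using cylinder_fun_indicator max.cobounded2 N_pos by (rule cylinder_fun_mono)
    then have Ig: "cylinder_fun N ?k (\<lambda>x. indicator (cylinder N I) x * g x)"
      using g by (rule cylinder_fun_comp2)
    have "word_proj S I (synth ?k g) = (\<Sum>J\<in>words N ?k. g (pad J) *\<^sub>C word_proj S I (word_proj S J \<phi>))"
      unfolding synth_def word_proj_sum[OF I] word_proj_scaleC[OF I] ..
    also have "\<dots> = synth ?k (\<lambda>x. indicator (cylinder N I) x * g x)"
      unfolding synth_def
    proof (intro sum.cong refl)
      fix J assume J: "J \<in> words N ?k"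
      have "take (length I) J = prefix (length I) (pad J)"
        using J prefix_pad_prefix[of "length I" ?k "pad J"] prefix_pad[of J ?k]
        by (auto simp: length_words pad_def intro!: nth_equalityI)
      then have "pad J \<in> cylinder N I \<longleftrightarrow> take (length I) J = I"
        using mem_cylinder_eq[OF pad_infinite_words[OF N_pos J] refl] by metis
      then show "g (pad J) *\<^sub>C word_proj S I (word_proj S J \<phi>) =
          (indicator (cylinder N I) (pad J) * g (pad J)) *\<^sub>C word_proj S J \<phi>"
        using word_proj_word_proj[of I J] I J by (simp add: words_def indicator_def)
    qed
    finally show ?thesis by (simp add: spectral_cylinder_fun[OF g] spectral_cylinder_fun[OF Ig])
  qed
  obtain n g where g: "\<And>k. cylinder_fun N (n k) (g k)"
    and lim: "(\<lambda>k. sqnorm \<mu> (\<lambda>x. f x - g k x)) \<longlonglongrightarrow> 0"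
    by (rule cylinder_fun_seq[OF f]) (rule that)
  have sq: "g k \<in> sq_integrable \<mu>" for k using g by (rule cylinder_fun_sq_integrable)
  let ?i = "\<lambda>x. indicator (cylinder N I) x :: complex"
  have isq: "(\<lambda>x. ?i x * h x) \<in> sq_integrable \<mu>" if "h \<in> sq_integrable \<mu>" for h
    using that by (intro mult_indicator_sq_integrable) auto
  have "(\<lambda>k. sqnorm \<mu> (\<lambda>x. ?i x * f x - ?i x * g k x)) \<longlonglongrightarrow> 0"
  proof (rule Lim_null_comparison[OF always_eventually lim], rule allI)
    fix k
    have "sqnorm \<mu> (\<lambda>x. ?i x * f x - ?i x * g k x) \<le> sqnorm \<mu> (\<lambda>x. f x - g k x)"
      unfolding sqnorm_def
      by (rule integral_mono[OF sq_integrable_integrable[OF sq_integrable_diff[OF isq[OF f] isq[OF sq]]]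
            sq_integrable_integrable[OF sq_integrable_diff[OF f sq]]])
        (simp add: indicator_def)
    then show "norm (sqnorm \<mu> (\<lambda>x. ?i x * f x - ?i x * g k x)) \<le> sqnorm \<mu> (\<lambda>x. f x - g k x)"
      by (simp add: sqnorm_nonneg)
  qed
  then have "(\<lambda>k. spectral (\<lambda>x. ?i x * g k x)) \<longlonglongrightarrow> spectral (\<lambda>x. ?i x * f x)"
    by (rule L2_unitary_tendsto[OF spectral_unitary isq[OF f] isq[OF sq]])
  moreover have "(\<lambda>k. word_proj S I (spectral (g k))) \<longlonglongrightarrow> word_proj S I (spectral f)"
    by (intro word_proj_tendsto I L2_unitary_tendsto[OF spectral_unitary f sq lim])
  ultimately show ?thesis
    unfolding cyl[OF g] by (rule LIMSEQ_unique[rotated])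
qed

end

section \<open>The weight functions and the monic system they form\<close>

context cyclic_cuntz
begin

definition weight :: "nat \<Rightarrow> (nat \<Rightarrow> nat) \<Rightarrow> complex"
  where "weight i = (SOME f. f \<in> sq_integrable \<mu> \<and> spectral f = S i \<phi>)"

lemma weight: "weight i \<in> sq_integrable \<mu>" "spectral (weight i) = S i \<phi>"
proof -
  have "\<exists>f. f \<in> sq_integrable \<mu> \<and> spectral f = S i \<phi>"
    using L2_unitary_surj[OF spectral_unitary] by metis
  from someI_ex[OF this] show "weight i \<in> sq_integrable \<mu>" "spectral (weight i) = S i \<phi>"
    unfolding weight_def by auto
qed

lemma weight_measurable [measurable]: "weight i \<in> borel_measurable \<mu>"
  using weight(1) by (rule sq_integrable_measurable)

lemma word_proj_S:
  assumes "i < N" "j < N" "set I \<subseteq> {..<N}"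
  shows "word_proj S (j # I) (S i x) = (if i = j then S i (word_proj S I x) else 0)"
proof -
  have "word_proj S I 0 = 0" using word_proj_scaleC[OF assms(3), of 0 0] by simp
  then show ?thesis
    using assms linear_isometry_zero[OF isometry] by (simp add: word_proj_Cons cadjoint_S)
qed

text \<open>The projection of the one-letter word \<open>[i]\<close> fixes the range of
  \<open>S i\<close>, and on functions it is multiplication by the indicator.\<close>

lemma weight_vanishes:
  assumes i: "i < N"
  shows "AE x in \<mu>. indicator (cylinder N [i]) x * weight i x = weight i x"
proof -
  have "spectral (\<lambda>x. indicator (cylinder N [i]) x * weight i x) = word_proj S [i] (S i \<phi>)"
    using word_proj_spectral[of "[i]" "weight i"] i weight by simp
  also have "\<dots> = spectral (weight i)"
    using word_proj_S[of i i "[]"] i weight by simp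
  finally show ?thesis
    using L2_unitary_eq_iff[OF spectral_unitary mult_indicator_sq_integrable[OF cylinder_sets weight(1)]
        weight(1)] by blast
qed

text \<open>As \<open>weight i\<close> lives on the cylinder of \<open>i\<close>, the factor at the
  shifted word amounts to the indicator of the cylinder of \<open>i # J\<close>, that is, to the
  projection of \<open>i # J\<close>. Applied after \<open>S i\<close>, this projection is
  \<open>S i\<close> applied after the projection of \<open>J\<close>.\<close>

lemma weight_cylinder:
  assumes i: "i < N" and J: "set J \<subseteq> {..<N}"
  shows "(\<lambda>x. weight i x * indicator (cylinder N J) (shift x)) \<in> sq_integrable \<mu>"
    and "spectral (\<lambda>x. weight i x * indicator (cylinder N J) (shift x)) = S i (word_proj S J \<phi>)"
proof -
  have sq: "(\<lambda>x. indicator (cylinder N (i # J)) x * weight i x) \<in> sq_integrable \<mu>"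
    by (rule mult_indicator_sq_integrable[OF cylinder_sets weight(1)])
  show sq': "(\<lambda>x. weight i x * indicator (cylinder N J) (shift x)) \<in> sq_integrable \<mu>"
  proof (rule sq_integrable_dominated[OF weight(1), of _ 1])
    show "(\<lambda>x. weight i x * indicator (cylinder N J) (shift x)) \<in> borel_measurable \<mu>"
      by measurable
  qed (auto simp: indicator_def)
  have "AE x in \<mu>. weight i x * indicator (cylinder N J) (shift x) = indicator (cylinder N (i # J)) x * weight i x"
    using weight_vanishes[OF i] AE_space
    by eventually_elim
      (auto simp: indicator_def space_eq mem_cylinder_Cons[of _ N i J] mem_cylinder_singleton split: if_splits)
  then have "spectral (\<lambda>x. weight i x * indicator (cylinder N J) (shift x)) =
      spectral (\<lambda>x. indicator (cylinder N (i # J)) x * weight i x)"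
    using L2_unitary_eq_iff[OF spectral_unitary sq' sq] by blast
  also have "\<dots> = S i (word_proj S J \<phi>)"
    using word_proj_spectral[of "i # J" "weight i"] word_proj_S[of i i J] i J weight by simp
  finally show "spectral (\<lambda>x. weight i x * indicator (cylinder N J) (shift x)) = S i (word_proj S J \<phi>)" .
qed

text \<open>On the cylinder of \<open>i # J\<close> both sides have the mass
  \<open>(norm (word_proj S J \<phi>))\<^sup>2\<close>, and on the cylinder of a word starting with
  another letter the mass 0.\<close>

lemma density_weight:
  assumes i: "i < N"
  shows "density \<mu> (\<lambda>x. ennreal ((cmod (weight i x))\<^sup>2)) = distr \<mu> \<mu> (prepend i)"
proof (rule measure_eqI_cylinders[OF N_pos])
  have [measurable]: "prepend i \<in> \<mu> \<rightarrow>\<^sub>M \<mu>" using i by (rule prepend_measurable)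
  have dens: "emeasure (density \<mu> (\<lambda>x. ennreal ((cmod (weight i x))\<^sup>2))) (cylinder N I) =
      ennreal ((norm (word_proj S I (S i \<phi>)))\<^sup>2)" if I: "set I \<subseteq> {..<N}" for I
  proof -
    have sq: "(\<lambda>x. indicator (cylinder N I) x * weight i x) \<in> sq_integrable \<mu>"
      by (rule mult_indicator_sq_integrable[OF cylinder_sets weight(1)])
    have "emeasure (density \<mu> (\<lambda>x. ennreal ((cmod (weight i x))\<^sup>2))) (cylinder N I) =
        (\<integral>\<^sup>+x. ennreal ((cmod (weight i x))\<^sup>2) * indicator (cylinder N I) x \<partial>\<mu>)"
      by (rule emeasure_density) auto
    also have "\<dots> = (\<integral>\<^sup>+x. ennreal ((cmod (indicator (cylinder N I) x * weight i x))\<^sup>2) \<partial>\<mu>)"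
      by (intro nn_integral_cong) (simp add: indicator_def)
    also have "\<dots> = ennreal (sqnorm \<mu> (\<lambda>x. indicator (cylinder N I) x * weight i x))"
      unfolding sqnorm_def by (rule nn_integral_eq_integral[OF sq_integrable_integrable[OF sq]]) simp
    finally show ?thesis
      using L2_unitary_norm[OF spectral_unitary sq] word_proj_spectral[OF I weight(1)[of i]] weight(2)[of i]
      by simp
  qed
  have meas: "emeasure \<mu> (cylinder N I) = ennreal ((norm (word_proj S I \<phi>))\<^sup>2)" if "set I \<subseteq> {..<N}" for I
    using measure_cylinder[OF that] by (simp add: emeasure_eq_measure)
  fix I assume I: "set I \<subseteq> {..<N}"
  have distr: "emeasure (distr \<mu> \<mu> (prepend i)) (cylinder N I) = emeasure \<mu> (prepend i -` cylinder N I \<inter> space \<mu>)"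
    by (rule emeasure_distr) auto
  show "emeasure (density \<mu> (\<lambda>x. ennreal ((cmod (weight i x))\<^sup>2))) (cylinder N I) =
      emeasure (distr \<mu> \<mu> (prepend i)) (cylinder N I)"
  proof (cases I)
    \<comment> \<open>The empty word has no first letter to compare; the total masses agree because
      \<open>S i\<close> preserves the norm of \<phi>.\<close>
    case Nil
    have "prepend i -` cylinder N [] \<inter> space \<mu> = cylinder N []"
      using i by (auto simp: cylinder_Nil space_eq prepend_infinite_words)
    then show ?thesis
      using dens[OF I] meas[of "[]"] Nil unfolding distr
      by (simp add: linear_isometry_norm[OF isometry[OF i]])
  next
    case (Cons j J)
    then have j: "j < N" "set J \<subseteq> {..<N}" using I by auto
    have "prepend i -` cylinder N I \<inter> space \<mu> = (if i = j then cylinder N J else {})"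
      using mem_cylinder_prepend[OF i, of _ j J] cylinder_subset[of N J] Cons by (auto simp: space_eq)
    then show ?thesis
      unfolding distr dens[OF I] using meas[OF j(2)] word_proj_S[OF i j, of \<phi>] Cons
        linear_isometry_norm[OF isometry[OF i]]
      by (cases "i = j") simp_all
  qed
next
  have "(\<integral>\<^sup>+x. ennreal ((cmod (weight i x))\<^sup>2) \<partial>\<mu>) < \<infinity>"
    using sq_integrable_integrable[OF weight(1), of i] by (simp add: integrable_iff_bounded)
  then show "finite_measure (density \<mu> (\<lambda>x. ennreal ((cmod (weight i x))\<^sup>2)))"
    by (intro finite_measureI) (simp add: emeasure_density cong: nn_integral_cong)
qed (simp_all add: sets_eq)

text \<open>Change of variables along \<open>prepend i\<close>, which \<open>shift\<close> undoes.
  \<open>nn_integral_monic_system\<close> cannot serve here: it presupposes a monic system, and the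
  nonvanishing of \<open>weight i\<close> is itself proved by means of this formula.\<close>

lemma nn_integral_weight:
  assumes i: "i < N" and [measurable]: "h \<in> borel_measurable \<mu>"
  shows "(\<integral>\<^sup>+x. ennreal ((cmod (weight i x))\<^sup>2) * h (shift x) \<partial>\<mu>) = (\<integral>\<^sup>+x. h x \<partial>\<mu>)"
proof -
  have [measurable]: "prepend i \<in> \<mu> \<rightarrow>\<^sub>M \<mu>" using i by (rule prepend_measurable)
  have "(\<integral>\<^sup>+x. ennreal ((cmod (weight i x))\<^sup>2) * h (shift x) \<partial>\<mu>) =
      (\<integral>\<^sup>+x. h (shift x) \<partial>density \<mu> (\<lambda>x. ennreal ((cmod (weight i x))\<^sup>2)))"
    by (rule nn_integral_density[symmetric]) auto
  also have "\<dots> = (\<integral>\<^sup>+x. h x \<partial>\<mu>)"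
    unfolding density_weight[OF i] by (subst nn_integral_distr) auto
  finally show ?thesis .
qed

lemma weight_shift:
  assumes i: "i < N" and g: "g \<in> sq_integrable \<mu>"
  shows "(\<lambda>x. weight i x * g (shift x)) \<in> sq_integrable \<mu>"
    and "sqnorm \<mu> (\<lambda>x. weight i x * g (shift x)) = sqnorm \<mu> g"
proof -
  have [measurable]: "g \<in> borel_measurable \<mu>" using g by (rule sq_integrable_measurable)
  have eq: "(\<integral>\<^sup>+x. ennreal ((cmod (weight i x * g (shift x)))\<^sup>2) \<partial>\<mu>) = (\<integral>\<^sup>+x. ennreal ((cmod (g x))\<^sup>2) \<partial>\<mu>)"
    using nn_integral_weight[OF i, of "\<lambda>x. ennreal ((cmod (g x))\<^sup>2)"]
    by (simp add: norm_mult power_mult_distrib ennreal_mult)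
  have "(\<integral>\<^sup>+x. ennreal ((cmod (g x))\<^sup>2) \<partial>\<mu>) < \<infinity>"
    using sq_integrable_integrable[OF g] by (simp add: integrable_iff_bounded)
  with eq show "(\<lambda>x. weight i x * g (shift x)) \<in> sq_integrable \<mu>"
    by (simp add: sq_integrable_def integrable_iff_bounded)
  show "sqnorm \<mu> (\<lambda>x. weight i x * g (shift x)) = sqnorm \<mu> g"
    unfolding sqnorm_def using eq by (simp add: integral_eq_nn_integral)
qed

text \<open>Both sides depend isometrically on \<open>g\<close>, so they need only be compared on
  cylinder functions, where \<open>weight_cylinder\<close> applies term by term.\<close>

lemma S_spectral:
  assumes i: "i < N" and g: "g \<in> sq_integrable \<mu>"
  shows "S i (spectral g) = spectral (\<lambda>x. weight i x * g (shift x))"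
proof -
  have cyl: "S i (spectral h) = spectral (\<lambda>x. weight i x * h (shift x))"
    if h: "cylinder_fun N n h" for n h
  proof -
    let ?t = "\<lambda>J x. h (pad J) * (weight i x * indicator (cylinder N J) (shift x))"
    have t: "?t J \<in> sq_integrable \<mu>" if "J \<in> words N n" for J
      using that i by (intro sq_integrable_scale weight_cylinder) (auto simp: words_def)
    have "S i (spectral h) = (\<Sum>J\<in>words N n. h (pad J) *\<^sub>C S i (word_proj S J \<phi>))"
      unfolding spectral_cylinder_fun[OF h] synth_def linear_isometry_sum[OF isometry[OF i]]
        linear_isometry_scaleC[OF isometry[OF i]] ..
    also have "\<dots> = (\<Sum>J\<in>words N n. spectral (?t J))"
    proof (intro sum.cong refl)
      fix J assume "J \<in> words N n"
      then have "set J \<subseteq> {..<N}" by (simp add: words_def)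
      from weight_cylinder[OF i this]
      show "h (pad J) *\<^sub>C S i (word_proj S J \<phi>) = spectral (?t J)"
        by (simp add: L2_unitary_scale[OF spectral_unitary])
    qed
    also have "\<dots> = spectral (\<lambda>x. \<Sum>J\<in>words N n. ?t J x)"
      by (rule L2_unitary_sum[OF spectral_unitary, symmetric]) (rule t)
    also have "\<dots> = spectral (\<lambda>x. weight i x * h (shift x))"
    proof (rule iffD2[OF L2_unitary_eq_iff[OF spectral_unitary]])
      show "AE x in \<mu>. (\<Sum>J\<in>words N n. ?t J x) = weight i x * h (shift x)"
      proof (rule AE_I2)
        fix x assume "x \<in> space \<mu>"
        then have "shift x \<in> infinite_words N" by (simp add: space_eq infinite_words_eq shift_def)
        from cylinder_fun_expand[OF h this]
        show "(\<Sum>J\<in>words N n. ?t J x) = weight i x * h (shift x)"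
          by (simp only: sum_distrib_left mult.left_commute)
      qed
      show "(\<lambda>x. \<Sum>J\<in>words N n. ?t J x) \<in> sq_integrable \<mu>" by (rule sq_integrable_sum) (rule t)
      show "(\<lambda>x. weight i x * h (shift x)) \<in> sq_integrable \<mu>"
        by (rule weight_shift(1)[OF i cylinder_fun_sq_integrable[OF h]])
    qed
    finally show ?thesis .
  qed
  obtain n h where h: "\<And>k. cylinder_fun N (n k) (h k)"
    and lim: "(\<lambda>k. sqnorm \<mu> (\<lambda>x. g x - h k x)) \<longlonglongrightarrow> 0"
    by (rule cylinder_fun_seq[OF g]) (rule that)
  have sq: "h k \<in> sq_integrable \<mu>" for k using h by (rule cylinder_fun_sq_integrable)
  have "sqnorm \<mu> (\<lambda>x. weight i x * g (shift x) - weight i x * h k (shift x)) = sqnorm \<mu> (\<lambda>x. g x - h k x)" for k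
    using weight_shift(2)[OF i sq_integrable_diff[OF g sq[of k]]] by (simp add: right_diff_distrib)
  then have "(\<lambda>k. sqnorm \<mu> (\<lambda>x. weight i x * g (shift x) - weight i x * h k (shift x))) \<longlonglongrightarrow> 0"
    using lim by simp
  then have "(\<lambda>k. spectral (\<lambda>x. weight i x * h k (shift x))) \<longlonglongrightarrow> spectral (\<lambda>x. weight i x * g (shift x))"
    by (rule L2_unitary_tendsto[OF spectral_unitary weight_shift(1)[OF i g] weight_shift(1)[OF i sq]])
  moreover have "(\<lambda>k. S i (spectral (h k))) \<longlonglongrightarrow> S i (spectral g)"
    by (intro linear_isometry_tendsto[OF isometry[OF i]] L2_unitary_tendsto[OF spectral_unitary g sq lim])
  ultimately show ?thesis
    unfolding cyl[OF h] by (rule LIMSEQ_unique[rotated])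
qed

text \<open>The indicator of the zero set of \<open>weight i\<close> in the cylinder of \<open>i\<close> is orthogonal to the range
  of \<open>S i\<close>, but lies in it.\<close>
lemma weight_nonzero:
  assumes i: "i < N"
  shows "AE x in \<mu>. x \<in> cylinder N [i] \<longrightarrow> weight i x \<noteq> 0"
proof -
  define B where "B = {x \<in> space \<mu>. weight i x = 0} \<inter> cylinder N [i]"
  have B: "B \<in> sets \<mu>" unfolding B_def by measurable
  have sq: "(indicator B :: _ \<Rightarrow> complex) \<in> sq_integrable \<mu>" using B by (rule indicator_sq_integrable)
  have "cinner (cadjoint (S i) (spectral (indicator B))) y = 0" for y
  proof -
    obtain g where g: "g \<in> sq_integrable \<mu>" "spectral g = y" by (rule L2_unitary_surj[OF spectral_unitary])
    have "cinner (cadjoint (S i) (spectral (indicator B))) y =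
        (\<integral>x. cnj (indicator B x) * (weight i x * g (shift x)) \<partial>\<mu>)"
      unfolding cinner_cadjoint_left[OF isometry[OF i]] g(2)[symmetric] S_spectral[OF i g(1)]
      by (rule L2_unitary_cinner[OF spectral_unitary sq weight_shift(1)[OF i g(1)]])
    also have "\<dots> = (\<integral>x. 0 \<partial>\<mu>)"
      by (intro Bochner_Integration.integral_cong) (auto simp: B_def indicator_def)
    finally show ?thesis by simp
  qed
  then have "cadjoint (S i) (spectral (indicator B)) = 0"
    using cinner_self_eq_0 by blast
  then have "word_proj S [i] (spectral (indicator B)) = 0"
    using i linear_isometry_zero[OF isometry[OF i]] by (simp add: word_proj_Cons)
  moreover have "word_proj S [i] (spectral (indicator B)) = spectral (indicator B)"
  proof -
    have "(\<lambda>x. indicator (cylinder N [i]) x * indicator B x) = (indicator B :: _ \<Rightarrow> complex)"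
      by (auto simp: B_def indicator_def)
    then show ?thesis using word_proj_spectral[OF _ sq, of "[i]"] i by simp
  qed
  ultimately have "sqnorm \<mu> (indicator B) = 0"
    using L2_unitary_norm[OF spectral_unitary sq] by simp
  then have "AE x in \<mu>. (indicator B x :: complex) = 0"
    using sqnorm_eq_0[OF sq] by simp
  then show ?thesis
    using AE_space by eventually_elim (auto simp: B_def indicator_def split: if_splits)
qed

lemma monic_system_weight: "monic_system N \<mu> weight"
  unfolding monic_system_def
proof (intro conjI allI impI)
  show "finite_measure \<mu>" "sets \<mu> = sets (word_borel N)" by (rule finite_measure_axioms, rule sets_eq)
  fix i assume i: "i < N"
  show "weight i \<in> sq_integrable \<mu>" by (rule weight)
  show "absolutely_continuous \<mu> (distr \<mu> \<mu> (prepend i))"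
    unfolding density_weight[OF i, symmetric] by (rule absolutely_continuousI_density) simp
  have "finite_measure (distr \<mu> \<mu> (prepend i))"
    using prepend_measurable[OF i] by (rule finite_measure_distr)
  then have "sigma_finite_measure (distr \<mu> \<mu> (prepend i))"
    by (simp add: finite_measure_def)
  \<comment> \<open>\<open>density_weight\<close> exhibits the squared modulus as a density of the
    push-forward, and densities are unique almost everywhere.\<close>
  then have "AE x in \<mu>. ennreal ((cmod (weight i x))\<^sup>2) = RN_deriv \<mu> (distr \<mu> \<mu> (prepend i)) x"
    by (intro RN_deriv_unique_sigma_finite density_weight[OF i]) simp
  then show "AE x in \<mu>. RN_deriv \<mu> (distr \<mu> \<mu> (prepend i)) x = ennreal ((cmod (weight i x))\<^sup>2)"
    by eventually_elim simp
  show "AE x in \<mu>. x \<in> prepend i ` infinite_words N \<longrightarrow> weight i x \<noteq> 0"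
    using weight_nonzero[OF i] prepend_image[OF i] by simp
qed

end

lemma monic_system_of_monic_rep:
  fixes S :: "nat \<Rightarrow> 'h::chilbert_space \<Rightarrow> 'h"
  assumes N: "0 < N" and "cuntz_rep N S" and "monic_rep N S"
  obtains \<mu> F V where "monic_system N \<mu> F" "L2_unitary \<mu> V"
    "\<And>i g. i < N \<Longrightarrow> g \<in> sq_integrable \<mu> \<Longrightarrow> S i (V g) = V (\<lambda>x. F i x * g (shift x))"
proof -
  interpret cuntz N S by unfold_locales fact
  obtain \<phi> where \<phi>: "closure (cspan {word_proj S I \<phi> | I. set I \<subseteq> {..<N}}) = UNIV"
    using assms(3) by (auto simp: monic_rep_def word_proj_def)
  obtain \<mu> where \<mu>: "finite_measure \<mu>" "sets \<mu> = sets (word_borel N)"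
    "\<And>I. set I \<subseteq> {..<N} \<Longrightarrow> measure \<mu> (cylinder N I) = (norm (word_proj S I \<phi>))\<^sup>2"
  proof (rule cylinder_measure_exists[OF N, of "\<lambda>I. (norm (word_proj S I \<phi>))\<^sup>2"])
    show "(norm (word_proj S I \<phi>))\<^sup>2 = (\<Sum>i<N. (norm (word_proj S (I @ [i]) \<phi>))\<^sup>2)"
      if "set I \<subseteq> {..<N}" for I
      using that by (rule word_proj_norm_refine)
  qed (simp_all add: that)
  interpret finite_measure \<mu> by fact
  interpret cyclic_cuntz N S \<mu> \<phi>
    by unfold_locales (use N \<mu> \<phi> in auto)
  show ?thesis
    using monic_system_weight spectral_unitary S_spectral by (rule that)
qed

theorem theorem2p7:
  fixes N :: nat and S :: "nat \<Rightarrow> 'h::chilbert_space \<Rightarrow> 'h"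
  assumes "N \<ge> 2" and "cuntz_rep N S"
  shows "monic_rep N S \<longleftrightarrow>
    (\<exists>\<mu> f. monic_system N \<mu> f \<and>
       unitarily_equivalent N type_space S (L2 \<mu>) (monic_system_op \<mu> f))"
proof
  have N: "0 < N" using assms(1) by simp
  {
    assume "monic_rep N S"
    then obtain \<mu> F and V :: "((nat \<Rightarrow> nat) \<Rightarrow> complex) \<Rightarrow> 'h" where F: "monic_system N \<mu> F"
      and "L2_unitary \<mu> V"
      "\<And>i g. i < N \<Longrightarrow> g \<in> sq_integrable \<mu> \<Longrightarrow> S i (V g) = V (\<lambda>x. F i x * g (shift x))"
      by (rule monic_system_of_monic_rep[OF N assms(2)]) (rule that)
    then have "unitarily_equivalent N type_space S (L2 \<mu>) (monic_system_op \<mu> F)"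
      unfolding unitarily_equivalent_L2_iff[OF F] by (intro exI[of _ V]) simp
    with F show "\<exists>\<mu> f. monic_system N \<mu> f \<and>
        unitarily_equivalent N type_space S (L2 \<mu>) (monic_system_op \<mu> f)"
      by (intro exI conjI)
  next
    assume "\<exists>\<mu> f. monic_system N \<mu> f \<and>
        unitarily_equivalent N type_space S (L2 \<mu>) (monic_system_op \<mu> f)"
    then obtain \<mu> F where F: "monic_system N \<mu> F"
      and "unitarily_equivalent N type_space S (L2 \<mu>) (monic_system_op \<mu> F)" by (elim exE conjE)
    then obtain V where "L2_unitary \<mu> V"
      "\<And>i g. i < N \<Longrightarrow> g \<in> sq_integrable \<mu> \<Longrightarrow> S i (V g) = V (\<lambda>x. F i x * g (shift x))"
      unfolding unitarily_equivalent_L2_iff[OF F] by (elim exE conjE) simp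
    then show "monic_rep N S" by (rule monic_rep_of_monic_system[OF N assms(2) F])
  }
qed

end
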